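(* Let $n=1$. For the given $1$-dimensional Sturm-Liouville equation and every $j\ge1$: (1) $\lambda_j(\Sigma_0)=(\lambda_{j-2}(\Lambda_D),\lambda_j(\Lambda_D))$; (2) $\lambda_1(\Sigma_1)=(-\infty,\lambda_1(\Lambda_D)]$, and $\lambda_j(\Sigma_1)=[\lambda_{j-1}(\Lambda_D),\lambda_j(\Lambda_D)]$ if $j\ge2$; (3) $\lambda_j(\Sigma_2)=\{\lambda_j(\Lambda_D)\}$. Here $\lambda_j(S)=\{\lambda_j(\Lambda):\Lambda\in S\}$ and $\lambda_i(\Lambda_D):=-\infty$ for $i\le0$.
   Context: Setting (with $n=1$). Let $T>0$, $P,Q\in H^1([0,T],\mathbf R)$, $R\in C([0,T],\mathbf R)$, with $P(t)>0$ for all $t\in[0,T]$. For $x:[0,T]\to\mathbf C$ put $y=P\dot x+Qx$ and $z=(y,x)^T$. Let $\mathcal Ax=-\frac{d}{dt}(P\dot x+Qx)+Q\dot x+Rx$. Let $J_1=\begin{bmatrix}0&-1\\ 1&0\end{bmatrix}$, $\omega_1(u,v)=\langle J_1u,v\rangle$ on $\mathbf C^{2}$ (standard Hermitian product), and $(\mathcal V,\Omega)=(\mathbf C^{2}\oplus\mathbf C^{2},-\omega_1\oplus\omega_1)$. $\mathrm{Lag}(\mathcal V,\Omega)$ is the set of complex subspaces $\Lambda\subset\mathcal V$ with $\Omega|_\Lambda=0$ and $\dim_{\mathbf C}\Lambda=2$. Vectors of $\mathcal V$ are written $(z(0),z(T))$ with $z(0)=(y(0),x(0))$, $z(T)=(y(T),x(T))$;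 the Dirichlet condition is $\Lambda_D=\{x(0)=x(T)=0\}$. For $\Lambda\in\mathrm{Lag}(\mathcal V,\Omega)$, $\mathcal A_\Lambda$ is the self-adjoint operator on $L^2([0,T],\mathbf C)$ acting as $\mathcal A$ with domain $\{x\in H^2([0,T],\mathbf C):(z(0),z(T))\in\Lambda\}$. Its spectrum is bounded below and consists of discrete eigenvalues, $\lambda_1(\Lambda)\le\lambda_2(\Lambda)\le\cdots$, counted with multiplicity. For $0\le r\le2$, the $r$-th layer is $\Sigma_r=\{\Lambda\in\mathrm{Lag}(\mathcal V,\Omega):\dim(\Lambda\cap\Lambda_D)=r\}$. *)

theory Defs
  imports "HOL-Analysis.Analysis" "HOL-Library.Function_Algebras"
begin

section \<open>Sobolev functions on an interval\<close>

text \<open>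
  On a bounded interval, \<open>H\<^sup>1\<close> consists of the functions that are primitives of their
  square-integrable weak derivative. We always work with this absolutely continuous
  representative, so that boundary values make sense. The weak derivative is unique only up to
  null sets, hence it is rendered as a relation.
\<close>

definition has_weak_deriv ::
    "real \<Rightarrow> (real \<Rightarrow> 'a::euclidean_space) \<Rightarrow> (real \<Rightarrow> 'a) \<Rightarrow> bool" where
  "has_weak_deriv T f g \<longleftrightarrow>
     g \<in> borel_measurable (lebesgue_on {0..T}) \<and>
     integrable (lebesgue_on {0..T}) (\<lambda>t. (norm (g t))\<^sup>2) \<and>
     (\<forall>t\<in>{0..T}. (g has_integral (f t - f 0)) {0..t})"

definition H1 :: "real \<Rightarrow> (real \<Rightarrow> 'a::euclidean_space) \<Rightarrow> bool" where
  "H1 T f \<longleftrightarrow> (\<exists>g. has_weak_deriv T f g)"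

definition H2 :: "real \<Rightarrow> (real \<Rightarrow> 'a::euclidean_space) \<Rightarrow> bool" where
  "H2 T f \<longleftrightarrow> (\<exists>g. has_weak_deriv T f g \<and> H1 T g)"

text \<open>
  An \<open>H\<^sup>2\<close> function is \<open>C\<^sup>1\<close> up to the boundary, so its first derivative is the classical
  one (one-sided at the end points).
\<close>

definition dot :: "real \<Rightarrow> (real \<Rightarrow> complex) \<Rightarrow> real \<Rightarrow> complex" where
  "dot T x t = vector_derivative x (at t within {0..T})"

definition quasi_deriv ::
    "real \<Rightarrow> (real \<Rightarrow> real) \<Rightarrow> (real \<Rightarrow> real) \<Rightarrow> (real \<Rightarrow> complex) \<Rightarrow> real \<Rightarrow> complex" where
  "quasi_deriv T P Q x t = of_real (P t) * dot T x t + of_real (Q t) * x t"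

text \<open>
  \<open>SL_maps T P Q R x w\<close> states \<open>\<A> x = w\<close> as an equation in \<open>L\<^sup>2([0,T])\<close>.
\<close>

definition SL_maps ::
    "real \<Rightarrow> (real \<Rightarrow> real) \<Rightarrow> (real \<Rightarrow> real) \<Rightarrow> (real \<Rightarrow> real) \<Rightarrow>
     (real \<Rightarrow> complex) \<Rightarrow> (real \<Rightarrow> complex) \<Rightarrow> bool" where
  "SL_maps T P Q R x w \<longleftrightarrow>
     (\<exists>h. has_weak_deriv T (quasi_deriv T P Q x) h \<and>
          (AE t in lebesgue_on {0..T}.
             - h t + of_real (Q t) * dot T x t + of_real (R t) * x t = w t))"


section \<open>The symplectic space of boundary values\<close>

type_synonym bvals = "(complex^2) \<times> (complex^2)"

definition bscale :: "complex \<Rightarrow> bvals \<Rightarrow> bvals" where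
  "bscale c v = (c *s fst v, c *s snd v)"

global_interpretation bvec: vector_space bscale
  by unfold_locales
     (auto simp: bscale_def vec_eq_iff algebra_simps)

definition hinner :: "complex^2 \<Rightarrow> complex^2 \<Rightarrow> complex" where
  "hinner u v = (\<Sum>i\<in>UNIV. u $ i * cnj (v $ i))"

definition J1 :: "complex^2^2" where
  "J1 = vector [vector [0, -1], vector [1, 0]]"

definition omega1 :: "complex^2 \<Rightarrow> complex^2 \<Rightarrow> complex" where
  "omega1 u v = hinner (J1 *v u) v"

definition Omega :: "bvals \<Rightarrow> bvals \<Rightarrow> complex" where
  "Omega v w = - omega1 (fst v) (fst w) + omega1 (snd v) (snd w)"

definition Lag :: "bvals set set" where
  "Lag = {\<Lambda>. bvec.subspace \<Lambda> \<and> (\<forall>v\<in>\<Lambda>. \<forall>w\<in>\<Lambda>. Omega v w = 0) \<and> bvec.dim \<Lambda> = 2}"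

text \<open>Coordinates are ordered as \<open>z = (y, x)\<close>, so the second component is the function value.\<close>

definition Lambda_D :: "bvals set" where
  "Lambda_D = {(z0, zT). z0 $ 2 = 0 \<and> zT $ 2 = 0}"

definition layer :: "nat \<Rightarrow> bvals set set" where
  "layer r = {\<Lambda> \<in> Lag. bvec.dim (\<Lambda> \<inter> Lambda_D) = r}"

definition zvec ::
    "real \<Rightarrow> (real \<Rightarrow> real) \<Rightarrow> (real \<Rightarrow> real) \<Rightarrow> (real \<Rightarrow> complex) \<Rightarrow> real \<Rightarrow> complex^2" where
  "zvec T P Q x t = vector [quasi_deriv T P Q x t, x t]"


section \<open>The operator with boundary condition and its eigenvalues\<close>

text \<open>
  A function on \<open>[0,T]\<close> is represented by its extension by zero to the real line. This makes
  the representation unique, so that dimensions of function spaces are the intended ones.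
\<close>

definition SL_dom ::
    "real \<Rightarrow> (real \<Rightarrow> real) \<Rightarrow> (real \<Rightarrow> real) \<Rightarrow> bvals set \<Rightarrow> (real \<Rightarrow> complex) set" where
  "SL_dom T P Q \<Lambda> =
     {x. (\<forall>t. t \<notin> {0..T} \<longrightarrow> x t = 0) \<and> H2 T x \<and> (zvec T P Q x 0, zvec T P Q x T) \<in> \<Lambda>}"

definition fscale :: "complex \<Rightarrow> (real \<Rightarrow> complex) \<Rightarrow> real \<Rightarrow> complex" where
  "fscale c f = (\<lambda>t. c * f t)"

global_interpretation fvec: vector_space fscale
  by unfold_locales (auto simp: fscale_def fun_eq_iff algebra_simps)

definition eigenspace ::
    "real \<Rightarrow> (real \<Rightarrow> real) \<Rightarrow> (real \<Rightarrow> real) \<Rightarrow> (real \<Rightarrow> real) \<Rightarrow> bvals set \<Rightarrow>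
     complex \<Rightarrow> (real \<Rightarrow> complex) set" where
  "eigenspace T P Q R \<Lambda> \<mu> = {x \<in> SL_dom T P Q \<Lambda>. SL_maps T P Q R x (\<lambda>t. \<mu> * x t)}"

text \<open>
  \<open>l 1 \<le> l 2 \<le> \<dots>\<close> lists all eigenvalues with multiplicity; the value \<open>l 0\<close> is irrelevant.
  Since \<open>\<mu>\<close> ranges over the complex numbers, this includes that all eigenvalues are real.
  Eigenspaces have dimension at most 2, so \<open>fvec.dim\<close> is not affected by its convention for
  infinite-dimensional spaces.
\<close>

definition eigenvalue_enumeration ::
    "real \<Rightarrow> (real \<Rightarrow> real) \<Rightarrow> (real \<Rightarrow> real) \<Rightarrow> (real \<Rightarrow> real) \<Rightarrow> bvals set \<Rightarrow>
     (nat \<Rightarrow> real) \<Rightarrow> bool" where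
  "eigenvalue_enumeration T P Q R \<Lambda> l \<longleftrightarrow>
     mono_on {1..} l \<and>
     (\<forall>\<mu>::complex. finite {j. j \<ge> 1 \<and> of_real (l j) = \<mu>} \<and>
        card {j. j \<ge> 1 \<and> of_real (l j) = \<mu>} = fvec.dim (eigenspace T P Q R \<Lambda> \<mu>))"

text \<open>For \<open>j \<ge> 1\<close> the value does not depend on the choice of the enumeration.\<close>

definition eigval ::
    "real \<Rightarrow> (real \<Rightarrow> real) \<Rightarrow> (real \<Rightarrow> real) \<Rightarrow> (real \<Rightarrow> real) \<Rightarrow> nat \<Rightarrow> bvals set \<Rightarrow> real" where
  "eigval T P Q R j \<Lambda> = (SOME l. eigenvalue_enumeration T P Q R \<Lambda> l) j"

definition dirichlet_eigval ::
    "real \<Rightarrow> (real \<Rightarrow> real) \<Rightarrow> (real \<Rightarrow> real) \<Rightarrow> (real \<Rightarrow> real) \<Rightarrow> int \<Rightarrow> ereal" where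
  "dirichlet_eigval T P Q R i =
     (if i \<le> 0 then -\<infinity> else ereal (eigval T P Q R (nat i) Lambda_D))"

definition eigval_range ::
    "real \<Rightarrow> (real \<Rightarrow> real) \<Rightarrow> (real \<Rightarrow> real) \<Rightarrow> (real \<Rightarrow> real) \<Rightarrow> nat \<Rightarrow> bvals set set \<Rightarrow>
     ereal set" where
  "eigval_range T P Q R j S = {ereal (eigval T P Q R j \<Lambda>) | \<Lambda>. \<Lambda> \<in> S}"

end

theory Submission
  imports Defs
begin

text \<open>
  Write \<open>m11, m12, m21, m22\<close> for the entries of the monodromy matrix at \<open>\<mu>\<close>, so that
  the Dirichlet eigenvalues are the zeros of \<open>m21\<close>. Away from them the boundary values
  \<open>X = (x(0), x(T))\<close> and \<open>Y = (- y(0), y(T))\<close> of solutions are related by \<open>Y = N X\<close> with the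
  symmetric matrix \<open>N = [[m22, -1], [-1, m11]] / m21\<close>. The form of \<open>N\<close> is strictly
  decreasing in \<open>\<mu>\<close> between consecutive Dirichlet eigenvalues, tends to \<open>+\<infinity>\<close> at \<open>-\<infinity>\<close>, and has
  a pole of rank one at each Dirichlet eigenvalue.

  A condition in the layer \<open>\<Sigma>\<^sub>0\<close> is \<open>Y = H X\<close> with \<open>H\<close> Hermitian, and its eigenvalues are
  the points where \<open>N - H\<close> is singular. The larger eigenvalue of \<open>N - H\<close> on
  \<open>(\<lambda>\<^sub>j\<^sub>-\<^sub>2(\<Lambda>\<^sub>D), \<lambda>\<^sub>j\<^sub>-\<^sub>1(\<Lambda>\<^sub>D))\<close> continues through \<open>\<lambda>\<^sub>j\<^sub>-\<^sub>1(\<Lambda>\<^sub>D)\<close> to the smaller one on the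
  next interval; the glued function decreases from \<open>+\<infinity>\<close> to \<open>-\<infinity>\<close>, and \<open>\<lambda>\<^sub>j\<close> is its zero. A
  condition in \<open>\<Sigma>\<^sub>1\<close> is \<open>X = s \<xi>\<close>, \<open>\<langle>Y, \<xi>\<rangle> = h s\<close>, and \<open>\<lambda>\<^sub>j\<close> is found from the scalar function
  \<open>\<langle>N \<xi>, \<xi>\<rangle> - h\<close> on \<open>(\<lambda>\<^sub>j\<^sub>-\<^sub>1(\<Lambda>\<^sub>D), \<lambda>\<^sub>j(\<Lambda>\<^sub>D))\<close>. Every value in the asserted ranges is attained by
  the graph of \<open>N\<close> at that value, or by a similar explicit condition at a pole.
\<close>

section \<open>Dimensions and enumerations\<close>

text \<open>No min-max principle enters. \<open>eigval\<close> picks an arbitrary enumeration, so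
  for each condition it suffices to exhibit one monotone sequence whose fibres have the size of the
  eigenspaces; \<open>enumeration_le\<close> makes such a sequence unique. The analysis rests on
  Lagrange's identity (y1 x2 - x1 y2)' = (\<mu>2 - \<mu>1) x1 x2, which gives uniqueness of
  solutions, simplicity of the zeros of \<open>m21\<close>, the derivative of the form of N and its
  limit at a pole. The obstacle is the Dirichlet eigenvalues: N does not exist there, but
  eigenvalues of other conditions may sit there. Since the monodromy matrix has determinant 1, det
  (N - H) has only a first-order pole, so one eigenvalue of N - H stays bounded while the other
  jumps from -infinity to +infinity. For a single vector \<xi> the numerator of the form vanishes at
  the pole only if \<xi> has one particular direction; only then is the pole an eigenvalue of the
  condition, possibly a double one.\<close>

context vector_space
begin

lemma span_pair_eq: "span {e, f} = {scale a e + scale b f |a b. True}"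
proof -
  have "x \<in> span {e, f} \<longleftrightarrow> (\<exists>k m. x - scale k e = scale m f)" for x
    by (simp add: span_insert span_singleton image_iff) 
  moreover have "x - scale k e = scale m f \<longleftrightarrow> x = scale k e + scale m f" for x k m
    by (auto simp: algebra_simps)
  ultimately show ?thesis
    by auto
qed

lemma independent_pairI:
  assumes "\<And>a b. scale a e + scale b f = 0 \<Longrightarrow> a = 0 \<and> b = 0"
  shows "e \<noteq> f" "independent {e, f}"
proof -
  show ne: "e \<noteq> f"
    using assms[of 1 "- 1"] by auto
  have "f \<noteq> 0"
    using assms[of 0 1] by auto
  moreover have "e \<notin> span {f}"
  proof
    assume "e \<in> span {f}"
    then obtain k where "e = scale k f"
      by (auto simp: span_singleton)
    then show False
      using assms[of 1 "- k"] by auto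
  qed
  ultimately show "independent {e, f}"
    using ne by (simp add: independent_insert)
qed

lemma dim_pair:
  assumes "\<And>a b. scale a e + scale b f = 0 \<Longrightarrow> a = 0 \<and> b = 0"
  shows "dim {scale a e + scale b f |a b. True} = 2"
proof -
  have "e \<noteq> f" "independent {e, f}"
    using independent_pairI[of e f] assms by blast+
  then show ?thesis
    using dim_span_eq_card_independent[of "{e, f}"] by (simp only: span_pair_eq) simp
qed

lemma dim_line:
  assumes "e \<noteq> 0"
  shows "dim (range (\<lambda>a. scale a e)) = 1"
  proof -
  have "independent {e}"
    using assms by simp
  then show ?thesis
    using dim_span_eq_card_independent[of "{e}"] by (simp only: span_singleton) simp
qed

lemma dim_zero: "dim {0} = 0"
  using dim_span_eq_card_independent[of "{}"] independent_empty by simp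

lemma dim_eq_2D:
  assumes "subspace S" "dim S = 2"
  shows "\<exists>e f. S = {scale a e + scale b f |a b. True} \<and>
    (\<forall>a b. scale a e + scale b f = 0 \<longrightarrow> a = 0 \<and> b = 0)"
proof -
  obtain B where B: "B \<subseteq> S" "independent B" "S \<subseteq> span B" "card B = 2"
    using basis_exists[of S] assms(2) by metis
  then obtain e f where ef: "B = {e, f}" "e \<noteq> f"
    by (meson card_2_iff)
  have "span B = S"
    using B assms(1) by (simp add: span_minimal subset_antisym)
  then have S: "S = {scale a e + scale b f |a b. True}"
    using ef span_pair_eq by simp
  have e: "e \<notin> span {f}" and f: "f \<noteq> 0"
    using B(2) ef by (auto simp: independent_insert)
  have "a = 0 \<and> b = 0" if ab: "scale a e + scale b f = 0" for a b
  proof -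
    have "a = 0"
    proof (rule ccontr)
      assume a: "a \<noteq> 0"
      have "scale a e = scale (- b) f"
        using ab by (simp add: eq_neg_iff_add_eq_0)
      then have "scale (inverse a) (scale a e) = scale (inverse a) (scale (- b) f)"
        by simp
      then have "e = scale (inverse a * (- b)) f"
        using a by simp
      then show False
        using e unfolding span_singleton by blast
    qed
    then show ?thesis
      using ab f by simp
  qed
  with S show ?thesis
    by blast
qed

lemma dim_eq_1D:
  assumes "subspace S" "dim S = 1"
  shows "\<exists>e. S = range (\<lambda>a. scale a e) \<and> e \<noteq> 0"
proof -
  obtain B where B: "B \<subseteq> S" "independent B" "S \<subseteq> span B" "card B = 1"
    using basis_exists[of S] assms(2) by metis
  then obtain e where e: "B = {e}"
    by (meson card_1_singletonE)
  have "span B = S"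
    using B assms(1) by (simp add: span_minimal subset_antisym)
  then show ?thesis
    using B(2) e by (auto simp: span_singleton)
qed

text \<open>The finite spanning set excludes infinite-dimensional S, to which \<open>dim\<close>
  also assigns 0.\<close>

lemma dim_eq_0D:
  assumes "subspace S" "dim S = 0" "S \<subseteq> span A" "finite A"
  shows "S = {0}"
proof -
  obtain B where B: "B \<subseteq> S" "independent B" "S \<subseteq> span B" "card B = 0"
    using basis_exists[of S] assms(2) by metis
  have "finite B"
    using independent_span_bound[OF assms(4) B(2)] B(1) assms(3) by auto
  then have "B = {}"
    using B by simp
  then show ?thesis
    using B(3) subspace_0[OF assms(1)] by auto
qed

text \<open>S is a subspace of pairs of scalars, described by bare closure properties, and the
  family is its image under an injective linear map. Eigenspaces arise in this way from the initial
  data of solutions.\<close>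

lemma dim_param:
  assumes ef: "\<And>a b. scale a e + scale b f = 0 \<Longrightarrow> a = 0 \<and> b = 0"
    and add: "\<And>u v. u \<in> S \<Longrightarrow> v \<in> S \<Longrightarrow> (fst u + fst v, snd u + snd v) \<in> S"
    and mult: "\<And>k u. u \<in> S \<Longrightarrow> (k * fst u, k * snd u) \<in> S"
    and zero: "(0, 0) \<in> S"
  shows "dim {scale a e + scale b f |a b. (a, b) \<in> S} =
           (if S = UNIV then 2 else if S = {(0, 0)} then 0 else 1)"
proof (cases "S = UNIV \<or> S = {(0, 0)}")
  case True
  moreover have "UNIV \<noteq> {(0 :: 'a, 0 :: 'a)}"
  proof
    assume "UNIV = {(0 :: 'a, 0 :: 'a)}"
    then have "(1, 1) \<in> {(0 :: 'a, 0 :: 'a)}"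
      by blast
    then show False by simp
  qed
  ultimately show ?thesis
    using dim_pair[OF ef] dim_zero by auto
next
  case False
  then obtain p q where pq: "(p, q) \<in> S" "(p, q) \<noteq> (0, 0)"
    using zero by auto
  have line: "\<exists>k. a = k * p \<and> b = k * q" if ab: "(a, b) \<in> S" for a b
  proof (rule ccontr)
    assume no: "\<not> ?thesis"
    \<comment> \<open>If (a, b) is not a multiple of (p, q), Cramer's rule writes every pair as a
      combination of the two, and S would be everything.\<close>
    have det: "a * q - b * p \<noteq> 0"
    proof
      assume d: "a * q - b * p = 0"
      show False
      proof (cases "p = 0")
        case True
        then show False
          using no pq d by (auto dest: spec[of _ "b / q"])
      next
        case False
        then have "b = a / p * q"
          using d by (simp add: field_simps)
        then show False
          using no False by (auto dest: spec[of _ "a / p"])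
      qed
    qed
    have "(u, v) \<in> S" for u v
    proof -
      define D where "D = a * q - b * p"
      have "((u * q - v * p) / D * a + (a * v - b * u) / D * p,
             (u * q - v * p) / D * b + (a * v - b * u) / D * q) \<in> S"
        using add[OF mult[OF ab, of "(u * q - v * p) / D"] mult[OF pq(1), of "(a * v - b * u) / D"]]
        by (simp only: fst_conv snd_conv)
      moreover have "(u * q - v * p) / D * a + (a * v - b * u) / D * p = u"
      proof -
        have "(u * q - v * p) / D * a + (a * v - b * u) / D * p
            = ((u * q - v * p) * a + (a * v - b * u) * p) / D"
          by (simp only: add_divide_distrib times_divide_eq_left)
        also have "(u * q - v * p) * a + (a * v - b * u) * p = u * D"
          unfolding D_def by (simp only: algebra_simps; simp?)
        finally show ?thesis
          using det by (simp only: D_def nonzero_mult_div_cancel_right[OF det])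
      qed
      moreover have "(u * q - v * p) / D * b + (a * v - b * u) / D * q = v"
      proof -
        have "(u * q - v * p) / D * b + (a * v - b * u) / D * q
            = ((u * q - v * p) * b + (a * v - b * u) * q) / D"
          by (simp only: add_divide_distrib times_divide_eq_left)
        also have "(u * q - v * p) * b + (a * v - b * u) * q = v * D"
          unfolding D_def by (simp only: algebra_simps; simp?)
        finally show ?thesis
          using det by (simp only: D_def nonzero_mult_div_cancel_right[OF det])
      qed
      ultimately show ?thesis
        by (simp only:)
    qed
    then show False
      using False by auto
  qed
  have "{scale a e + scale b f |a b. (a, b) \<in> S} = range (\<lambda>k. scale k (scale p e + scale q f))"
  proof (intro equalityI subsetI)
    fix x assume "x \<in> {scale a e + scale b f |a b. (a, b) \<in> S}"
    then obtain a b where x: "x = scale a e + scale b f" "(a, b) \<in> S"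
      by blast
    from line[OF this(2)] obtain k where "a = k * p" "b = k * q"
      by blast
    then show "x \<in> range (\<lambda>k. scale k (scale p e + scale q f))"
      using x(1) by (auto simp: scale_right_distrib)
  next
    fix x assume "x \<in> range (\<lambda>k. scale k (scale p e + scale q f))"
    then obtain k where "x = scale (k * p) e + scale (k * q) f"
      by (auto simp: scale_right_distrib)
    then show "x \<in> {scale a e + scale b f |a b. (a, b) \<in> S}"
      using mult[OF pq(1), of k] by auto
  qed
  moreover have "scale p e + scale q f \<noteq> 0"
    using ef pq(2) by auto
  ultimately show ?thesis
    using dim_line False by auto
qed

end

text \<open>Counting: if l' j > l j, the positions where l' takes one of the values l 1, ..., l j
  all lie before j, yet equal fibre sizes make their number at least j. With the roles exchanged, a
  monotone enumeration is unique on the indices from 1 on.\<close>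

lemma enumeration_le:
  fixes l l' :: "nat \<Rightarrow> real"
  assumes l: "mono_on {1..} l" "\<And>m. finite {j. j \<ge> 1 \<and> l j = m}"
    and l': "mono_on {1..} l'" "\<And>m. finite {j. j \<ge> 1 \<and> l' j = m}"
    and card: "\<And>m. card {j. j \<ge> 1 \<and> l j = m} = card {j. j \<ge> 1 \<and> l' j = m}"
    and j: "j \<ge> 1"
  shows "l' j \<le> l j"
proof (rule ccontr)
  assume less: "\<not> l' j \<le> l j"
  define V where "V = l ` {1..j}"
  have "(\<Union>m\<in>V. {i. i \<ge> 1 \<and> l' i = m}) \<subseteq> {1..<j}"
  proof
    fix i assume "i \<in> (\<Union>m\<in>V. {i. i \<ge> 1 \<and> l' i = m})"
    then obtain i' where i: "i \<ge> 1" "l' i = l i'" "1 \<le> i'" "i' \<le> j"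
      by (auto simp: V_def)
    then have "l' i < l' j"
      using mono_onD[OF l(1), of i' j] less j by auto
    then have "i < j"
      using mono_onD[OF l'(1), of j i] i j by (meson atLeast_iff leD not_le_imp_less)
    then show "i \<in> {1..<j}"
      using i by simp
  qed
  then have "card (\<Union>m\<in>V. {i. i \<ge> 1 \<and> l' i = m}) \<le> j - 1"
    using card_mono[of "{1..<j}"] by simp
  moreover have "card (\<Union>m\<in>V. {i. i \<ge> 1 \<and> l' i = m}) = (\<Sum>m\<in>V. card {i. i \<ge> 1 \<and> l' i = m})"
    by (rule card_UN_disjoint) (use l' in \<open>auto simp: V_def\<close>)
  moreover have "card (\<Union>m\<in>V. {i. i \<ge> 1 \<and> l i = m}) = (\<Sum>m\<in>V. card {i. i \<ge> 1 \<and> l i = m})"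
    by (rule card_UN_disjoint) (use l in \<open>auto simp: V_def\<close>)
  moreover have "card {1..j} \<le> card (\<Union>m\<in>V. {i. i \<ge> 1 \<and> l i = m})"
    by (rule card_mono) (use l in \<open>auto simp: V_def\<close>)
  ultimately show False
    using card j by simp
qed

text \<open>Removes the choice operator from \<open>eigval\<close>: any one enumeration decides the
  value.\<close>

lemma eigval_eq:
  assumes l: "eigenvalue_enumeration T P Q R \<Lambda> l" and j: "j \<ge> 1"
  shows "eigval T P Q R j \<Lambda> = l j"
proof -
  define l' where "l' = (SOME l. eigenvalue_enumeration T P Q R \<Lambda> l)"
  have l': "eigenvalue_enumeration T P Q R \<Lambda> l'"
    unfolding l'_def using someI[of "eigenvalue_enumeration T P Q R \<Lambda>", OF l] by simp
  have *: "mono_on {1..} k" "finite {j. j \<ge> 1 \<and> k j = m}"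
    "card {j. j \<ge> 1 \<and> k j = m} = fvec.dim (eigenspace T P Q R \<Lambda> (of_real m))"
    if "eigenvalue_enumeration T P Q R \<Lambda> k" for k and m :: real
  proof -
    have "\<forall>\<mu>::complex. finite {j. j \<ge> 1 \<and> of_real (k j) = \<mu>} \<and>
        card {j. j \<ge> 1 \<and> of_real (k j) = \<mu>} = fvec.dim (eigenspace T P Q R \<Lambda> \<mu>)"
      "mono_on {1..} k"
      using that unfolding eigenvalue_enumeration_def by auto
    from this(2) spec[OF this(1), of "of_real m"]
    show "mono_on {1..} k" "finite {j. j \<ge> 1 \<and> k j = m}"
      "card {j. j \<ge> 1 \<and> k j = m} = fvec.dim (eigenspace T P Q R \<Lambda> (of_real m))"
      by simp_all
  qed
  have "l' j = l j"
    by (rule antisym; rule enumeration_le) (use *[OF l] *[OF l'] j in auto)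
  then show ?thesis
    unfolding eigval_def l'_def .
qed

text \<open>Iterates the successor map \<open>nxt\<close> from a point below Z. Finiteness of the
  lower parts makes the infimum in \<open>nxt\<close> attained and keeps the iterates from staying
  below a point of Z forever; unboundedness provides a successor at every stage.\<close>

lemma enumerate_discrete:
  fixes Z :: "real set"
  assumes fin: "\<And>B. finite (Z \<inter> {..B})" and unb: "\<And>B. \<exists>z\<in>Z. z > B"
  obtains d :: "nat \<Rightarrow> real" where "strict_mono d" "range d = Z"
proof -
  define nxt where "nxt B = Inf (Z \<inter> {B<..})" for B
  have nxt: "nxt B \<in> Z" "nxt B > B" "\<And>z. z \<in> Z \<Longrightarrow> z > B \<Longrightarrow> nxt B \<le> z" for B
  proof -
    obtain z where z: "z \<in> Z" "z > B"
      using unb by blast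
    let ?F = "Z \<inter> {B<..z}"
    have F: "finite ?F" "?F \<noteq> {}"
      using fin[of z] z by (auto elim: rev_finite_subset)
    have min: "Min ?F \<in> ?F"
      using Min_in F by blast
    have le: "Min ?F \<le> w" if "w \<in> Z \<inter> {B<..}" for w
    proof (cases "w \<le> z")
      case True
      then show ?thesis using that F(1) by auto
    next
      case False
      then show ?thesis using min by auto
    qed
    then have eq: "nxt B = Min ?F"
      unfolding nxt_def using min by (intro cInf_eq_minimum) auto
    show "nxt B \<in> Z" "nxt B > B" "\<And>z. z \<in> Z \<Longrightarrow> z > B \<Longrightarrow> nxt B \<le> z"
      using min le unfolding eq by auto
  qed
  obtain z0 where z0: "z0 \<in> Z"
    using unb by blast
  define B0 where "B0 = Min (Z \<inter> {..z0}) - 1"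
  have B0: "z > B0" if "z \<in> Z" for z
  proof (cases "z \<le> z0")
    case True
    then show ?thesis
      unfolding B0_def using fin[of z0] that Min_le[of "Z \<inter> {..z0}" z] by (simp del: Min_le)
  next
    case False
    have "Min (Z \<inter> {..z0}) \<in> Z \<inter> {..z0}"
      using fin z0 by (intro Min_in) auto
    then show ?thesis
      unfolding B0_def using False by auto
  qed
  \<comment> \<open>The exponent starts at 1 because \<open>B0\<close> itself lies strictly below
    Z.\<close>
  define d where "d n = (nxt ^^ Suc n) B0" for n
  have dS: "d (Suc n) = nxt (d n)" for n
    by (simp add: d_def)
  have sm: "strict_mono d"
    by (simp add: strict_mono_Suc_iff dS nxt(2))
  have dZ: "d n \<in> Z" for n
    by (simp add: d_def nxt(1))
  have "Z \<subseteq> range d"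
  proof
    fix z assume z: "z \<in> Z"
    have "\<exists>n. z < d n"
    proof (rule ccontr)
      assume "\<not> ?thesis"
      then have "range d \<subseteq> Z \<inter> {..z}"
        using dZ by (auto simp: not_less)
      then have "finite (range d)"
        using fin finite_subset by blast
      then show False
        using finite_imageD[of d UNIV] strict_mono_imp_inj_on[OF sm] infinite_UNIV_nat by blast
    qed
    \<comment> \<open>The first iterate beyond z: by minimality the previous iterate is at most z,
      and the successor property forbids it to be smaller.\<close>
    define n where "n = (LEAST n. z < d n)"
    have n: "z < d n"
      unfolding n_def using \<open>\<exists>n. z < d n\<close> by (rule LeastI_ex)
    show "z \<in> range d"
    proof (cases n)
      case 0
      then have "nxt B0 \<le> z"
        using nxt(3) z B0 by blast
      then show ?thesis
        using n 0 by (simp add: d_def)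
    next
      case (Suc m)
      then have "\<not> z < d m"
        using not_less_Least[of m "\<lambda>n. z < d n"] unfolding n_def by simp
      moreover have "\<not> d m < z"
        using nxt(3)[of z "d m"] z n Suc by (auto simp: dS)
      ultimately show ?thesis
        by auto
    qed
  qed
  then show ?thesis
    using sm dZ that by blast
qed

section \<open>Absolutely continuous functions\<close>

lemma continuous_on_Icc_bound:
  fixes u :: "real \<Rightarrow> real"
  assumes "continuous_on {a..b} u"
  obtains B where "B > 0" "\<And>t. t \<in> {a..b} \<Longrightarrow> \<bar>u t\<bar> \<le> B"
proof -
  have "bounded (u ` {a..b})"
    using assms by (intro compact_imp_bounded compact_continuous_image) auto
  then obtain B where "B > 0" "\<forall>x\<in>u ` {a..b}. norm x \<le> B"
    unfolding bounded_pos by blast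
  then show ?thesis
    using that by auto
qed

lemma has_integral_diff_of_primitive:
  fixes h :: "real \<Rightarrow> 'a::banach"
  assumes "\<And>t. t \<in> {0..T} \<Longrightarrow> (h has_integral (F t - F 0)) {0..t}"
    and ab: "0 \<le> a" "a \<le> b" "b \<le> T"
  shows "(h has_integral (F b - F a)) {a..b}"
proof -
  have b: "(h has_integral (F b - F 0)) {0..b}" and a: "(h has_integral (F a - F 0)) {0..a}"
    using assms by auto
  have int: "h integrable_on {a..b}"
    using integrable_on_subinterval[of h "{0..b}" a b] b ab by auto
  have "integral {0..a} h + integral {a..b} h = integral {0..b} h"
    using b ab by (intro Henstock_Kurzweil_Integration.integral_combine) auto
  then have "integral {a..b} h = F b - F a"
    using integral_unique[OF a] integral_unique[OF b] by (simp add: algebra_simps)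
  then show ?thesis
    using int by (simp add: has_integral_iff)
qed

lemma has_weak_deriv_has_integral:
  assumes "has_weak_deriv T f f'" "0 \<le> a" "a \<le> b" "b \<le> T"
  shows "(f' has_integral (f b - f a)) {a..b}"
  by (rule has_integral_diff_of_primitive[of T]) (use assms in \<open>auto simp: has_weak_deriv_def\<close>)

lemma has_weak_deriv_continuous:
  assumes "has_weak_deriv T f f'"
  shows "continuous_on {0..T} f"
proof (cases "T \<ge> 0")
  case True
  have int: "(f' has_integral (f t - f 0)) {0..t}" if "t \<in> {0..T}" for t
    using assms that by (auto simp: has_weak_deriv_def)
  have "continuous_on {0..T} (\<lambda>t. integral {0..t} f' + f 0)"
    using int[of T] True by (intro continuous_intros indefinite_integral_continuous_1) auto
  then show ?thesis
    by (rule continuous_on_eq) (simp add: integral_unique[OF int])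
qed simp

lemma H1_continuous: "H1 T f \<Longrightarrow> continuous_on {0..T} f"
  by (auto simp: H1_def intro: has_weak_deriv_continuous)

text \<open>Cut [0, t] into equal pieces shorter than \<delta>. The increments of K telescope, so
  |\<psi> t - \<psi> 0| is at most e times a fixed number, for every e.\<close>

lemma constant_of_small_increments:
  fixes \<psi> K :: "real \<Rightarrow> real"
  assumes incr: "\<And>e. e > 0 \<Longrightarrow> \<exists>\<delta>>0. \<forall>a b. 0 \<le> a \<and> a \<le> b \<and> b \<le> T \<and> b - a < \<delta> \<longrightarrow>
      \<bar>\<psi> b - \<psi> a\<bar> \<le> e * (K b - K a)"
    and t: "t \<in> {0..T}"
  shows "\<psi> t = \<psi> 0"
proof -
  have small: "\<bar>\<psi> t - \<psi> 0\<bar> \<le> e * (K t - K 0)" if e: "e > 0" for e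
  proof -
    obtain \<delta> where \<delta>: "\<delta> > 0"
      "\<And>a b. 0 \<le> a \<Longrightarrow> a \<le> b \<Longrightarrow> b \<le> T \<Longrightarrow> b - a < \<delta> \<Longrightarrow> \<bar>\<psi> b - \<psi> a\<bar> \<le> e * (K b - K a)"
      using incr[OF e] by blast
    obtain n :: nat where n: "t / \<delta> < real n"
      using reals_Archimedean2 by blast
    then have n0: "n > 0"
      using t \<delta>(1) by (auto simp: field_simps intro!: Nat.gr0I)
    define p where "p i = t * (real i / real n)" for i :: nat
    have "\<bar>\<psi> (p i) - \<psi> 0\<bar> \<le> e * (K (p i) - K 0)" if "i \<le> n" for i
      using that
    proof (induction i)
      case 0
      then show ?case by (simp add: p_def)
    next
      case (Suc i)
      have diff: "p (Suc i) - p i = t / real n"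
        by (simp add: p_def add_divide_distrib algebra_simps)
      have "t * (real (Suc i) / real n) \<le> t * 1"
        using t Suc(2) n0 by (intro mult_left_mono) auto
      then have "p (Suc i) \<le> T"
        using t by (simp add: p_def)
      moreover have "p i \<ge> 0"
        using t by (simp add: p_def)
      moreover have "t / real n \<ge> 0" "t / real n < \<delta>"
        using t n n0 \<delta>(1) by (auto simp: field_simps)
      ultimately have "\<bar>\<psi> (p (Suc i)) - \<psi> (p i)\<bar> \<le> e * (K (p (Suc i)) - K (p i))"
        using diff by (intro \<delta>(2)) auto
      moreover have "\<bar>\<psi> (p i) - \<psi> 0\<bar> \<le> e * (K (p i) - K 0)"
        using Suc by simp
      ultimately show ?case
        by (simp add: algebra_simps)
    qed
    from this[of n] show ?thesis
      using n0 by (simp add: p_def)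
  qed
  show ?thesis
  proof (rule ccontr)
    define X where "X = \<bar>\<psi> t - \<psi> 0\<bar>"
    \<comment> \<open>Adding 1 keeps C positive even if K does not change; with e = X / (2 C) the
      bound would give X <= X / 2.\<close>
    define C where "C = \<bar>K t - K 0\<bar> + 1"
    assume "\<psi> t \<noteq> \<psi> 0"
    then have X: "X > 0"
      by (simp add: X_def)
    have C: "C > 0"
      by (simp add: C_def add_nonneg_pos)
    have "X \<le> X / (2 * C) * (K t - K 0)"
      using small[of "X / (2 * C)"] X C by (simp add: X_def)
    also have "\<dots> \<le> X / (2 * C) * C"
      using X C by (intro mult_left_mono) (auto simp: C_def)
    also have "\<dots> = X / 2"
      using C by simp
    finally show False
      using X by simp
  qed
qed

text \<open>Source of the calculus rules for primitives of merely square-integrable functions, which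
  need not be differentiable at every point. On a short interval the increment of F is the integral
  of some w that may depend on the interval; w differs from h by at most e k, so F minus the
  primitive of h is constant.\<close>

lemma has_integral_of_increments:
  fixes F h k :: "real \<Rightarrow> real"
  assumes h: "h integrable_on {0..T}" and k: "k integrable_on {0..T}"
    and incr: "\<And>e. e > 0 \<Longrightarrow> \<exists>\<delta>>0. \<forall>a b. 0 \<le> a \<and> a \<le> b \<and> b \<le> T \<and> b - a < \<delta> \<longrightarrow>
      (\<exists>w. (w has_integral (F b - F a)) {a..b} \<and> (\<forall>s\<in>{a..b}. \<bar>w s - h s\<bar> \<le> e * k s))"
    and t: "t \<in> {0..T}"
  shows "(h has_integral (F t - F 0)) {0..t}"
proof -
  have int: "(g has_integral (integral {0..b} g - integral {0..a} g)) {a..b}"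
    if "g integrable_on {0..T}" "0 \<le> a" "a \<le> b" "b \<le> T" for g :: "real \<Rightarrow> real" and a b
    by (rule has_integral_diff_of_primitive[of T])
      (use that in \<open>auto intro!: integrable_integral intro: integrable_on_subinterval\<close>)
  have "F t - integral {0..t} h = F 0 - integral {0..0} h"
  proof (rule constant_of_small_increments[where T = T and K = "\<lambda>t. integral {0..t} k"])
    fix e :: real assume "e > 0"
    from incr[OF this] obtain \<delta> where \<delta>: "\<delta> > 0" "\<And>a b. 0 \<le> a \<Longrightarrow> a \<le> b \<Longrightarrow> b \<le> T \<Longrightarrow> b - a < \<delta> \<Longrightarrow>
        (\<exists>w. (w has_integral (F b - F a)) {a..b} \<and> (\<forall>s\<in>{a..b}. \<bar>w s - h s\<bar> \<le> e * k s))"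
      by blast
    show "\<exists>\<delta>>0. \<forall>a b. 0 \<le> a \<and> a \<le> b \<and> b \<le> T \<and> b - a < \<delta> \<longrightarrow>
        \<bar>(F b - integral {0..b} h) - (F a - integral {0..a} h)\<bar>
          \<le> e * (integral {0..b} k - integral {0..a} k)"
    proof (intro exI[of _ \<delta>] conjI allI impI)
      fix a b assume ab: "0 \<le> a \<and> a \<le> b \<and> b \<le> T \<and> b - a < \<delta>"
      then obtain w where w: "(w has_integral (F b - F a)) {a..b}"
        "\<And>s. s \<in> {a..b} \<Longrightarrow> \<bar>w s - h s\<bar> \<le> e * k s"
        using \<delta>(2) by blast
      have 1: "((\<lambda>s. w s - h s) has_integral
          (F b - F a - (integral {0..b} h - integral {0..a} h))) {a..b}"
        using w(1) int[OF h] ab by (intro has_integral_diff) auto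
      have 2: "((\<lambda>s. e * k s) has_integral (e * (integral {0..b} k - integral {0..a} k))) {a..b}"
        using int[OF k] ab by (intro has_integral_mult_right) auto
      have "norm (integral {a..b} (\<lambda>s. w s - h s)) \<le> integral {a..b} (\<lambda>s. e * k s)"
        using 1 2 w(2) by (intro integral_norm_bound_integral) auto
      then show "\<bar>(F b - integral {0..b} h) - (F a - integral {0..a} h)\<bar>
          \<le> e * (integral {0..b} k - integral {0..a} k)"
        unfolding integral_unique[OF 1] integral_unique[OF 2] by (simp add: algebra_simps)
    qed (use \<delta> in auto)
  qed (use t in auto)
  then have "integral {0..t} h = F t - F 0"
    by simp
  moreover have "h integrable_on {0..t}"
    using h t by (auto intro: integrable_on_subinterval)
  ultimately show ?thesis
    by (simp add: has_integral_iff)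
qed

section \<open>Square-integrable functions and the algebra of H1\<close>

definition square_int :: "real \<Rightarrow> (real \<Rightarrow> 'a::euclidean_space) \<Rightarrow> bool" where
  "square_int T g \<longleftrightarrow> g \<in> borel_measurable (lebesgue_on {0..T}) \<and>
     integrable (lebesgue_on {0..T}) (\<lambda>t. (norm (g t))\<^sup>2)"

lemma has_weak_deriv_square_int: "has_weak_deriv T f g \<Longrightarrow> square_int T g"
  by (simp add: has_weak_deriv_def square_int_def)

lemma square_int_bound:
  assumes "square_int T g" "h \<in> borel_measurable (lebesgue_on {0..T})"
    and "\<And>t. t \<in> {0..T} \<Longrightarrow> norm (h t) \<le> C * norm (g t)"
  shows "square_int T h"
proof -
  have "integrable (lebesgue_on {0..T}) (\<lambda>t. (norm (h t))\<^sup>2)"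
  proof (rule Bochner_Integration.integrable_bound)
    show "integrable (lebesgue_on {0..T}) (\<lambda>t. C\<^sup>2 * (norm (g t))\<^sup>2)"
      using assms(1) by (simp add: square_int_def)
    show "(\<lambda>t. (norm (h t))\<^sup>2) \<in> borel_measurable (lebesgue_on {0..T})"
      using assms(2) by measurable
    show "AE t in lebesgue_on {0..T}. norm ((norm (h t))\<^sup>2) \<le> norm (C\<^sup>2 * (norm (g t))\<^sup>2)"
    proof (rule AE_I2)
      fix t assume "t \<in> space (lebesgue_on {0..T})"
      then have "t \<in> {0..T}"
        by (simp add: space_restrict_space)
      from power_mono[OF assms(3)[OF this], of 2]
      show "norm ((norm (h t))\<^sup>2) \<le> norm (C\<^sup>2 * (norm (g t))\<^sup>2)"
        by (simp add: power_mult_distrib)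
    qed
  qed
  then show ?thesis
    using assms(2) by (simp add: square_int_def)
qed

lemma square_int_add:
  assumes "square_int T f" "square_int T g"
  shows "square_int T (\<lambda>t. f t + g t)"
proof -
  have m[measurable]: "f \<in> borel_measurable (lebesgue_on {0..T})"
    "g \<in> borel_measurable (lebesgue_on {0..T})"
    using assms by (simp_all add: square_int_def)
  have "integrable (lebesgue_on {0..T}) (\<lambda>t. (norm (f t + g t))\<^sup>2)"
  proof (rule Bochner_Integration.integrable_bound)
    show "integrable (lebesgue_on {0..T}) (\<lambda>t. 2 * (norm (f t))\<^sup>2 + 2 * (norm (g t))\<^sup>2)"
      using assms by (simp add: square_int_def)
    show "(\<lambda>t. (norm (f t + g t))\<^sup>2) \<in> borel_measurable (lebesgue_on {0..T})"
      by measurable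
    have "(norm (f t + g t))\<^sup>2 \<le> 2 * (norm (f t))\<^sup>2 + 2 * (norm (g t))\<^sup>2" for t
    proof -
      have "(norm (f t + g t))\<^sup>2 \<le> (norm (f t) + norm (g t))\<^sup>2"
        by (intro power_mono norm_triangle_ineq) auto
      also have "\<dots> \<le> 2 * (norm (f t))\<^sup>2 + 2 * (norm (g t))\<^sup>2"
        using sum_squares_bound[of "norm (f t)" "norm (g t)"] by (simp add: power2_sum)
      finally show ?thesis .
    qed
    then show "AE t in lebesgue_on {0..T}. norm ((norm (f t + g t))\<^sup>2)
        \<le> norm (2 * (norm (f t))\<^sup>2 + 2 * (norm (g t))\<^sup>2)"
      by (intro AE_I2) simp
  qed
  then show ?thesis
    by (simp add: square_int_def)
qed

lemma square_int_mult_continuous: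
  fixes u v :: "real \<Rightarrow> real"
  assumes u: "continuous_on {0..T} u" and v: "square_int T v"
  shows "square_int T (\<lambda>t. u t * v t)"
proof -
  obtain B where B: "\<And>t. t \<in> {0..T} \<Longrightarrow> \<bar>u t\<bar> \<le> B"
    using continuous_on_Icc_bound[OF u] by blast
  have [measurable]: "u \<in> borel_measurable (lebesgue_on {0..T})"
    using u by (rule continuous_imp_measurable_on_sets_lebesgue) simp
  have [measurable]: "v \<in> borel_measurable (lebesgue_on {0..T})"
    using v by (simp add: square_int_def)
  show ?thesis
    by (rule square_int_bound[OF v, where C = B])
      (measurable, auto simp: abs_mult intro!: mult_right_mono B)
qed

lemma square_int_integrable:
  fixes g :: "real \<Rightarrow> real"
  assumes "square_int T g"
  shows "(\<lambda>t. \<bar>g t\<bar>) integrable_on {0..T}" "g integrable_on {0..T}"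
proof -
  have [measurable]: "g \<in> borel_measurable (lebesgue_on {0..T})"
    using assms by (simp add: square_int_def)
  have "integrable (lebesgue_on {0..T}) g"
  proof (rule Bochner_Integration.integrable_bound)
    have "integrable (lebesgue_on {0..T}) (\<lambda>t. 1 :: real)"
      by (intro continuous_imp_integrable_real continuous_intros)
    then show "integrable (lebesgue_on {0..T}) (\<lambda>t. 1 + (norm (g t))\<^sup>2)"
      using assms by (simp add: square_int_def)
    have "norm (g t) \<le> norm (1 + (norm (g t))\<^sup>2)" for t
      using sum_squares_bound[of 1 "\<bar>g t\<bar>"] by (simp add: power2_eq_square)
    then show "AE t in lebesgue_on {0..T}. norm (g t) \<le> norm (1 + (norm (g t))\<^sup>2)"
      by (intro AE_I2) auto
  qed measurable
  then show "g integrable_on {0..T}" "(\<lambda>t. \<bar>g t\<bar>) integrable_on {0..T}"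
    by (auto intro!: integrable_on_lebesgue_on)
qed

text \<open>Freezing one factor at an end point gives an exact increment: f b g b - f a g a is the
  integral over [a, b] of g b f' + f a g'. By uniform continuity this integrand differs from g f' +
  f g' by at most e (|f'| + |g'|) on short intervals.\<close>

lemma H1_mult:
  fixes f g :: "real \<Rightarrow> real"
  assumes "H1 T f" "H1 T g"
  shows "H1 T (\<lambda>t. f t * g t)"
proof -
  obtain f' g' where f': "has_weak_deriv T f f'" and g': "has_weak_deriv T g g'"
    using assms by (auto simp: H1_def)
  note cont = H1_continuous[OF assms(1)] H1_continuous[OF assms(2)]
  note sq = has_weak_deriv_square_int[OF f'] has_weak_deriv_square_int[OF g']
  define h where "h t = g t * f' t + f t * g' t" for t
  have h: "square_int T h"
    unfolding h_def by (intro square_int_add square_int_mult_continuous cont sq)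
  have "(h has_integral (f t * g t - f 0 * g 0)) {0..t}" if "t \<in> {0..T}" for t
  proof (rule has_integral_of_increments[OF _ _ _ that])
    show "h integrable_on {0..T}"
      using h by (rule square_int_integrable)
    show "(\<lambda>t. \<bar>f' t\<bar> + \<bar>g' t\<bar>) integrable_on {0..T}"
      using sq by (intro integrable_add square_int_integrable)
    fix e :: real assume e: "e > 0"
    obtain \<delta>1 where \<delta>1: "\<delta>1 > 0" "\<And>a b. a \<in> {0..T} \<Longrightarrow> b \<in> {0..T} \<Longrightarrow> dist b a < \<delta>1 \<Longrightarrow> dist (f b) (f a) < e"
      using compact_uniformly_continuous[OF cont(1)] e
      unfolding uniformly_continuous_on_def by (metis compact_Icc)
    obtain \<delta>2 where \<delta>2: "\<delta>2 > 0" "\<And>a b. a \<in> {0..T} \<Longrightarrow> b \<in> {0..T} \<Longrightarrow> dist b a < \<delta>2 \<Longrightarrow> dist (g b) (g a) < e"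
      using compact_uniformly_continuous[OF cont(2)] e
      unfolding uniformly_continuous_on_def by (metis compact_Icc)
    show "\<exists>\<delta>>0. \<forall>a b. 0 \<le> a \<and> a \<le> b \<and> b \<le> T \<and> b - a < \<delta> \<longrightarrow>
      (\<exists>w. (w has_integral (f b * g b - f a * g a)) {a..b} \<and>
        (\<forall>s\<in>{a..b}. \<bar>w s - h s\<bar> \<le> e * (\<bar>f' s\<bar> + \<bar>g' s\<bar>)))"
    proof (intro exI[of _ "min \<delta>1 \<delta>2"] conjI allI impI)
      fix a b assume ab: "0 \<le> a \<and> a \<le> b \<and> b \<le> T \<and> b - a < min \<delta>1 \<delta>2"
      have "((\<lambda>s. g b * f' s + f a * g' s) has_integral (g b * (f b - f a) + f a * (g b - g a))) {a..b}"
        using ab has_weak_deriv_has_integral[OF f'] has_weak_deriv_has_integral[OF g']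
        by (intro has_integral_add has_integral_mult_right) auto
      moreover have "g b * (f b - f a) + f a * (g b - g a) = f b * g b - f a * g a"
        by (simp add: algebra_simps)
      moreover have "\<bar>(g b * f' s + f a * g' s) - h s\<bar> \<le> e * (\<bar>f' s\<bar> + \<bar>g' s\<bar>)" if s: "s \<in> {a..b}" for s
      proof -
        have "\<bar>g b - g s\<bar> \<le> e" "\<bar>f a - f s\<bar> \<le> e"
          using \<delta>1(2)[of s a] \<delta>2(2)[of s b] ab s by (auto simp: dist_real_def)
        then have "\<bar>(g b - g s) * f' s\<bar> \<le> e * \<bar>f' s\<bar>" "\<bar>(f a - f s) * g' s\<bar> \<le> e * \<bar>g' s\<bar>"
          by (auto simp: abs_mult intro: mult_right_mono)
        moreover have "(g b * f' s + f a * g' s) - h s = (g b - g s) * f' s + (f a - f s) * g' s"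
          by (simp add: h_def algebra_simps)
        ultimately show ?thesis
          by (simp add: distrib_left)
      qed
      ultimately show "\<exists>w. (w has_integral (f b * g b - f a * g a)) {a..b} \<and>
          (\<forall>s\<in>{a..b}. \<bar>w s - h s\<bar> \<le> e * (\<bar>f' s\<bar> + \<bar>g' s\<bar>))"
        by (intro exI[of _ "\<lambda>s. g b * f' s + f a * g' s"]) auto
    qed (use \<delta>1 \<delta>2 in auto)
  qed
  then show ?thesis
    using h by (auto simp: H1_def has_weak_deriv_def square_int_def)
qed

text \<open>Again an exact increment with a frozen coefficient: 1 / f b - 1 / f a = - (f b - f a) /
  (f a f b). With the product rule this will put the velocity (y - Q x) / P of a solution into
  H1.\<close>

lemma H1_inverse:
  fixes f :: "real \<Rightarrow> real"
  assumes "H1 T f" and f0: "\<And>t. t \<in> {0..T} \<Longrightarrow> f t \<noteq> 0"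
  shows "H1 T (\<lambda>t. 1 / f t)"
proof -
  obtain f' where f': "has_weak_deriv T f f'"
    using assms by (auto simp: H1_def)
  define r where "r t = 1 / f t" for t
  have r: "continuous_on {0..T} r"
    unfolding r_def using f0 by (intro continuous_intros H1_continuous assms) auto
  note sq = has_weak_deriv_square_int[OF f']
  define h where "h t = - (r t * r t) * f' t" for t
  have h: "square_int T h"
    unfolding h_def by (intro square_int_mult_continuous continuous_intros r sq)
  obtain B where B: "\<And>t. t \<in> {0..T} \<Longrightarrow> \<bar>r t\<bar> \<le> B" "B > 0"
    using continuous_on_Icc_bound[OF r] by blast
  have "(h has_integral (r t - r 0)) {0..t}" if "t \<in> {0..T}" for t
  proof (rule has_integral_of_increments[OF _ _ _ that])
    show "h integrable_on {0..T}"
      using h by (rule square_int_integrable)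
    show "(\<lambda>t. \<bar>f' t\<bar>) integrable_on {0..T}"
      using sq by (rule square_int_integrable)
    fix e :: real assume e: "e > 0"
    \<comment> \<open>Two differences of r, each multiplied by a value of r of size at most B, then
      add up to at most e.\<close>
    then have "e / (2 * B) > 0"
      using B by simp
    then obtain \<delta> where \<delta>: "\<delta> > 0"
      "\<And>a b. a \<in> {0..T} \<Longrightarrow> b \<in> {0..T} \<Longrightarrow> dist b a < \<delta> \<Longrightarrow> dist (r b) (r a) < e / (2 * B)"
      using compact_uniformly_continuous[OF r] unfolding uniformly_continuous_on_def by (metis compact_Icc)
    show "\<exists>\<delta>>0. \<forall>a b. 0 \<le> a \<and> a \<le> b \<and> b \<le> T \<and> b - a < \<delta> \<longrightarrow>
      (\<exists>w. (w has_integral (r b - r a)) {a..b} \<and> (\<forall>s\<in>{a..b}. \<bar>w s - h s\<bar> \<le> e * \<bar>f' s\<bar>))"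
    proof (intro exI[of _ \<delta>] conjI allI impI)
      fix a b assume ab: "0 \<le> a \<and> a \<le> b \<and> b \<le> T \<and> b - a < \<delta>"
      have "((\<lambda>s. - (r a * r b) * f' s) has_integral (- (r a * r b) * (f b - f a))) {a..b}"
        using ab has_weak_deriv_has_integral[OF f'] by (intro has_integral_mult_right) auto
      moreover have "- (r a * r b) * (f b - f a) = r b - r a"
        using f0[of a] f0[of b] ab by (simp add: r_def field_simps)
      moreover have "\<bar>- (r a * r b) * f' s - h s\<bar> \<le> e * \<bar>f' s\<bar>" if s: "s \<in> {a..b}" for s
      proof -
        have "\<bar>r s - r a\<bar> \<le> e / (2 * B)" "\<bar>r s - r b\<bar> \<le> e / (2 * B)"
          using \<delta>(2)[of s a] \<delta>(2)[of s b] ab s by (auto simp: dist_real_def)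
        then have "\<bar>r s\<bar> * \<bar>r s - r a\<bar> \<le> B * (e / (2 * B))" "\<bar>r a\<bar> * \<bar>r s - r b\<bar> \<le> B * (e / (2 * B))"
          using B ab s by (intro mult_mono; auto)+
        moreover have "r s * r s - r a * r b = r s * (r s - r a) + r a * (r s - r b)"
          by (simp add: algebra_simps)
        ultimately have "\<bar>r s * r s - r a * r b\<bar> \<le> e"
          using B(2) abs_triangle_ineq[of "r s * (r s - r a)" "r a * (r s - r b)"]
          by (simp add: abs_mult)
        then have "\<bar>r s * r s - r a * r b\<bar> * \<bar>f' s\<bar> \<le> e * \<bar>f' s\<bar>"
          by (rule mult_right_mono) simp
        moreover have "- (r a * r b) * f' s - h s = (r s * r s - r a * r b) * f' s"
          by (simp add: h_def algebra_simps)
        ultimately show ?thesis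
          by (simp add: abs_mult)
      qed
      ultimately show "\<exists>w. (w has_integral (r b - r a)) {a..b} \<and> (\<forall>s\<in>{a..b}. \<bar>w s - h s\<bar> \<le> e * \<bar>f' s\<bar>)"
        by (intro exI[of _ "\<lambda>s. - (r a * r b) * f' s"]) auto
    qed (use \<delta> in auto)
  qed
  then show ?thesis
    using h by (auto simp: H1_def has_weak_deriv_def square_int_def r_def)
qed

lemma C1_has_weak_deriv:
  fixes f :: "real \<Rightarrow> 'a::euclidean_space"
  assumes f: "\<And>t. t \<in> {0..T} \<Longrightarrow> (f has_vector_derivative f' t) (at t within {0..T})"
    and f': "continuous_on {0..T} f'"
  shows "has_weak_deriv T f f'"
  unfolding has_weak_deriv_def
proof (intro conjI ballI)
  show "f' \<in> borel_measurable (lebesgue_on {0..T})"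
    using f' by (rule continuous_imp_measurable_on_sets_lebesgue) simp
  show "integrable (lebesgue_on {0..T}) (\<lambda>t. (norm (f' t))\<^sup>2)"
    using f' by (intro continuous_imp_integrable_real continuous_intros)
  show "(f' has_integral (f t - f 0)) {0..t}" if "t \<in> {0..T}" for t
    using that by (intro fundamental_theorem_of_calculus has_vector_derivative_within_subset[OF f]) auto
qed

lemma H1_diff:
  fixes f g :: "real \<Rightarrow> real"
  assumes "H1 T f" "H1 T g"
  shows "H1 T (\<lambda>t. f t - g t)"
proof -
  obtain f' g' where f': "has_weak_deriv T f f'" and g': "has_weak_deriv T g g'"
    using assms by (auto simp: H1_def)
  have "square_int T (\<lambda>t. f' t + (- 1) * g' t)"
    by (intro square_int_add square_int_mult_continuous continuous_intros
        has_weak_deriv_square_int[OF f'] has_weak_deriv_square_int[OF g'])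
  moreover have "((\<lambda>s. f' s - g' s) has_integral (f t - g t - (f 0 - g 0))) {0..t}" if "t \<in> {0..T}" for t
    using has_integral_diff[of f' "f t - f 0" "{0..t}" g' "g t - g 0"] f' g' that
    by (simp add: has_weak_deriv_def algebra_simps)
  ultimately have "has_weak_deriv T (\<lambda>t. f t - g t) (\<lambda>t. f' t - g' t)"
    by (simp add: has_weak_deriv_def square_int_def)
  then show ?thesis
    by (auto simp: H1_def)
qed

lemma H1_complex_combination:
  fixes f g :: "real \<Rightarrow> real" and \<alpha> \<beta> :: complex
  assumes "H1 T f" "H1 T g"
  shows "H1 T (\<lambda>t. \<alpha> * of_real (f t) + \<beta> * of_real (g t))"
proof -
  obtain f' g' where f': "has_weak_deriv T f f'" and g': "has_weak_deriv T g g'"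
    using assms by (auto simp: H1_def)
  have sq: "square_int T (\<lambda>t. \<gamma> * of_real (k t))" if "square_int T k" for k :: "real \<Rightarrow> real" and \<gamma> :: complex
  proof -
    have [measurable]: "k \<in> borel_measurable (lebesgue_on {0..T})"
      using that by (simp add: square_int_def)
    have "(\<lambda>t. \<gamma> * complex_of_real (k t)) \<in> borel_measurable (lebesgue_on {0..T})"
      by measurable
    then show ?thesis
      by (rule square_int_bound[OF that, where C = "norm \<gamma>"]) (simp add: norm_mult)
  qed
  have "square_int T (\<lambda>t. \<alpha> * of_real (f' t) + \<beta> * of_real (g' t))"
    by (intro square_int_add sq has_weak_deriv_square_int[OF f'] has_weak_deriv_square_int[OF g'])
  moreover have "((\<lambda>s. \<alpha> * of_real (f' s) + \<beta> * of_real (g' s)) has_integral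
      (\<alpha> * of_real (f t) + \<beta> * of_real (g t) - (\<alpha> * of_real (f 0) + \<beta> * of_real (g 0)))) {0..t}"
    if t: "t \<in> {0..T}" for t
  proof -
    have "((\<lambda>s. \<alpha> * of_real (f' s) + \<beta> * of_real (g' s)) has_integral
        (\<alpha> * of_real (f t - f 0) + \<beta> * of_real (g t - g 0))) {0..t}"
      using f' g' t unfolding has_weak_deriv_def
      by (intro has_integral_add has_integral_mult_right
          has_integral_linear[OF _ bounded_linear_of_real, unfolded o_def]) auto
    then show ?thesis
      by (simp add: algebra_simps)
  qed
  ultimately have "has_weak_deriv T (\<lambda>t. \<alpha> * of_real (f t) + \<beta> * of_real (g t))
      (\<lambda>t. \<alpha> * of_real (f' t) + \<beta> * of_real (g' t))"
    by (simp add: has_weak_deriv_def square_int_def)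
  then show ?thesis
    by (auto simp: H1_def)
qed

section \<open>Linear differential equations with a parameter\<close>

text \<open>The substitution s = t r moves the variable end point into the integrand and leaves the
  fixed domain [0, 1].\<close>

lemma continuous_on_indefinite_integral_param:
  fixes G :: "'b::topological_space \<Rightarrow> real \<Rightarrow> 'a::euclidean_space"
  assumes G: "continuous_on (U \<times> {0..T}) (\<lambda>(\<mu>, s). G \<mu> s)"
  shows "continuous_on (U \<times> {0..T}) (\<lambda>(\<mu>, t). integral {0..t} (G \<mu>))"
proof -
  have slice: "continuous_on {0..T} (G \<mu>)" if "\<mu> \<in> U" for \<mu>
  proof -
    have "continuous_on {0..T} (\<lambda>s. (\<lambda>(\<mu>, s). G \<mu> s) (\<mu>, s))"
      by (rule continuous_on_compose2[OF G]) (use that in \<open>auto intro!: continuous_intros\<close>)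
    then show ?thesis
      by simp
  qed
  have eq: "integral {0..t} (G \<mu>) = integral (cbox 0 1) (\<lambda>r. t *\<^sub>R G \<mu> (t * r))"
    if "\<mu> \<in> U" "t \<in> {0..T}" for \<mu> t
  proof -
    have "(\<lambda>r. t * r) ` {0..1} \<subseteq> {0..T}"
      using that(2) by (auto intro: order_trans[OF mult_left_le])
    then have "((\<lambda>r. t *\<^sub>R G \<mu> (t * r)) has_integral integral {t * 0..t * 1} (G \<mu>)) {0..1}"
      using that by (intro has_integral_substitution[OF _ _ _ slice])
        (auto intro!: derivative_eq_intros)
    from integral_unique[OF this] show ?thesis
      by (simp only: cbox_interval mult_zero_right mult_1_right)
  qed
  have "continuous_on (U \<times> {0..T}) (\<lambda>p. integral (cbox 0 1) (\<lambda>r. snd p *\<^sub>R G (fst p) (snd p * r)))"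
  proof (rule integral_continuous_on_param)
    have "continuous_on ((U \<times> {0..T}) \<times> cbox 0 (1::real)) (\<lambda>q. G (fst (fst q)) (snd (fst q) * snd q))"
    proof -
      have "continuous_on ((U \<times> {0..T}) \<times> cbox 0 (1::real))
          (\<lambda>q. (\<lambda>(\<mu>, s). G \<mu> s) (fst (fst q), snd (fst q) * snd q))"
        by (rule continuous_on_compose2[OF G])
          (auto intro!: continuous_intros intro: order_trans[OF mult_left_le])
      then show ?thesis
        by simp
    qed
    then show "continuous_on ((U \<times> {0..T}) \<times> cbox 0 1) (\<lambda>(p, r). snd p *\<^sub>R G (fst p) (snd p * r))"
      unfolding case_prod_unfold by (intro continuous_intros)
  qed
  then show ?thesis
    by (rule continuous_on_eq) (auto simp: eq)
qed

text \<open>Picard iteration for all parameters at once, so that joint continuity in (\<mu>, t)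
  comes with the solution. The Lipschitz constant is uniform only for bounded \<mu>; hence
  convergence is uniform on strips |\<mu>| <= L, and continuity is obtained locally.\<close>

lemma ode_param_exists:
  fixes F :: "real \<Rightarrow> real \<Rightarrow> 'a::euclidean_space \<Rightarrow> 'a"
  assumes T: "T \<ge> 0"
    and cont: "continuous_on (UNIV \<times> {0..T} \<times> UNIV) (\<lambda>(\<mu>, t, z). F \<mu> t z)"
    and lip: "\<And>L. \<exists>K\<ge>0. \<forall>\<mu> t z w. \<bar>\<mu>\<bar> \<le> L \<longrightarrow> t \<in> {0..T} \<longrightarrow> norm (F \<mu> t z - F \<mu> t w) \<le> K * norm (z - w)"
  obtains z where "\<And>\<mu>. z \<mu> 0 = \<zeta>"
    and "\<And>\<mu> t. t \<in> {0..T} \<Longrightarrow> (z \<mu> has_vector_derivative F \<mu> t (z \<mu> t)) (at t within {0..T})"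
    and "continuous_on (UNIV \<times> {0..T}) (\<lambda>(\<mu>, t). z \<mu> t)"
proof -
  define pic where "pic = rec_nat (\<lambda>\<mu> t. \<zeta>) (\<lambda>n p \<mu> t. \<zeta> + integral {0..t} (\<lambda>s. F \<mu> s (p \<mu> s)))"
  have pic0: "pic 0 \<mu> t = \<zeta>" and picS: "pic (Suc n) \<mu> t = \<zeta> + integral {0..t} (\<lambda>s. F \<mu> s (pic n \<mu> s))"
    for n \<mu> t
    by (simp_all add: pic_def)
  have F_cont: "continuous_on (U \<times> {0..T}) (\<lambda>(\<mu>, t). F \<mu> t (p \<mu> t))"
    if "continuous_on (U \<times> {0..T}) (\<lambda>(\<mu>, t). p \<mu> t)" for p U
  proof -
    have p: "continuous_on (U \<times> {0..T}) (\<lambda>q. p (fst q) (snd q))"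
      using that by (simp add: case_prod_unfold)
    show ?thesis
    proof -
      have "continuous_on (U \<times> {0..T}) (\<lambda>q. (\<lambda>(\<mu>, t, z). F \<mu> t z) (fst q, snd q, p (fst q) (snd q)))"
        by (rule continuous_on_compose2[OF cont]) (auto intro!: continuous_intros p)
      then show ?thesis
        by (simp add: case_prod_unfold)
    qed
  qed
  have slice: "continuous_on {0..T} (p \<mu>)" if "continuous_on (U \<times> {0..T}) (\<lambda>(\<mu>, t). p \<mu> t)" "\<mu> \<in> U"
    for p :: "real \<Rightarrow> real \<Rightarrow> 'a" and \<mu> U
  proof -
    have "continuous_on {0..T} (\<lambda>s. (\<lambda>(\<mu>, s). p \<mu> s) (\<mu>, s))"
      by (rule continuous_on_compose2[OF that(1)]) (use that(2) in \<open>auto intro!: continuous_intros\<close>)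
    then show ?thesis
      by simp
  qed
  have pic_cont: "continuous_on (UNIV \<times> {0..T}) (\<lambda>(\<mu>, t). pic n \<mu> t)" for n
  proof (induction n)
    case 0
    then show ?case by (simp add: pic0)
  next
    case (Suc n)
    have "continuous_on (UNIV \<times> {0..T}) (\<lambda>(\<mu>, t). integral {0..t} (\<lambda>s. F \<mu> s (pic n \<mu> s)))"
      by (intro continuous_on_indefinite_integral_param F_cont Suc)
    then show ?case
      unfolding picS case_prod_unfold by (intro continuous_intros)
  qed
  \<comment> \<open>The limit of the iterates, written as a telescoping series so that the M-test
    applies.\<close>
  define z where "z \<mu> t = \<zeta> + (\<Sum>i. pic (Suc i) \<mu> t - pic i \<mu> t)" for \<mu> t
  have unif: "uniform_limit ({-L..L} \<times> {0..T}) (\<lambda>n (\<mu>, t). pic n \<mu> t) (\<lambda>(\<mu>, t). z \<mu> t) sequentially" for L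
  proof -
    obtain K where K: "K \<ge> 0" "\<And>\<mu> t z w. \<bar>\<mu>\<bar> \<le> L \<Longrightarrow> t \<in> {0..T} \<Longrightarrow> norm (F \<mu> t z - F \<mu> t w) \<le> K * norm (z - w)"
      using lip[of L] by blast
    have "continuous_on ({-L..L} \<times> {0..T}) (\<lambda>(\<mu>, t). F \<mu> t \<zeta>)"
      by (intro F_cont continuous_intros) (simp add: case_prod_unfold)
    then have "bounded ((\<lambda>(\<mu>, t). F \<mu> t \<zeta>) ` ({-L..L} \<times> {0..T}))"
      by (intro compact_imp_bounded compact_continuous_image compact_Times compact_Icc)
    then obtain B where B: "B > 0" "\<forall>x\<in>(\<lambda>(\<mu>, t). F \<mu> t \<zeta>) ` ({-L..L} \<times> {0..T}). norm x \<le> B"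
      unfolding bounded_pos by blast
    have F_int: "(\<lambda>s. F \<mu> s (pic n \<mu> s)) integrable_on {0..t}" if "t \<in> {0..T}" for n \<mu> t
      using slice[OF F_cont[OF pic_cont], of \<mu> n] that
      by (intro integrable_continuous_real) (auto intro: continuous_on_subset)
    \<comment> \<open>The factorial comes from integrating K times the previous bound; B bounds F at
      the initial value on the strip.\<close>
    have step: "norm (pic (Suc n) \<mu> t - pic n \<mu> t) \<le> B * K ^ n * (t ^ Suc n / fact (Suc n))"
      if "\<bar>\<mu>\<bar> \<le> L" "t \<in> {0..T}" for n \<mu> t
      using that(2)
    proof (induction n arbitrary: t)
      case 0
      have "norm (integral {0..t} (\<lambda>s. F \<mu> s (pic 0 \<mu> s))) \<le> integral {0..t} (\<lambda>s. B)"
      proof (rule integral_norm_bound_integral)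
        show "(\<lambda>s. F \<mu> s (pic 0 \<mu> s)) integrable_on {0..t}"
          using 0 by (rule F_int)
        show "norm (F \<mu> s (pic 0 \<mu> s)) \<le> B" if "s \<in> {0..t}" for s
          using B(2) that \<open>\<bar>\<mu>\<bar> \<le> L\<close> 0 by (auto simp: pic0 abs_le_iff)
      qed (simp_all add: integrable_const_ivl)
      then show ?case
        using 0 by (simp add: picS pic0 mult.commute)
    next
      case (Suc n)
      have pw: "((\<lambda>s. K * (B * K ^ n * (s ^ Suc n / fact (Suc n)))) has_integral
          (B * K ^ Suc n * (t ^ Suc (Suc n) / fact (Suc (Suc n))) - B * K ^ Suc n * (0 ^ Suc (Suc n) / fact (Suc (Suc n))))) {0..t}"
      proof (rule fundamental_theorem_of_calculus)
        fix s assume "s \<in> {0..t}"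
        have "((\<lambda>s. B * K ^ Suc n * (s ^ Suc (Suc n) / fact (Suc (Suc n)))) has_real_derivative
            B * K ^ Suc n * (real (Suc (Suc n)) * s ^ Suc n / fact (Suc (Suc n)))) (at s within {0..t})"
          by (intro derivative_eq_intros refl | simp)+
        moreover have "B * K ^ Suc n * (real (Suc (Suc n)) * s ^ Suc n / fact (Suc (Suc n)))
            = K * (B * K ^ n * (s ^ Suc n / fact (Suc n)))"
        proof -
          have "real (Suc (Suc n)) * s ^ Suc n / fact (Suc (Suc n)) = s ^ Suc n / fact (Suc n)"
            unfolding fact_Suc[of "Suc n"] by (simp del: of_nat_Suc fact_Suc power_Suc)
          then show ?thesis
            by (simp only: power_Suc mult_ac)
        qed
        ultimately show "((\<lambda>s. B * K ^ Suc n * (s ^ Suc (Suc n) / fact (Suc (Suc n)))) has_vector_derivative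
            K * (B * K ^ n * (s ^ Suc n / fact (Suc n)))) (at s within {0..t})"
          by (simp only: has_real_derivative_iff_has_vector_derivative)
      qed (use Suc in auto)
      have "pic (Suc (Suc n)) \<mu> t - pic (Suc n) \<mu> t
          = integral {0..t} (\<lambda>s. F \<mu> s (pic (Suc n) \<mu> s) - F \<mu> s (pic n \<mu> s))"
        unfolding picS[of "Suc n"] picS[of n \<mu> t] using Suc.prems
        by (subst integral_diff) (auto intro: F_int)
      also have "norm \<dots> \<le> integral {0..t} (\<lambda>s. K * (B * K ^ n * (s ^ Suc n / fact (Suc n))))"
      proof (rule integral_norm_bound_integral)
        show "(\<lambda>s. F \<mu> s (pic (Suc n) \<mu> s) - F \<mu> s (pic n \<mu> s)) integrable_on {0..t}"
          using Suc.prems by (intro integrable_diff F_int)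
        show "(\<lambda>s. K * (B * K ^ n * (s ^ Suc n / fact (Suc n)))) integrable_on {0..t}"
          using pw by blast
        fix s assume s: "s \<in> {0..t}"
        then have s': "s \<in> {0..T}"
          using Suc.prems by auto
        have "norm (F \<mu> s (pic (Suc n) \<mu> s) - F \<mu> s (pic n \<mu> s)) \<le> K * norm (pic (Suc n) \<mu> s - pic n \<mu> s)"
          using K(2) that(1) s' by blast
        also have "\<dots> \<le> K * (B * K ^ n * (s ^ Suc n / fact (Suc n)))"
          using Suc.IH[OF s'] K(1) by (intro mult_left_mono)
        finally show "norm (F \<mu> s (pic (Suc n) \<mu> s) - F \<mu> s (pic n \<mu> s))
            \<le> K * (B * K ^ n * (s ^ Suc n / fact (Suc n)))" .
      qed
      finally show ?case
        unfolding integral_unique[OF pw] by simp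
    qed
    have "uniform_limit ({-L..L} \<times> {0..T}) (\<lambda>n q. \<Sum>i<n. pic (Suc i) (fst q) (snd q) - pic i (fst q) (snd q))
        (\<lambda>q. \<Sum>i. pic (Suc i) (fst q) (snd q) - pic i (fst q) (snd q)) sequentially"
    proof (rule Weierstrass_m_test)
      fix n and q :: "real \<times> real" assume q: "q \<in> {-L..L} \<times> {0..T}"
      then have t: "snd q \<in> {0..T}" "\<bar>fst q\<bar> \<le> L"
        by auto
      have "norm (pic (Suc n) (fst q) (snd q) - pic n (fst q) (snd q)) \<le> B * K ^ n * (snd q ^ Suc n / fact (Suc n))"
        using step[OF t(2,1)] .
      also have "\<dots> \<le> B * K ^ n * (T ^ Suc n / fact n)"
        using t B K by (intro mult_left_mono frac_le power_mono fact_mono) auto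
      also have "\<dots> = B * T * (inverse (fact n) * (K * T) ^ n)"
        by (simp add: power_mult_distrib divide_inverse)
      finally show "norm (pic (Suc n) (fst q) (snd q) - pic n (fst q) (snd q)) \<le> B * T * (inverse (fact n) * (K * T) ^ n)" .
    next
      show "summable (\<lambda>n. B * T * (inverse (fact n) * (K * T) ^ n))"
        by (intro summable_mult summable_exp)
    qed
    then have "uniform_limit ({-L..L} \<times> {0..T}) (\<lambda>n q. \<zeta> + (\<Sum>i<n. pic (Suc i) (fst q) (snd q) - pic i (fst q) (snd q)))
        (\<lambda>q. \<zeta> + (\<Sum>i. pic (Suc i) (fst q) (snd q) - pic i (fst q) (snd q))) sequentially"
      by (intro uniform_limit_intros)
    moreover have "\<zeta> + (\<Sum>i<n. pic (Suc i) \<mu> t - pic i \<mu> t) = pic n \<mu> t" for n \<mu> t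
      by (subst sum_lessThan_telescope) (simp add: pic0)
    ultimately show ?thesis
      by (simp add: z_def case_prod_unfold)
  qed
  have z_contL: "continuous_on ({-L..L} \<times> {0..T}) (\<lambda>(\<mu>, t). z \<mu> t)" for L
  proof (rule uniform_limit_theorem[OF _ unif])
    show "\<forall>\<^sub>F n in sequentially. continuous_on ({-L..L} \<times> {0..T}) (\<lambda>(\<mu>, t). pic n \<mu> t)"
      by (intro always_eventually allI continuous_on_subset[OF pic_cont]) auto
  qed simp
  have z_cont: "continuous_on (UNIV \<times> {0..T}) (\<lambda>(\<mu>, t). z \<mu> t)"
    unfolding continuous_on_eq_continuous_within
  proof
    fix q :: "real \<times> real" assume q: "q \<in> UNIV \<times> {0..T}"
    define L where "L = \<bar>fst q\<bar> + 1"
    \<comment> \<open>Continuity at q only sees a neighbourhood of q, so a strip containing it in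
      its interior suffices.\<close>
    have "at q within (UNIV \<times> {0..T}) = at q within ({-L..L} \<times> {0..T})"
      by (rule at_within_nhd[of _ "{-L<..<L} \<times> UNIV"]) (auto simp: L_def mem_Times_iff intro: open_Times)
    moreover have "continuous (at q within ({-L..L} \<times> {0..T})) (\<lambda>(\<mu>, t). z \<mu> t)"
    proof (rule bspec[OF z_contL[of L, unfolded continuous_on_eq_continuous_within]])
      have "fst q \<in> {-L..L}"
        unfolding L_def by auto
      then show "q \<in> {-L..L} \<times> {0..T}"
        using q by (simp add: mem_Times_iff)
    qed
    ultimately show "continuous (at q within (UNIV \<times> {0..T})) (\<lambda>(\<mu>, t). z \<mu> t)"
      by simp
  qed
  have integral_eq: "z \<mu> t = \<zeta> + integral {0..t} (\<lambda>s. F \<mu> s (z \<mu> s))" if t: "t \<in> {0..T}" for \<mu> t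
  proof -
    define L where "L = \<bar>\<mu>\<bar>"
    obtain K where K: "K \<ge> 0" "\<And>\<mu> t z w. \<bar>\<mu>\<bar> \<le> L \<Longrightarrow> t \<in> {0..T} \<Longrightarrow> norm (F \<mu> t z - F \<mu> t w) \<le> K * norm (z - w)"
      using lip[of L] by blast
    have close: "\<forall>\<^sub>F n in sequentially. \<forall>s\<in>{0..T}. dist (pic n \<mu> s) (z \<mu> s) < e" if "e > 0" for e
      using uniform_limitD[OF unif[of L] that]
    proof eventually_elim
      case (elim n)
      have "\<mu> \<in> {-L..L}"
        unfolding L_def by auto
      then show ?case
        using elim by auto
    qed
    have lim: "uniform_limit {0..t} (\<lambda>n s. F \<mu> s (pic n \<mu> s)) (\<lambda>s. F \<mu> s (z \<mu> s)) sequentially"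
    proof (rule uniform_limitI)
      fix e :: real assume e: "e > 0"
      have "e / (K + 1) > 0"
        using e K(1) by simp
      from close[OF this] show "\<forall>\<^sub>F n in sequentially. \<forall>s\<in>{0..t}. dist (F \<mu> s (pic n \<mu> s)) (F \<mu> s (z \<mu> s)) < e"
      proof eventually_elim
        case (elim n)
        show ?case
        proof
          fix s assume "s \<in> {0..t}"
          then have s: "s \<in> {0..T}"
            using t by auto
          have "dist (F \<mu> s (pic n \<mu> s)) (F \<mu> s (z \<mu> s)) \<le> K * dist (pic n \<mu> s) (z \<mu> s)"
            unfolding dist_norm using K(2)[of \<mu> s] s by (simp add: L_def)
          also have "\<dots> \<le> K * (e / (K + 1))"
            using elim s K(1) by (intro mult_left_mono) (auto intro: less_imp_le)
          also have "\<dots> < e"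
            using e K(1) by (simp add: field_simps)
          finally show "dist (F \<mu> s (pic n \<mu> s)) (F \<mu> s (z \<mu> s)) < e" .
        qed
      qed
    qed
    obtain I J where IJ: "\<And>n. ((\<lambda>s. F \<mu> s (pic n \<mu> s)) has_integral I n) {0..t}"
      "((\<lambda>s. F \<mu> s (z \<mu> s)) has_integral J) {0..t}" "I \<longlonglongrightarrow> J"
    proof (rule uniform_limit_integral[OF lim])
      fix n
      show "continuous_on {0..t} (\<lambda>s. F \<mu> s (pic n \<mu> s))"
        using slice[OF F_cont[OF pic_cont], of \<mu> n] t by (auto intro: continuous_on_subset)
    qed auto
    have "(\<lambda>n. pic n \<mu> t) \<longlonglongrightarrow> z \<mu> t"
      unfolding tendsto_iff
    proof (intro allI impI)
      fix e :: real assume "e > 0"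
      from close[OF this] show "\<forall>\<^sub>F n in sequentially. dist (pic n \<mu> t) (z \<mu> t) < e"
        by eventually_elim (use t in auto)
    qed
    then have "(\<lambda>n. pic (Suc n) \<mu> t) \<longlonglongrightarrow> z \<mu> t"
      by (rule LIMSEQ_Suc)
    moreover have "pic (Suc n) \<mu> t = \<zeta> + I n" for n
      using integral_unique[OF IJ(1)[of n]] by (simp add: picS)
    moreover have "(\<lambda>n. \<zeta> + I n) \<longlonglongrightarrow> \<zeta> + J"
      by (intro tendsto_intros IJ)
    ultimately have "z \<mu> t = \<zeta> + J"
      using LIMSEQ_unique by simp
    then show ?thesis
      using integral_unique[OF IJ(2)] by simp
  qed
  show ?thesis
  proof (rule that[of z])
    show "z \<mu> 0 = \<zeta>" for \<mu>
      using integral_eq[of 0] T by simp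
    show "(z \<mu> has_vector_derivative F \<mu> t (z \<mu> t)) (at t within {0..T})" if t: "t \<in> {0..T}" for \<mu> t
    proof (rule has_vector_derivative_transform[OF t integral_eq])
      have "continuous_on {0..T} (\<lambda>s. F \<mu> s (z \<mu> s))"
        by (rule slice[OF F_cont[OF z_cont]]) simp
      from integral_has_vector_derivative[OF this t]
      show "((\<lambda>t. \<zeta> + integral {0..t} (\<lambda>s. F \<mu> s (z \<mu> s))) has_vector_derivative F \<mu> t (z \<mu> t)) (at t within {0..T})"
        by (auto intro!: derivative_eq_intros)
    qed
  qed (rule z_cont)
qed

section \<open>Lagrangian subspaces\<close>

lemma omega1_eq: "omega1 u v = u $ 1 * cnj (v $ 2) - u $ 2 * cnj (v $ 1)"
  by (simp add: omega1_def hinner_def J1_def matrix_vector_mult_def sum_2)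

text \<open>With X = (x(0), x(T)) and Y = (- y(0), y(T)) the right side is <Y, X'> - <X, Y'>; the
  sign inside Y absorbs the sign of the first summand of \<open>Omega\<close>.\<close>

lemma Omega_eq:
  "Omega v w = (- fst v $ 1 * cnj (fst w $ 2) + snd v $ 1 * cnj (snd w $ 2))
     - (fst v $ 2 * cnj (- fst w $ 1) + snd v $ 2 * cnj (snd w $ 1))"
  by (simp add: Omega_def omega1_eq)

lemma bvals_eqI:
  fixes v w :: bvals
  assumes "fst v $ 1 = fst w $ 1" "fst v $ 2 = fst w $ 2" "snd v $ 1 = snd w $ 1" "snd v $ 2 = snd w $ 2"
  shows "v = w"
  using assms by (simp add: prod_eq_iff vec_eq_iff forall_2)

lemma bscale_comps [simp]:
  "fst (bscale c v) $ i = c * fst v $ i" "snd (bscale c v) $ i = c * snd v $ i"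
  by (simp_all add: bscale_def)

section \<open>Normal forms of the three layers\<close>

definition Lag_graph :: "real \<Rightarrow> real \<Rightarrow> complex \<Rightarrow> bvals set" where
  "Lag_graph h11 h22 h12 =
     {v. - fst v $ 1 = of_real h11 * fst v $ 2 + h12 * snd v $ 2 \<and>
         snd v $ 1 = cnj h12 * fst v $ 2 + of_real h22 * snd v $ 2}"

definition Lag_line :: "complex \<Rightarrow> complex \<Rightarrow> real \<Rightarrow> bvals set" where
  "Lag_line \<xi>0 \<xi>1 h =
     {v. \<exists>s. fst v $ 2 = s * \<xi>0 \<and> snd v $ 2 = s * \<xi>1 \<and>
         - fst v $ 1 * cnj \<xi>0 + snd v $ 1 * cnj \<xi>1 = of_real h * s}"

lemma Lambda_D_iff: "v \<in> Lambda_D \<longleftrightarrow> fst v $ 2 = 0 \<and> snd v $ 2 = 0"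
  by (cases v) (simp add: Lambda_D_def)

lemma subspace_Lambda_D: "bvec.subspace Lambda_D"
  by (auto simp: bvec.subspace_def Lambda_D_iff)

lemma LagD:
  assumes "\<Lambda> \<in> Lag"
  shows "bvec.subspace \<Lambda>" "bvec.dim \<Lambda> = 2" "\<And>v w. v \<in> \<Lambda> \<Longrightarrow> w \<in> \<Lambda> \<Longrightarrow> Omega v w = 0"
  using assms by (auto simp: Lag_def)

text \<open>Two functionals with trivial common kernel on a plane have nonzero determinant on a
  basis: otherwise the combinations with coefficients (p f, - p e) and (q f, - q e) would lie in
  that kernel.\<close>

lemma pair_relation_zero:
  fixes e f :: bvals
  assumes ind: "\<And>a b. bscale a e + bscale b f = 0 \<Longrightarrow> a = 0 \<and> b = 0"
    and zero: "\<And>a b. p (bscale a e + bscale b f) = 0 \<Longrightarrow> q (bscale a e + bscale b f) = 0 \<Longrightarrow>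
      bscale a e + bscale b f = 0"
    and lin: "\<And>a b. p (bscale a e + bscale b f) = a * p e + b * p f"
      "\<And>a b. q (bscale a e + bscale b f) = a * q e + b * q f"
  shows "p e * q f - q e * p f \<noteq> (0 :: complex)"
proof
  assume D: "p e * q f - q e * p f = 0"
  have z: "a = 0 \<and> b = 0" if "a * p e + b * p f = 0" "a * q e + b * q f = 0" for a b
  proof (rule ind)
    show "bscale a e + bscale b f = 0"
      by (rule zero) (simp_all only: lin that)
  qed
  have 1: "p f = 0 \<and> - p e = 0"
    by (rule z) (use D in \<open>auto simp: algebra_simps\<close>)
  have "q f = 0 \<and> - q e = 0"
    by (rule z) (use 1 in \<open>auto simp: algebra_simps\<close>)
  then show False
    using z[of 1 0] 1 by simp
qed

text \<open>Transversality to the Dirichlet plane makes the projection of \<Lambda> to X injective,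
  so Y is a linear function of X on \<Lambda>; isotropy makes its matrix Hermitian.\<close>

lemma layer0_iff: "\<Lambda> \<in> layer 0 \<longleftrightarrow> (\<exists>h11 h22 h12. \<Lambda> = Lag_graph h11 h22 h12)"
proof
  assume L: "\<Lambda> \<in> layer 0"
  then have Lag: "\<Lambda> \<in> Lag" and d0: "bvec.dim (\<Lambda> \<inter> Lambda_D) = 0"
    by (auto simp: layer_def)
  note sub = LagD(1)[OF Lag]
  obtain e f where ef: "\<Lambda> = {bscale a e + bscale b f |a b. True}"
    "\<forall>a b. bscale a e + bscale b f = 0 \<longrightarrow> a = 0 \<and> b = 0"
    using bvec.dim_eq_2D[OF LagD(1,2)[OF Lag]] by blast
  have "\<Lambda> \<inter> Lambda_D = {0}"
  proof (rule bvec.dim_eq_0D[OF _ d0])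
    show "bvec.subspace (\<Lambda> \<inter> Lambda_D)"
      using sub subspace_Lambda_D by (rule bvec.subspace_inter)
    show "\<Lambda> \<inter> Lambda_D \<subseteq> bvec.span {e, f}"
      unfolding bvec.span_pair_eq ef(1) by blast
  qed simp
  then have zero: "v = 0" if "v \<in> \<Lambda>" "fst v $ 2 = 0" "snd v $ 2 = 0" for v
    using that Lambda_D_iff[of v] by blast
  define D where "D = fst e $ 2 * snd f $ 2 - snd e $ 2 * fst f $ 2"
  have D: "D \<noteq> 0"
    unfolding D_def
  proof (rule pair_relation_zero[of e f "\<lambda>v. fst v $ 2" "\<lambda>v. snd v $ 2"])
    show "bscale a e + bscale b f = 0"
      if "fst (bscale a e + bscale b f) $ 2 = 0" "snd (bscale a e + bscale b f) $ 2 = 0" for a b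
      using zero[OF _ that] ef(1) by blast
  qed (use ef(2) in auto)
  \<comment> \<open>Cramer's rule: the basis of \<Lambda> whose X parts are (1, 0) and (0, 1). Its Y
    parts are the columns of H.\<close>
  define e1 where "e1 = bscale (snd f $ 2 / D) e + bscale (- snd e $ 2 / D) f"
  define e2 where "e2 = bscale (- fst f $ 2 / D) e + bscale (fst e $ 2 / D) f"
  have mem: "e1 \<in> \<Lambda>" "e2 \<in> \<Lambda>"
    unfolding e1_def e2_def ef(1) by blast+
  have div: "a / D + b / D = (a + b) / D" for a b :: complex
    by (simp add: add_divide_distrib)
  have "snd f $ 2 / D * fst e $ 2 + - snd e $ 2 / D * fst f $ 2 = D / D"
    "- fst f $ 2 / D * snd e $ 2 + fst e $ 2 / D * snd f $ 2 = D / D"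
    unfolding times_divide_eq_left div
    by (rule arg_cong[of _ _ "\<lambda>w. w / D"], simp add: D_def algebra_simps)+
  then have X1: "fst e1 $ 2 = 1" "snd e1 $ 2 = 0" and X2: "fst e2 $ 2 = 0" "snd e2 $ 2 = 1"
    using D by (simp_all add: e1_def e2_def)
  define h11 where "h11 = Re (- fst e1 $ 1)"
  define h22 where "h22 = Re (snd e2 $ 1)"
  define h12 where "h12 = - fst e2 $ 1"
  have "- fst e1 $ 1 = cnj (- fst e1 $ 1)" "snd e2 $ 1 = cnj (snd e2 $ 1)" "snd e1 $ 1 = cnj h12"
    using LagD(3)[OF Lag mem(1) mem(1)] LagD(3)[OF Lag mem(2) mem(2)] LagD(3)[OF Lag mem(1) mem(2)]
    by (simp_all add: Omega_eq X1 X2 h12_def eq_neg_iff_add_eq_0)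
  then have Y: "fst e1 $ 1 = - of_real h11" "snd e2 $ 1 = of_real h22" "snd e1 $ 1 = cnj h12"
    "fst e2 $ 1 = - h12"
    by (simp_all add: h11_def h22_def h12_def complex_eq_iff)
  have "\<Lambda> = Lag_graph h11 h22 h12"
  proof (intro equalityI subsetI)
    fix v assume v: "v \<in> \<Lambda>"
    define w where "w = v - (bscale (fst v $ 2) e1 + bscale (snd v $ 2) e2)"
    have "w = 0"
    proof (rule zero)
      show "w \<in> \<Lambda>"
        unfolding w_def using v mem sub by (intro bvec.subspace_diff bvec.subspace_add bvec.subspace_scale)
    qed (simp_all add: w_def X1 X2)
    then have "v = bscale (fst v $ 2) e1 + bscale (snd v $ 2) e2"
      by (simp add: w_def)
    then have "fst v $ 1 = fst (bscale (fst v $ 2) e1 + bscale (snd v $ 2) e2) $ 1"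
      "snd v $ 1 = snd (bscale (fst v $ 2) e1 + bscale (snd v $ 2) e2) $ 1"
      by simp_all
    then have "fst v $ 1 = fst v $ 2 * (- of_real h11) + snd v $ 2 * (- h12)"
      "snd v $ 1 = fst v $ 2 * cnj h12 + snd v $ 2 * of_real h22"
      by (simp_all only: fst_add snd_add vector_add_component bscale_comps Y)
    then show "v \<in> Lag_graph h11 h22 h12"
      by (simp add: Lag_graph_def)
  next
    fix v assume v: "v \<in> Lag_graph h11 h22 h12"
    have "v = bscale (fst v $ 2) e1 + bscale (snd v $ 2) e2"
    proof (rule bvals_eqI)
      show "fst v $ 1 = fst (bscale (fst v $ 2) e1 + bscale (snd v $ 2) e2) $ 1"
      proof -
        have *: "- fst v $ 1 = of_real h11 * fst v $ 2 + h12 * snd v $ 2"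
          using v by (simp add: Lag_graph_def)
        have "fst v $ 1 = - (of_real h11 * fst v $ 2 + h12 * snd v $ 2)"
          unfolding *[symmetric] by simp
        then show ?thesis
          by (simp add: Y mult.commute)
      qed
      show "snd v $ 1 = snd (bscale (fst v $ 2) e1 + bscale (snd v $ 2) e2) $ 1"
        using v by (simp add: Lag_graph_def Y)
    qed (simp_all add: X1 X2)
    also have "\<dots> \<in> \<Lambda>"
      using mem sub by (intro bvec.subspace_add bvec.subspace_scale)
    finally show "v \<in> \<Lambda>" .
  qed
  then show "\<exists>h11 h22 h12. \<Lambda> = Lag_graph h11 h22 h12"
    by blast
next
  assume "\<exists>h11 h22 h12. \<Lambda> = Lag_graph h11 h22 h12"
  then obtain h11 h22 h12 where L: "\<Lambda> = Lag_graph h11 h22 h12"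
    by blast
  define e1 :: bvals where "e1 = (vector [- of_real h11, 1], vector [cnj h12, 0])"
  define e2 :: bvals where "e2 = (vector [- h12, 0], vector [of_real h22, 1])"
  have mem: "v \<in> \<Lambda> \<longleftrightarrow> fst v $ 1 = fst v $ 2 * (- of_real h11) + snd v $ 2 * (- h12) \<and>
      snd v $ 1 = fst v $ 2 * cnj h12 + snd v $ 2 * of_real h22" for v
  proof -
    have "- a = b \<longleftrightarrow> a = - b" for a b :: complex
      by auto
    then show ?thesis
      by (simp add: L Lag_graph_def mult.commute)
  qed
  have eq: "\<Lambda> = {bscale a e1 + bscale b e2 |a b. True}"
  proof (intro equalityI subsetI)
    fix v assume "v \<in> \<Lambda>"
    then have "v = bscale (fst v $ 2) e1 + bscale (snd v $ 2) e2"
      by (intro bvals_eqI) (simp_all add: mem e1_def e2_def)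
    then show "v \<in> {bscale a e1 + bscale b e2 |a b. True}"
      by blast
  qed (auto simp: mem e1_def e2_def)
  have "bvec.dim \<Lambda> = 2"
    unfolding eq
  proof (rule bvec.dim_pair)
    fix a b assume "bscale a e1 + bscale b e2 = 0"
    then have "fst (bscale a e1 + bscale b e2) $ 2 = 0" "snd (bscale a e1 + bscale b e2) $ 2 = 0"
      by simp_all
    then show "a = 0 \<and> b = 0"
      by (simp add: e1_def e2_def)
  qed
  moreover have "bvec.subspace \<Lambda>"
    unfolding bvec.subspace_def
  proof (intro conjI ballI allI)
    show "v + w \<in> \<Lambda>" if "v \<in> \<Lambda>" "w \<in> \<Lambda>" for v w
      using that unfolding mem by (simp add: ring_distribs)
    show "bscale c v \<in> \<Lambda>" if "v \<in> \<Lambda>" for c v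
      using that unfolding mem by (simp add: ring_distribs mult.assoc)
  qed (simp add: mem)
  moreover have "Omega v w = 0" if "v \<in> \<Lambda>" "w \<in> \<Lambda>" for v w
  proof -
    have v: "fst v $ 1 = fst v $ 2 * (- of_real h11) + snd v $ 2 * (- h12)"
        "snd v $ 1 = fst v $ 2 * cnj h12 + snd v $ 2 * of_real h22"
      and w: "fst w $ 1 = fst w $ 2 * (- of_real h11) + snd w $ 2 * (- h12)"
        "snd w $ 1 = fst w $ 2 * cnj h12 + snd w $ 2 * of_real h22"
      using that unfolding mem by blast+
    show ?thesis
      unfolding Omega_eq v w by (simp add: algebra_simps)
  qed
  moreover have "\<Lambda> \<inter> Lambda_D = {0}"
    by (auto simp: mem Lambda_D_iff intro!: bvals_eqI)
  ultimately show "\<Lambda> \<in> layer 0"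
    by (simp add: layer_def Lag_def bvec.dim_zero)
qed

text \<open>In two dimensions the orthogonal complement of a nonzero vector is a line.\<close>

lemma orthogonal_complex_pair:
  fixes a0 a1 b0 b1 c0 c1 :: complex
  assumes "a0 * cnj c0 + a1 * cnj c1 = 0" "b0 * cnj c0 + b1 * cnj c1 = 0"
    and c: "c0 \<noteq> 0 \<or> c1 \<noteq> 0" and b: "b0 \<noteq> 0 \<or> b1 \<noteq> 0"
  shows "\<exists>k. a0 = k * b0 \<and> a1 = k * b1"
proof -
  have "(a0 * b1 - a1 * b0) * cnj c0 = (a0 * cnj c0 + a1 * cnj c1) * b1 - a1 * (b0 * cnj c0 + b1 * cnj c1)"
    "(a0 * b1 - a1 * b0) * cnj c1 = a0 * (b0 * cnj c0 + b1 * cnj c1) - (a0 * cnj c0 + a1 * cnj c1) * b0"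
    by (simp_all add: algebra_simps)
  then have "(a0 * b1 - a1 * b0) * cnj c0 = 0" "(a0 * b1 - a1 * b0) * cnj c1 = 0"
    unfolding assms(1,2) by simp_all
  then have D: "a0 * b1 - a1 * b0 = 0"
    using c by auto
  show ?thesis
  proof (cases "b0 = 0")
    case True
    then have "a0 = 0" "b1 \<noteq> 0"
      using D b by auto
    then show ?thesis
      using True by (intro exI[of _ "a1 / b1"]) simp
  next
    case False
    then have "a1 = a0 / b0 * b1"
      using D by (simp add: field_simps)
    then show ?thesis
      using False by (intro exI[of _ "a0 / b0"]) simp
  qed
qed

text \<open>The vector g spanning the intersection has X = 0, so isotropy against g makes every X in
  \<Lambda> orthogonal to the Y part of g, hence a multiple of one \<xi>. Isotropy against a vector
  v0 with X = \<xi> then fixes <Y, \<xi>>, and isotropy of v0 with itself makes h real.\<close>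

lemma layer1_iff:
  "\<Lambda> \<in> layer 1 \<longleftrightarrow> (\<exists>\<xi>0 \<xi>1 h. (\<xi>0 \<noteq> 0 \<or> \<xi>1 \<noteq> 0) \<and> \<Lambda> = Lag_line \<xi>0 \<xi>1 h)"
proof
  assume L: "\<Lambda> \<in> layer 1"
  then have Lag: "\<Lambda> \<in> Lag" and d1: "bvec.dim (\<Lambda> \<inter> Lambda_D) = 1"
    by (auto simp: layer_def)
  note sub = LagD(1)[OF Lag]
  obtain e f where ef: "\<Lambda> = {bscale a e + bscale b f |a b. True}"
    "\<forall>a b. bscale a e + bscale b f = 0 \<longrightarrow> a = 0 \<and> b = 0"
    using bvec.dim_eq_2D[OF LagD(1,2)[OF Lag]] by blast
  obtain g where g: "\<Lambda> \<inter> Lambda_D = range (\<lambda>a. bscale a g)" "g \<noteq> 0"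
    using bvec.dim_eq_1D[OF bvec.subspace_inter[OF sub subspace_Lambda_D] d1] by blast
  have "bscale 1 g \<in> \<Lambda> \<inter> Lambda_D"
    unfolding g(1) by blast
  then have gm: "g \<in> \<Lambda>" "fst g $ 2 = 0" "snd g $ 2 = 0"
    by (auto simp: Lambda_D_iff)
  have \<eta>: "- fst g $ 1 \<noteq> 0 \<or> snd g $ 1 \<noteq> 0"
    using g(2) gm bvals_eqI[of g 0] by auto
  have em: "bscale 1 e + bscale 0 f \<in> \<Lambda>" "bscale 0 e + bscale 1 f \<in> \<Lambda>"
    unfolding ef(1) by blast+
  have "\<exists>v\<in>\<Lambda>. v \<notin> Lambda_D"
  proof (rule ccontr)
    assume "\<not> ?thesis"
    then have "e \<in> range (\<lambda>a. bscale a g)" "f \<in> range (\<lambda>a. bscale a g)"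
      using em unfolding g(1)[symmetric] by auto
    then obtain a b where ab: "e = bscale a g" "f = bscale b g"
      by blast
    have "bscale b e + bscale (- a) f = 0"
      unfolding ab by (simp add: mult.commute)
    then have "a = 0"
      using ef(2) by fastforce
    then have "bscale 1 e + bscale 0 f = 0"
      using ab by simp
    then show False
      using ef(2) by fastforce
  qed
  then obtain v0 where v0: "v0 \<in> \<Lambda>" "fst v0 $ 2 \<noteq> 0 \<or> snd v0 $ 2 \<noteq> 0"
    unfolding Lambda_D_iff by blast
  define \<xi>0 where "\<xi>0 = fst v0 $ 2"
  define \<xi>1 where "\<xi>1 = snd v0 $ 2"
  define h where "h = Re (- fst v0 $ 1 * cnj \<xi>0 + snd v0 $ 1 * cnj \<xi>1)"
  define w where "w = - fst v0 $ 1 * cnj \<xi>0 + snd v0 $ 1 * cnj \<xi>1"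
  have "w = cnj w"
    using LagD(3)[OF Lag v0(1) v0(1)] by (simp add: w_def Omega_eq \<xi>0_def \<xi>1_def mult.commute)
  then have "w = of_real (Re w)"
    by (simp add: complex_eq_iff)
  then have h: "- fst v0 $ 1 * cnj \<xi>0 + snd v0 $ 1 * cnj \<xi>1 = of_real h"
    unfolding h_def w_def .
  have orth: "(- fst g $ 1) * cnj \<xi>0 + snd g $ 1 * cnj \<xi>1 = 0"
    using LagD(3)[OF Lag gm(1) v0(1)] by (simp add: Omega_eq gm \<xi>0_def \<xi>1_def)
  have orth': "\<xi>0 * cnj (- fst g $ 1) + \<xi>1 * cnj (snd g $ 1) = 0"
    using arg_cong[OF orth, of cnj] by (simp add: mult.commute)
  have "\<Lambda> = Lag_line \<xi>0 \<xi>1 h"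
  proof (intro equalityI subsetI)
    fix v assume v: "v \<in> \<Lambda>"
    have "fst v $ 2 * cnj (- fst g $ 1) + snd v $ 2 * cnj (snd g $ 1) = 0"
      using LagD(3)[OF Lag v gm(1)] by (simp add: Omega_eq gm)
    from orthogonal_complex_pair[OF this orth' \<eta>] obtain s where s: "fst v $ 2 = s * \<xi>0" "snd v $ 2 = s * \<xi>1"
      using v0(2) unfolding \<xi>0_def \<xi>1_def by blast
    have "- fst v $ 1 * cnj \<xi>0 + snd v $ 1 * cnj \<xi>1 = s * (\<xi>0 * cnj (- fst v0 $ 1) + \<xi>1 * cnj (snd v0 $ 1))"
      using LagD(3)[OF Lag v v0(1)] by (simp add: Omega_eq s \<xi>0_def[symmetric] \<xi>1_def[symmetric] algebra_simps)
    also have "\<xi>0 * cnj (- fst v0 $ 1) + \<xi>1 * cnj (snd v0 $ 1) = of_real h"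
      using arg_cong[OF h, of cnj] by (simp add: mult.commute)
    finally show "v \<in> Lag_line \<xi>0 \<xi>1 h"
      using s by (auto simp: Lag_line_def mult.commute)
  next
    fix v assume "v \<in> Lag_line \<xi>0 \<xi>1 h"
    then obtain s where s: "fst v $ 2 = s * \<xi>0" "snd v $ 2 = s * \<xi>1"
      "- fst v $ 1 * cnj \<xi>0 + snd v $ 1 * cnj \<xi>1 = of_real h * s"
      by (auto simp: Lag_line_def)
    \<comment> \<open>This difference has X = 0 and Y orthogonal to \<xi>, which makes it a multiple
      of g.\<close>
    define w where "w = v - bscale s v0"
    have "- fst w $ 1 * cnj \<xi>0 + snd w $ 1 * cnj \<xi>1 = of_real h * s
        - s * (- fst v0 $ 1 * cnj \<xi>0 + snd v0 $ 1 * cnj \<xi>1)"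
      unfolding s(3)[symmetric] by (simp add: w_def algebra_simps)
    then have "(- fst w $ 1) * cnj \<xi>0 + snd w $ 1 * cnj \<xi>1 = 0"
      unfolding h by simp
    from orthogonal_complex_pair[OF this orth _ \<eta>]
    obtain k where k: "- fst w $ 1 = k * (- fst g $ 1)" "snd w $ 1 = k * snd g $ 1"
      using v0(2) unfolding \<xi>0_def \<xi>1_def by blast
    have "w = bscale k g"
      using k by (intro bvals_eqI) (simp_all add: gm, simp_all add: w_def s \<xi>0_def \<xi>1_def)
    then have "v = bscale k g + bscale s v0"
      by (simp add: w_def algebra_simps)
    also have "\<dots> \<in> \<Lambda>"
      using gm v0 sub by (intro bvec.subspace_add bvec.subspace_scale)
    finally show "v \<in> \<Lambda>" .
  qed
  then show "\<exists>\<xi>0 \<xi>1 h. (\<xi>0 \<noteq> 0 \<or> \<xi>1 \<noteq> 0) \<and> \<Lambda> = Lag_line \<xi>0 \<xi>1 h"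
    using v0(2) unfolding \<xi>0_def \<xi>1_def by blast
next
  assume "\<exists>\<xi>0 \<xi>1 h. (\<xi>0 \<noteq> 0 \<or> \<xi>1 \<noteq> 0) \<and> \<Lambda> = Lag_line \<xi>0 \<xi>1 h"
  then obtain \<xi>0 \<xi>1 h where \<xi>: "\<xi>0 \<noteq> 0 \<or> \<xi>1 \<noteq> 0" and L: "\<Lambda> = Lag_line \<xi>0 \<xi>1 h"
    by blast
  define r where "r = \<xi>0 * cnj \<xi>0 + \<xi>1 * cnj \<xi>1"
  have r: "r \<noteq> 0"
  proof -
    have "r = of_real ((cmod \<xi>0)\<^sup>2 + (cmod \<xi>1)\<^sup>2)"
      by (simp add: r_def complex_norm_square[symmetric] del: of_real_power)
    moreover have "(cmod \<xi>0)\<^sup>2 + (cmod \<xi>1)\<^sup>2 \<noteq> 0"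
      using \<xi> by (simp add: sum_power2_eq_zero_iff)
    ultimately show ?thesis
      by (simp only: of_real_eq_0_iff not_False_eq_True)
  qed
  \<comment> \<open>g has X = 0 and Y = (cnj \<xi>1, - cnj \<xi>0), which is orthogonal to \<xi>; f
    has X = \<xi> and Y = h \<xi> / |\<xi>|^2.\<close>
  define g :: bvals where "g = (vector [- cnj \<xi>1, 0], vector [- cnj \<xi>0, 0])"
  define f :: bvals where "f = (vector [- (of_real h * \<xi>0 / r), \<xi>0], vector [of_real h * \<xi>1 / r, \<xi>1])"
  have memI: "v \<in> \<Lambda>" if "fst v $ 2 = s * \<xi>0" "snd v $ 2 = s * \<xi>1"
    "- fst v $ 1 * cnj \<xi>0 + snd v $ 1 * cnj \<xi>1 = of_real h * s" for v s
    using that by (auto simp: L Lag_line_def)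
  have memE: "\<exists>s. fst v $ 2 = s * \<xi>0 \<and> snd v $ 2 = s * \<xi>1 \<and>
      - fst v $ 1 * cnj \<xi>0 + snd v $ 1 * cnj \<xi>1 = of_real h * s" if "v \<in> \<Lambda>" for v
    using that by (simp add: L Lag_line_def)
  have fm: "f \<in> \<Lambda>"
  proof (rule memI[of _ 1])
    have "- fst f $ 1 * cnj \<xi>0 + snd f $ 1 * cnj \<xi>1 = of_real h * (\<xi>0 * cnj \<xi>0 + \<xi>1 * cnj \<xi>1) / r"
      by (simp add: f_def algebra_simps add_divide_distrib)
    then show "- fst f $ 1 * cnj \<xi>0 + snd f $ 1 * cnj \<xi>1 = of_real h * 1"
      using r by (simp add: r_def[symmetric])
  qed (simp_all add: f_def)
  have gm: "g \<in> \<Lambda>"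
    by (rule memI[of _ 0]) (simp_all add: g_def)
  have sub: "bvec.subspace \<Lambda>"
    unfolding bvec.subspace_def
  proof (intro conjI ballI allI)
    show "0 \<in> \<Lambda>"
      by (rule memI[of _ 0]) simp_all
    fix v assume v: "v \<in> \<Lambda>"
    obtain s where s: "fst v $ 2 = s * \<xi>0" "snd v $ 2 = s * \<xi>1"
      "- fst v $ 1 * cnj \<xi>0 + snd v $ 1 * cnj \<xi>1 = of_real h * s"
      using memE[OF v] by blast
    show "bscale c v \<in> \<Lambda>" for c
    proof (rule memI[of _ "c * s"])
      have "- fst (bscale c v) $ 1 * cnj \<xi>0 + snd (bscale c v) $ 1 * cnj \<xi>1
          = c * (- fst v $ 1 * cnj \<xi>0 + snd v $ 1 * cnj \<xi>1)"
        by (simp add: algebra_simps)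
      then show "- fst (bscale c v) $ 1 * cnj \<xi>0 + snd (bscale c v) $ 1 * cnj \<xi>1 = of_real h * (c * s)"
        unfolding s(3) by simp
    qed (simp_all add: s)
    fix w assume w: "w \<in> \<Lambda>"
    obtain s' where s': "fst w $ 2 = s' * \<xi>0" "snd w $ 2 = s' * \<xi>1"
      "- fst w $ 1 * cnj \<xi>0 + snd w $ 1 * cnj \<xi>1 = of_real h * s'"
      using memE[OF w] by blast
    show "v + w \<in> \<Lambda>"
    proof (rule memI[of _ "s + s'"])
      have "- fst (v + w) $ 1 * cnj \<xi>0 + snd (v + w) $ 1 * cnj \<xi>1
          = (- fst v $ 1 * cnj \<xi>0 + snd v $ 1 * cnj \<xi>1) + (- fst w $ 1 * cnj \<xi>0 + snd w $ 1 * cnj \<xi>1)"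
        by (simp add: algebra_simps)
      then show "- fst (v + w) $ 1 * cnj \<xi>0 + snd (v + w) $ 1 * cnj \<xi>1 = of_real h * (s + s')"
        unfolding s(3) s'(3) by (simp add: algebra_simps)
    qed (simp_all add: s s' algebra_simps)
  qed
  have multiple: "\<exists>k. w = bscale k g" if w: "w \<in> \<Lambda>" "fst w $ 2 = 0" "snd w $ 2 = 0" for w
  proof -
    obtain s where s: "s * \<xi>0 = 0" "s * \<xi>1 = 0" "- fst w $ 1 * cnj \<xi>0 + snd w $ 1 * cnj \<xi>1 = of_real h * s"
      using memE[OF w(1)] w(2,3) by auto
    then have "s = 0"
      using \<xi> by auto
    then have "(- fst w $ 1) * cnj \<xi>0 + snd w $ 1 * cnj \<xi>1 = 0"
      using s by simp
    moreover have "cnj \<xi>1 * cnj \<xi>0 + (- cnj \<xi>0) * cnj \<xi>1 = 0"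
      by simp
    ultimately obtain k where "- fst w $ 1 = k * cnj \<xi>1" "snd w $ 1 = k * (- cnj \<xi>0)"
      using orthogonal_complex_pair[of "- fst w $ 1" \<xi>0 "snd w $ 1" \<xi>1 "cnj \<xi>1" "- cnj \<xi>0"] \<xi> by auto
    then have "w = bscale k g"
      using w by (intro bvals_eqI) (simp_all add: g_def, metis add.inverse_inverse)
    then show ?thesis
      by blast
  qed
  have eq: "\<Lambda> = {bscale a g + bscale b f |a b. True}"
  proof (intro equalityI subsetI)
    fix v assume v: "v \<in> \<Lambda>"
    obtain s where s: "fst v $ 2 = s * \<xi>0" "snd v $ 2 = s * \<xi>1"
      using memE[OF v] by blast
    have "v - bscale s f \<in> \<Lambda>"
      using v fm sub by (intro bvec.subspace_diff bvec.subspace_scale)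
    then obtain k where "v - bscale s f = bscale k g"
      using multiple[of "v - bscale s f"] by (auto simp: s f_def)
    then have "v = bscale k g + bscale s f"
      by (simp add: algebra_simps)
    then show "v \<in> {bscale a g + bscale b f |a b. True}"
      by blast
  next
    fix v assume "v \<in> {bscale a g + bscale b f |a b. True}"
    then show "v \<in> \<Lambda>"
      using gm fm sub by (auto intro!: bvec.subspace_add bvec.subspace_scale)
  qed
  have g0: "g \<noteq> 0"
  proof
    assume "g = 0"
    then have "fst g $ 1 = 0" "snd g $ 1 = 0"
      by simp_all
    then show False
      using \<xi> by (simp add: g_def)
  qed
  have "bvec.dim \<Lambda> = 2"
    unfolding eq
  proof (rule bvec.dim_pair)
    fix a b assume ab: "bscale a g + bscale b f = 0"
    then have "fst (bscale a g + bscale b f) $ 2 = 0" "snd (bscale a g + bscale b f) $ 2 = 0"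
      by simp_all
    then have "b * \<xi>0 = 0" "b * \<xi>1 = 0"
      by (simp_all add: f_def g_def)
    then have "b = 0"
      using \<xi> by auto
    then show "a = 0 \<and> b = 0"
      using ab g0 by simp
  qed
  moreover have "Omega v w = 0" if v: "v \<in> \<Lambda>" and w: "w \<in> \<Lambda>" for v w
  proof -
    obtain s where s: "fst v $ 2 = s * \<xi>0" "snd v $ 2 = s * \<xi>1"
      "- fst v $ 1 * cnj \<xi>0 + snd v $ 1 * cnj \<xi>1 = of_real h * s"
      using memE[OF v] by blast
    obtain s' where s': "fst w $ 2 = s' * \<xi>0" "snd w $ 2 = s' * \<xi>1"
      "- fst w $ 1 * cnj \<xi>0 + snd w $ 1 * cnj \<xi>1 = of_real h * s'"
      using memE[OF w] by blast
    have "Omega v w = cnj s' * (- fst v $ 1 * cnj \<xi>0 + snd v $ 1 * cnj \<xi>1)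
        - s * cnj (- fst w $ 1 * cnj \<xi>0 + snd w $ 1 * cnj \<xi>1)"
      unfolding Omega_eq s(1,2) s'(1,2) by (simp add: algebra_simps)
    then show ?thesis
      unfolding s(3) s'(3) by simp
  qed
  moreover have "\<Lambda> \<inter> Lambda_D = range (\<lambda>a. bscale a g)"
  proof (intro equalityI subsetI)
    fix v assume "v \<in> range (\<lambda>a. bscale a g)"
    then show "v \<in> \<Lambda> \<inter> Lambda_D"
      using gm sub by (auto simp: Lambda_D_iff g_def intro: bvec.subspace_scale)
  next
    fix v assume "v \<in> \<Lambda> \<inter> Lambda_D"
    then show "v \<in> range (\<lambda>a. bscale a g)"
      using multiple[of v] Lambda_D_iff[of v] by blast
  qed
  ultimately show "\<Lambda> \<in> layer 1"
    using sub by (simp add: layer_def Lag_def bvec.dim_line[OF g0])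
qed

text \<open>The Y parts of a two-dimensional intersection fill the whole plane, so isotropy forces X
  = 0 on all of \<Lambda>.\<close>

lemma layer2_eq: "layer 2 = {Lambda_D}"
proof -
  define e1 :: bvals where "e1 = (vector [1, 0], vector [0, 0])"
  define e2 :: bvals where "e2 = (vector [0, 0], vector [1, 0])"
  have mem: "e1 \<in> Lambda_D" "e2 \<in> Lambda_D"
    by (simp_all add: Lambda_D_iff e1_def e2_def)
  have eq: "Lambda_D = {bscale a e1 + bscale b e2 |a b. True}"
  proof (intro equalityI subsetI)
    fix v assume "v \<in> Lambda_D"
    then have "v = bscale (fst v $ 1) e1 + bscale (snd v $ 1) e2"
      by (intro bvals_eqI) (simp_all add: Lambda_D_iff e1_def e2_def)
    then show "v \<in> {bscale a e1 + bscale b e2 |a b. True}"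
      by blast
  qed (auto simp: Lambda_D_iff e1_def e2_def)
  have "bvec.dim Lambda_D = 2"
    unfolding eq
  proof (rule bvec.dim_pair)
    fix a b assume "bscale a e1 + bscale b e2 = 0"
    then have "fst (bscale a e1 + bscale b e2) $ 1 = 0" "snd (bscale a e1 + bscale b e2) $ 1 = 0"
      by simp_all
    then show "a = 0 \<and> b = 0"
      by (simp add: e1_def e2_def)
  qed
  then have "Lambda_D \<in> layer 2"
    using subspace_Lambda_D by (simp add: layer_def Lag_def Omega_eq Lambda_D_iff)
  moreover have "\<Lambda> = Lambda_D" if L: "\<Lambda> \<in> layer 2" for \<Lambda>
  proof -
    from L have Lag: "\<Lambda> \<in> Lag" and d2: "bvec.dim (\<Lambda> \<inter> Lambda_D) = 2"
      by (auto simp: layer_def)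
    note sub = LagD(1)[OF Lag]
    obtain e f where ef: "\<Lambda> \<inter> Lambda_D = {bscale a e + bscale b f |a b. True}"
      "\<forall>a b. bscale a e + bscale b f = 0 \<longrightarrow> a = 0 \<and> b = 0"
      using bvec.dim_eq_2D[OF bvec.subspace_inter[OF sub subspace_Lambda_D] d2] by blast
    have "bscale a e + bscale b f \<in> \<Lambda> \<inter> Lambda_D" for a b
      unfolding ef(1) by blast
    from this[of 1 0] this[of 0 1] have efm: "e \<in> \<Lambda>" "f \<in> \<Lambda>" "fst e $ 2 = 0" "snd e $ 2 = 0" "fst f $ 2 = 0" "snd f $ 2 = 0"
      by (auto simp: Lambda_D_iff)
    have D: "fst e $ 1 * snd f $ 1 - snd e $ 1 * fst f $ 1 \<noteq> 0"
      by (rule pair_relation_zero[of e f "\<lambda>v. fst v $ 1" "\<lambda>v. snd v $ 1"])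
        (use ef efm in \<open>auto intro!: bvals_eqI\<close>)
    have X0: "fst v $ 2 = 0 \<and> snd v $ 2 = 0" if v: "v \<in> \<Lambda>" for v
    proof -
      have "fst v $ 2 * cnj (- fst e $ 1) + snd v $ 2 * cnj (snd e $ 1) = 0"
        "fst v $ 2 * cnj (- fst f $ 1) + snd v $ 2 * cnj (snd f $ 1) = 0"
        using LagD(3)[OF Lag v efm(1)] LagD(3)[OF Lag v efm(2)] by (simp_all add: Omega_eq efm)
      moreover have "fst v $ 2 * cnj (fst e $ 1 * snd f $ 1 - snd e $ 1 * fst f $ 1)
          = (fst v $ 2 * cnj (- fst f $ 1) + snd v $ 2 * cnj (snd f $ 1)) * cnj (snd e $ 1)
            - (fst v $ 2 * cnj (- fst e $ 1) + snd v $ 2 * cnj (snd e $ 1)) * cnj (snd f $ 1)"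
        "snd v $ 2 * cnj (fst e $ 1 * snd f $ 1 - snd e $ 1 * fst f $ 1)
          = (fst v $ 2 * cnj (- fst f $ 1) + snd v $ 2 * cnj (snd f $ 1)) * cnj (fst e $ 1)
            - (fst v $ 2 * cnj (- fst e $ 1) + snd v $ 2 * cnj (snd e $ 1)) * cnj (fst f $ 1)"
        by (simp_all add: algebra_simps)
      ultimately have "fst v $ 2 * cnj (fst e $ 1 * snd f $ 1 - snd e $ 1 * fst f $ 1) = 0"
        "snd v $ 2 * cnj (fst e $ 1 * snd f $ 1 - snd e $ 1 * fst f $ 1) = 0"
        by (simp_all only: mult_zero_left diff_self)
      then show ?thesis
        using D by (metis complex_cnj_zero_iff mult_eq_0_iff)
    qed
    then have "\<Lambda> \<subseteq> Lambda_D"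
      by (auto simp: Lambda_D_iff)
    moreover have "v \<in> \<Lambda>" if v: "v \<in> Lambda_D" for v
    proof -
      define d where "d = fst e $ 1 * snd f $ 1 - snd e $ 1 * fst f $ 1"
      define a where "a = (fst v $ 1 * snd f $ 1 - snd v $ 1 * fst f $ 1) / d"
      define b where "b = (fst e $ 1 * snd v $ 1 - snd e $ 1 * fst v $ 1) / d"
      have d0: "d \<noteq> 0"
        using D by (simp add: d_def)
      have "a * fst e $ 1 + b * fst f $ 1 = fst v $ 1 * d / d" "a * snd e $ 1 + b * snd f $ 1 = snd v $ 1 * d / d"
        unfolding a_def b_def times_divide_eq_left add_divide_distrib[symmetric]
        by (rule arg_cong[of _ _ "\<lambda>w. w / d"], simp add: d_def algebra_simps)+
      then have "v = bscale a e + bscale b f"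
        using v efm d0 by (intro bvals_eqI) (simp_all add: Lambda_D_iff)
      also have "\<dots> \<in> \<Lambda>"
        using efm sub by (intro bvec.subspace_add bvec.subspace_scale)
      finally show ?thesis .
    qed
    ultimately show ?thesis
      by blast
  qed
  ultimately show ?thesis
    by blast
qed

section \<open>Solutions and eigenspaces\<close>

locale sturm_liouville =
  fixes T :: real and P Q R :: "real \<Rightarrow> real"
  assumes T: "T > 0" and P: "H1 T P" and Q: "H1 T Q" and R: "continuous_on {0..T} R"
    and P_pos: "\<And>t. t \<in> {0..T} \<Longrightarrow> P t > 0"
begin

lemma cont_coeffs: "continuous_on {0..T} P" "continuous_on {0..T} Q" "continuous_on {0..T} (\<lambda>t. 1 / P t)"
proof -
  show P': "continuous_on {0..T} P" and "continuous_on {0..T} Q"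
    using P Q by (auto intro: H1_continuous)
  have "P t \<noteq> 0" if "t \<in> {0..T}" for t
    using P_pos[OF that] by simp
  then show "continuous_on {0..T} (\<lambda>t. 1 / P t)"
    by (intro continuous_on_divide P' continuous_on_const) auto
qed

text \<open>The derivative of x, recovered from y = P x' + Q x. In the variables (y, x) the equation
  is a first-order system with continuous coefficients built from 1 / P, Q and R, free of
  derivatives of P and Q. The type is polymorphic because fundamental solutions are real and
  eigenfunctions complex.\<close>

definition vel :: "(real \<Rightarrow> 'a::real_normed_field) \<Rightarrow> (real \<Rightarrow> 'a) \<Rightarrow> real \<Rightarrow> 'a" where
  "vel y x t = of_real (1 / P t) * (y t - of_real (Q t) * x t)"

definition sol :: "'a::real_normed_field \<Rightarrow> (real \<Rightarrow> 'a) \<Rightarrow> (real \<Rightarrow> 'a) \<Rightarrow> bool" where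
  "sol \<mu> y x \<longleftrightarrow> (\<forall>t\<in>{0..T}.
     (y has_vector_derivative of_real (Q t) * vel y x t + (of_real (R t) - \<mu>) * x t) (at t within {0..T}) \<and>
     (x has_vector_derivative vel y x t) (at t within {0..T}))"

lemma solD:
  assumes "sol \<mu> y x" "t \<in> {0..T}"
  shows "(y has_vector_derivative of_real (Q t) * vel y x t + (of_real (R t) - \<mu>) * x t) (at t within {0..T})"
    and "(x has_vector_derivative vel y x t) (at t within {0..T})"
  using assms by (auto simp: sol_def)

lemma sol_continuous:
  assumes "sol \<mu> y x"
  shows "continuous_on {0..T} y" "continuous_on {0..T} x" "continuous_on {0..T} (vel y x)"
proof -
  show yx: "continuous_on {0..T} y" "continuous_on {0..T} x"
    using solD[OF assms] has_vector_derivative_continuous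
    by (fastforce simp: continuous_on_eq_continuous_within)+
  show "continuous_on {0..T} (vel y x)"
    unfolding vel_def by (intro continuous_intros yx cont_coeffs)
qed

text \<open>The contributions of Q and R are symmetric in the two solutions and cancel; only the
  difference of the parameters survives.\<close>

lemma lagrange_identity:
  fixes \<mu>1 \<mu>2 :: "'a::real_normed_field"
  assumes 1: "sol \<mu>1 y1 x1" and 2: "sol \<mu>2 y2 x2" and t: "t \<in> {0..T}"
  shows "((\<lambda>t. y1 t * x2 t - x1 t * y2 t) has_vector_derivative (\<mu>2 - \<mu>1) * (x1 t * x2 t)) (at t within {0..T})"
proof -
  let ?q = "of_real (Q t) :: 'a" and ?r = "of_real (R t) :: 'a"
  have "((\<lambda>t. y1 t * x2 t - x1 t * y2 t) has_vector_derivative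
      (y1 t * vel y2 x2 t + (?q * vel y1 x1 t + (?r - \<mu>1) * x1 t) * x2 t) -
      (x1 t * (?q * vel y2 x2 t + (?r - \<mu>2) * x2 t) + vel y1 x1 t * y2 t)) (at t within {0..T})"
    by (intro has_vector_derivative_diff has_vector_derivative_mult solD[OF 1 t] solD[OF 2 t])
  moreover have "(y1 t * vel y2 x2 t + (?q * vel y1 x1 t + (?r - \<mu>1) * x1 t) * x2 t) -
      (x1 t * (?q * vel y2 x2 t + (?r - \<mu>2) * x2 t) + vel y1 x1 t * y2 t) = (\<mu>2 - \<mu>1) * (x1 t * x2 t)"
    by (simp add: vel_def algebra_simps)
  ultimately show ?thesis
    by simp
qed

lemma lagrange_integral:
  fixes \<mu>1 \<mu>2 :: "'a::{real_normed_field,banach}"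
  assumes "sol \<mu>1 y1 x1" "sol \<mu>2 y2 x2" "t \<in> {0..T}"
  shows "((\<lambda>s. (\<mu>2 - \<mu>1) * (x1 s * x2 s)) has_integral
      ((y1 t * x2 t - x1 t * y2 t) - (y1 0 * x2 0 - x1 0 * y2 0))) {0..t}"
  by (rule fundamental_theorem_of_calculus)
    (use assms in \<open>auto intro!: has_vector_derivative_within_subset[OF lagrange_identity]\<close>)

lemma wronskian_constant:
  fixes \<mu> :: "'a::{real_normed_field,banach}"
  assumes "sol \<mu> y1 x1" "sol \<mu> y2 x2" "t \<in> {0..T}"
  shows "y1 t * x2 t - x1 t * y2 t = y1 0 * x2 0 - x1 0 * y2 0"
  using has_integral_unique[OF lagrange_integral[OF assms] has_integral_eq[OF _ has_integral_0]] by simp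

lemma sol_combination:
  assumes 1: "sol \<mu> y1 x1" and 2: "sol \<mu> y2 x2"
  shows "sol \<mu> (\<lambda>t. a * y1 t + b * y2 t) (\<lambda>t. a * x1 t + b * x2 t)"
  unfolding sol_def
proof (intro ballI conjI)
  fix t assume t: "t \<in> {0..T}"
  have v: "vel (\<lambda>t. a * y1 t + b * y2 t) (\<lambda>t. a * x1 t + b * x2 t) t = a * vel y1 x1 t + b * vel y2 x2 t"
    by (simp add: vel_def algebra_simps)
  have mult: "((\<lambda>t. k * f t) has_vector_derivative k * f') F"
    if "(f has_vector_derivative f') F" for k :: 'a and f f' F
    using has_vector_derivative_mult_right[OF that] .
  show "((\<lambda>t. a * x1 t + b * x2 t) has_vector_derivative
      vel (\<lambda>t. a * y1 t + b * y2 t) (\<lambda>t. a * x1 t + b * x2 t) t) (at t within {0..T})"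
    unfolding v by (intro has_vector_derivative_add mult solD[OF 1 t] solD[OF 2 t])
  have "((\<lambda>t. a * y1 t + b * y2 t) has_vector_derivative
      a * (of_real (Q t) * vel y1 x1 t + (of_real (R t) - \<mu>) * x1 t)
      + b * (of_real (Q t) * vel y2 x2 t + (of_real (R t) - \<mu>) * x2 t)) (at t within {0..T})"
    by (intro has_vector_derivative_add mult solD[OF 1 t] solD[OF 2 t])
  moreover have "a * (of_real (Q t) * vel y1 x1 t + (of_real (R t) - \<mu>) * x1 t)
      + b * (of_real (Q t) * vel y2 x2 t + (of_real (R t) - \<mu>) * x2 t)
      = of_real (Q t) * (a * vel y1 x1 t + b * vel y2 x2 t) + (of_real (R t) - \<mu>) * (a * x1 t + b * x2 t)"
    by (simp add: algebra_simps)
  ultimately show "((\<lambda>t. a * y1 t + b * y2 t) has_vector_derivative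
      of_real (Q t) * vel (\<lambda>t. a * y1 t + b * y2 t) (\<lambda>t. a * x1 t + b * x2 t) t
      + (of_real (R t) - \<mu>) * (a * x1 t + b * x2 t)) (at t within {0..T})"
    unfolding v by simp
qed

lemma sol_DERIV:
  fixes \<mu> :: real
  assumes "sol \<mu> y x" "t \<in> {0..T}"
  shows "(y has_real_derivative Q t * vel y x t + (R t - \<mu>) * x t) (at t within {0..T})"
    and "(x has_real_derivative vel y x t) (at t within {0..T})"
  using solD[OF assms] by (simp_all add: has_real_derivative_iff_has_vector_derivative)

lemma sol_of_real:
  fixes \<mu> :: real
  assumes "sol \<mu> y x"
  shows "sol (of_real \<mu> :: complex) (\<lambda>t. of_real (y t)) (\<lambda>t. of_real (x t))"
  unfolding sol_def
proof (intro ballI conjI)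
  fix t assume t: "t \<in> {0..T}"
  have v: "vel (\<lambda>t. of_real (y t) :: complex) (\<lambda>t. of_real (x t)) t = of_real (vel y x t)"
    by (simp add: vel_def)
  show "((\<lambda>t. of_real (x t) :: complex) has_vector_derivative vel (\<lambda>t. of_real (y t)) (\<lambda>t. of_real (x t)) t) (at t within {0..T})"
    unfolding v by (intro has_vector_derivative_of_real sol_DERIV(2)[OF assms t])
  show "((\<lambda>t. of_real (y t) :: complex) has_vector_derivative
      of_real (Q t) * vel (\<lambda>t. of_real (y t)) (\<lambda>t. of_real (x t)) t + (of_real (R t) - of_real \<mu>) * of_real (x t)) (at t within {0..T})"
    unfolding v using has_vector_derivative_of_real[OF sol_DERIV(1)[OF assms t], where 'a = complex]
    by (simp only: of_real_add of_real_mult of_real_diff)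
qed

lemma sol_cnj:
  assumes "sol \<mu> y x"
  shows "sol (cnj \<mu>) (\<lambda>t. cnj (y t)) (\<lambda>t. cnj (x t))"
  unfolding sol_def
proof (intro ballI conjI)
  fix t assume t: "t \<in> {0..T}"
  have v: "vel (\<lambda>t. cnj (y t)) (\<lambda>t. cnj (x t)) t = cnj (vel y x t)"
    by (simp add: vel_def)
  show "((\<lambda>t. cnj (x t)) has_vector_derivative vel (\<lambda>t. cnj (y t)) (\<lambda>t. cnj (x t)) t) (at t within {0..T})"
    unfolding v by (intro has_vector_derivative_cnj solD[OF assms t])
  show "((\<lambda>t. cnj (y t)) has_vector_derivative
      of_real (Q t) * vel (\<lambda>t. cnj (y t)) (\<lambda>t. cnj (x t)) t + (of_real (R t) - cnj \<mu>) * cnj (x t)) (at t within {0..T})"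
    unfolding v using has_vector_derivative_cnj[OF solD(1)[OF assms t]] by simp
qed

section \<open>Fundamental solutions and the monodromy matrix\<close>

definition sol_family :: "real \<Rightarrow> real \<Rightarrow> (real \<Rightarrow> real \<Rightarrow> real) \<Rightarrow> (real \<Rightarrow> real \<Rightarrow> real) \<Rightarrow> bool" where
  "sol_family a b y x \<longleftrightarrow> (\<forall>\<mu>. y \<mu> 0 = a \<and> x \<mu> 0 = b \<and> sol \<mu> (y \<mu>) (x \<mu>)) \<and>
     continuous_on (UNIV \<times> {0..T}) (\<lambda>(\<mu>, t). y \<mu> t) \<and> continuous_on (UNIV \<times> {0..T}) (\<lambda>(\<mu>, t). x \<mu> t)"

lemma sol_family_exists: "\<exists>y x. sol_family a b y x"
proof -
  define F where "F \<mu> t z = (Q t * (1 / P t * (fst z - Q t * snd z)) + (R t - \<mu>) * snd z,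
      1 / P t * (fst z - Q t * snd z))" for \<mu> t and z :: "real \<times> real"
  have T0: "T \<ge> 0"
    using T by simp
  have cont: "continuous_on (UNIV \<times> {0..T} \<times> UNIV) (\<lambda>(\<mu>, t, z). F \<mu> t z)"
  proof -
    have c: "continuous_on (UNIV \<times> {0..T} \<times> UNIV) (\<lambda>q :: real \<times> real \<times> real \<times> real. u (fst (snd q)))"
      if "continuous_on {0..T} u" for u :: "real \<Rightarrow> real"
      by (rule continuous_on_compose2[OF that]) (auto intro!: continuous_intros)
    show ?thesis
      unfolding F_def case_prod_unfold
      by (intro continuous_intros c[OF cont_coeffs(3)] c[OF cont_coeffs(2)] c[OF R])
  qed
  have lip: "\<exists>K\<ge>0. \<forall>\<mu> t z w. \<bar>\<mu>\<bar> \<le> L \<longrightarrow> t \<in> {0..T} \<longrightarrow> norm (F \<mu> t z - F \<mu> t w) \<le> K * norm (z - w)" for L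
  proof -
    obtain BQ where BQ: "BQ > 0" "\<And>t. t \<in> {0..T} \<Longrightarrow> \<bar>Q t\<bar> \<le> BQ"
      using continuous_on_Icc_bound[OF cont_coeffs(2)] by blast
    obtain BP where BP: "BP > 0" "\<And>t. t \<in> {0..T} \<Longrightarrow> \<bar>1 / P t\<bar> \<le> BP"
      using continuous_on_Icc_bound[OF cont_coeffs(3)] by blast
    obtain BR where BR: "BR > 0" "\<And>t. t \<in> {0..T} \<Longrightarrow> \<bar>R t\<bar> \<le> BR"
      using continuous_on_Icc_bound[OF R] by blast
    define K where "K = BQ * (BP * (1 + BQ)) + (BR + \<bar>L\<bar>) + BP * (1 + BQ)"
    have "norm (F \<mu> t z - F \<mu> t w) \<le> K * norm (z - w)" if "\<bar>\<mu>\<bar> \<le> L" and t: "t \<in> {0..T}" for \<mu> t z w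
    proof -
      define d where "d = z - w"
      have d: "\<bar>fst d\<bar> \<le> norm d" "\<bar>snd d\<bar> \<le> norm d"
        using norm_fst_le[of "fst d" "snd d"] norm_snd_le[of "snd d" "fst d"] by simp_all
      have "\<bar>fst d - Q t * snd d\<bar> \<le> \<bar>fst d\<bar> + \<bar>Q t\<bar> * \<bar>snd d\<bar>"
        using abs_triangle_ineq4[of "fst d" "Q t * snd d"] by (simp add: abs_mult)
      also have "\<dots> \<le> norm d + BQ * norm d"
        using d BQ t by (intro add_mono mult_mono) auto
      finally have "\<bar>fst d - Q t * snd d\<bar> \<le> (1 + BQ) * norm d"
        by (simp add: algebra_simps)
      then have v: "\<bar>1 / P t * (fst d - Q t * snd d)\<bar> \<le> BP * ((1 + BQ) * norm d)"
        unfolding abs_mult using BP t by (intro mult_mono) auto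
      then have qv: "\<bar>Q t * (1 / P t * (fst d - Q t * snd d))\<bar> \<le> BQ * (BP * ((1 + BQ) * norm d))"
        unfolding abs_mult[of "Q t"] using BQ t by (intro mult_mono) auto
      have "\<bar>R t - \<mu>\<bar> \<le> BR + \<bar>L\<bar>"
        using BR(2)[OF t] that by linarith
      then have r: "\<bar>(R t - \<mu>) * snd d\<bar> \<le> (BR + \<bar>L\<bar>) * norm d"
        unfolding abs_mult using d BR by (intro mult_mono) auto
      have "F \<mu> t z - F \<mu> t w = (Q t * (1 / P t * (fst d - Q t * snd d)) + (R t - \<mu>) * snd d,
          1 / P t * (fst d - Q t * snd d))"
        by (simp add: F_def d_def minus_prod_def algebra_simps)
      also have "norm \<dots> \<le> \<bar>Q t * (1 / P t * (fst d - Q t * snd d)) + (R t - \<mu>) * snd d\<bar>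
          + \<bar>1 / P t * (fst d - Q t * snd d)\<bar>"
        by (rule norm_Pair_le[THEN order_trans]) simp
      also have "\<dots> \<le> K * norm d"
        using v qv r unfolding K_def by (simp only: distrib_right mult.assoc)
      finally show ?thesis
        by (simp add: d_def)
    qed
    moreover have "K \<ge> 0"
      using BQ BP BR by (simp add: K_def)
    ultimately show ?thesis
      by blast
  qed
  obtain z where z: "\<And>\<mu>. z \<mu> 0 = (a, b)"
    "\<And>\<mu> t. t \<in> {0..T} \<Longrightarrow> (z \<mu> has_vector_derivative F \<mu> t (z \<mu> t)) (at t within {0..T})"
    "continuous_on (UNIV \<times> {0..T}) (\<lambda>(\<mu>, t). z \<mu> t)"
    using ode_param_exists[OF T0 cont lip, where \<zeta> = "(a, b)"] by blast
  have "sol_family a b (\<lambda>\<mu> t. fst (z \<mu> t)) (\<lambda>\<mu> t. snd (z \<mu> t))"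
    unfolding sol_family_def
  proof (intro conjI allI)
    show "fst (z \<mu> 0) = a" "snd (z \<mu> 0) = b" for \<mu>
      using z(1) by simp_all
    have "((\<lambda>t. fst (z \<mu> t)) has_vector_derivative fst (F \<mu> t (z \<mu> t))) (at t within {0..T}) \<and>
      ((\<lambda>t. snd (z \<mu> t)) has_vector_derivative snd (F \<mu> t (z \<mu> t))) (at t within {0..T})"
      if "t \<in> {0..T}" for \<mu> t
      using z(2)[OF that] bounded_linear.has_vector_derivative bounded_linear_fst bounded_linear_snd
      by blast
    then show "sol \<mu> (\<lambda>t. fst (z \<mu> t)) (\<lambda>t. snd (z \<mu> t))" for \<mu>
      unfolding sol_def F_def vel_def by simp
    have c: "continuous_on (UNIV \<times> {0..T}) (\<lambda>q. z (fst q) (snd q))"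
      using z(3) by (simp add: case_prod_unfold)
    show "continuous_on (UNIV \<times> {0..T}) (\<lambda>(\<mu>, t). fst (z \<mu> t))"
      "continuous_on (UNIV \<times> {0..T}) (\<lambda>(\<mu>, t). snd (z \<mu> t))"
      unfolding case_prod_unfold by (intro continuous_intros c)+
  qed
  then show ?thesis
    by blast
qed

text \<open>Initial values come in the order (y, x). Thus \<open>fund 1 0\<close> is the solution
  that vanishes at 0, and \<open>m21\<close> is its value at T.\<close>

definition fund :: "real \<Rightarrow> real \<Rightarrow> (real \<Rightarrow> real \<Rightarrow> real) \<times> (real \<Rightarrow> real \<Rightarrow> real)" where
  "fund a b = (SOME p. sol_family a b (fst p) (snd p))"

abbreviation "Y1 \<equiv> fst (fund 1 0)"
abbreviation "X1 \<equiv> snd (fund 1 0)"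
abbreviation "Y2 \<equiv> fst (fund 0 1)"
abbreviation "X2 \<equiv> snd (fund 0 1)"

lemma fund_family: "sol_family a b (fst (fund a b)) (snd (fund a b))"
proof -
  have "\<exists>p. sol_family a b (fst p) (snd p)"
    using sol_family_exists[of a b] by auto
  then show ?thesis
    unfolding fund_def by (rule someI_ex)
qed

lemma fund_sol: "sol \<mu> (fst (fund a b) \<mu>) (snd (fund a b) \<mu>)"
  and fund_init [simp]: "fst (fund a b) \<mu> 0 = a" "snd (fund a b) \<mu> 0 = b"
  and fund_cont: "continuous_on (UNIV \<times> {0..T}) (\<lambda>(\<mu>, t). fst (fund a b) \<mu> t)"
    "continuous_on (UNIV \<times> {0..T}) (\<lambda>(\<mu>, t). snd (fund a b) \<mu> t)"
  using fund_family[of a b] by (auto simp: sol_family_def)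

definition m11 :: "real \<Rightarrow> real" where "m11 \<mu> = Y1 \<mu> T"
definition m12 :: "real \<Rightarrow> real" where "m12 \<mu> = Y2 \<mu> T"
definition m21 :: "real \<Rightarrow> real" where "m21 \<mu> = X1 \<mu> T"
definition m22 :: "real \<Rightarrow> real" where "m22 \<mu> = X2 \<mu> T"

lemma T_mem: "T \<in> {0..T}" "0 \<in> {0..T}"
  using T by simp_all

lemma m_cont: "continuous_on U m11" "continuous_on U m12" "continuous_on U m21" "continuous_on U m22"
proof -
  have "continuous_on U (\<lambda>\<mu>. f \<mu> T)" if "continuous_on (UNIV \<times> {0..T}) (\<lambda>(\<mu>, t). f \<mu> t)" for f :: "real \<Rightarrow> real \<Rightarrow> real"
  proof -
    have "continuous_on U (\<lambda>\<mu>. (\<lambda>(\<mu>, t). f \<mu> t) (\<mu>, T))"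
      by (rule continuous_on_compose2[OF that]) (use T in \<open>auto intro!: continuous_intros\<close>)
    then show ?thesis by simp
  qed
  from this[OF fund_cont(1)] this[OF fund_cont(2)] show
    "continuous_on U m11" "continuous_on U m12" "continuous_on U m21" "continuous_on U m22"
    unfolding m11_def m12_def m21_def m22_def by auto
qed

lemma fund_wronskian: "t \<in> {0..T} \<Longrightarrow> Y1 \<mu> t * X2 \<mu> t - X1 \<mu> t * Y2 \<mu> t = 1"
  using wronskian_constant[OF fund_sol fund_sol] by simp

lemma det_m: "m11 \<mu> * m22 \<mu> - m21 \<mu> * m12 \<mu> = 1"
  using fund_wronskian[OF T_mem(1)] by (simp add: m11_def m12_def m21_def m22_def)

lemma det_m_complex: "of_real (m11 \<mu>) * of_real (m22 \<mu>) = (1 :: complex) + of_real (m21 \<mu>) * of_real (m12 \<mu>)"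
proof -
  have "m11 \<mu> * m22 \<mu> = 1 + m21 \<mu> * m12 \<mu>"
    using det_m[of \<mu>] by simp
  from arg_cong[OF this, of of_real] show ?thesis
    by (simp only: of_real_mult of_real_add of_real_1)
qed

text \<open>The Wronskians of a solution with the two fundamental ones are constant, equal to its
  initial data, and can be solved for y and x because the fundamental Wronskian is 1. This serves as
  the uniqueness theorem for the system.\<close>

lemma sol_representation:
  assumes s: "sol (of_real \<mu> :: complex) y x" and t: "t \<in> {0..T}"
  shows "y t = y 0 * of_real (Y1 \<mu> t) + x 0 * of_real (Y2 \<mu> t)"
    and "x t = y 0 * of_real (X1 \<mu> t) + x 0 * of_real (X2 \<mu> t)"
proof -
  note f = sol_of_real[OF fund_sol]
  have 1: "y t * of_real (X2 \<mu> t) - x t * of_real (Y2 \<mu> t) = y 0"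
    using wronskian_constant[OF s f[of \<mu> 0 1] t] by simp
  have 2: "of_real (Y1 \<mu> t) * x t - of_real (X1 \<mu> t) * y t = x 0"
    using wronskian_constant[OF f[of \<mu> 1 0] s t] by simp
  have 3: "of_real (Y1 \<mu> t) * of_real (X2 \<mu> t) - of_real (X1 \<mu> t) * of_real (Y2 \<mu> t) = (1 :: complex)"
    using arg_cong[OF fund_wronskian[OF t, of \<mu>], of of_real]
    by (simp only: of_real_diff of_real_mult of_real_1)
  have "y t * 1 = (y t * of_real (X2 \<mu> t) - x t * of_real (Y2 \<mu> t)) * of_real (Y1 \<mu> t)
      + (of_real (Y1 \<mu> t) * x t - of_real (X1 \<mu> t) * y t) * of_real (Y2 \<mu> t)"
    unfolding 3[symmetric] by (simp add: algebra_simps)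
  then show "y t = y 0 * of_real (Y1 \<mu> t) + x 0 * of_real (Y2 \<mu> t)"
    unfolding 1 2 by simp
  have "x t * 1 = (y t * of_real (X2 \<mu> t) - x t * of_real (Y2 \<mu> t)) * of_real (X1 \<mu> t)
      + (of_real (Y1 \<mu> t) * x t - of_real (X1 \<mu> t) * y t) * of_real (X2 \<mu> t)"
    unfolding 3[symmetric] by (simp add: algebra_simps)
  then show "x t = y 0 * of_real (X1 \<mu> t) + x 0 * of_real (X2 \<mu> t)"
    unfolding 1 2 by simp
qed

text \<open>An eigenfunction is a classical solution: its derivative g is continuous as an H1
  function, the equation identifies the weak derivative of the quasi-derivative almost everywhere
  with the continuous k, and a primitive of a continuous function is differentiable
  everywhere.\<close>

lemma eigenspace_sol:
  assumes x: "x \<in> eigenspace T P Q R \<Lambda> \<mu>"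
  shows "sol \<mu> (quasi_deriv T P Q x) x"
proof -
  let ?y = "quasi_deriv T P Q x"
  obtain g where g: "has_weak_deriv T x g" "H1 T g"
    using x by (auto simp: eigenspace_def SL_dom_def H2_def)
  obtain h where h: "has_weak_deriv T ?y h"
    "AE t in lebesgue_on {0..T}. - h t + of_real (Q t) * dot T x t + of_real (R t) * x t = \<mu> * x t"
    using x by (auto simp: eigenspace_def SL_maps_def)
  have cg: "continuous_on {0..T} g"
    using g(2) by (rule H1_continuous)
  have cx: "continuous_on {0..T} x"
    using g(1) by (rule has_weak_deriv_continuous)
  have prim: "(f has_vector_derivative k t) (at t within {0..T})"
    if k: "continuous_on {0..T} k" and f: "\<And>s. s \<in> {0..T} \<Longrightarrow> (k has_integral (f s - f 0)) {0..s}"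
      and t: "t \<in> {0..T}" for f k :: "real \<Rightarrow> complex" and t
  proof (rule has_vector_derivative_transform[OF t])
    show "f s = f 0 + integral {0..s} k" if "s \<in> {0..T}" for s
      using integral_unique[OF f[OF that]] by simp
    show "((\<lambda>s. f 0 + integral {0..s} k) has_vector_derivative k t) (at t within {0..T})"
      using integral_has_vector_derivative[OF k t] by (auto intro!: derivative_eq_intros)
  qed
  have dx: "(x has_vector_derivative g t) (at t within {0..T})" if "t \<in> {0..T}" for t
    using g(1) that by (intro prim[OF cg]) (auto simp: has_weak_deriv_def)
  then have dot: "dot T x t = g t" if "t \<in> {0..T}" for t
    unfolding dot_def using T that by (intro vector_derivative_within_closed_interval) auto
  have v: "vel ?y x t = g t" if "t \<in> {0..T}" for t
    using P_pos[OF that] by (simp add: vel_def quasi_deriv_def dot[OF that])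
  define k where "k t = of_real (Q t) * g t + (of_real (R t) - \<mu>) * x t" for t
  have ck: "continuous_on {0..T} k"
    unfolding k_def by (intro continuous_intros cg cx cont_coeffs R)
  have "AE t in lebesgue. t \<in> {0..T} \<longrightarrow> h t = k t"
  proof -
    have "AE t in lebesgue. t \<in> {0..T} \<longrightarrow>
        - h t + of_real (Q t) * dot T x t + of_real (R t) * x t = \<mu> * x t"
      using h(2) by (simp add: AE_restrict_space_iff)
    then show ?thesis
    proof eventually_elim
      case (elim t)
      then show ?case
        using dot[of t] by (auto simp: k_def algebra_simps)
    qed
  qed
  then obtain N where N: "N \<in> null_sets lebesgue" "{t. \<not> (t \<in> {0..T} \<longrightarrow> h t = k t)} \<subseteq> N"
    by (auto simp: eventually_ae_filter)
  have "(k has_integral (?y t - ?y 0)) {0..t}" if "t \<in> {0..T}" for t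
  proof (rule has_integral_spike)
    show "negligible N"
      using N(1) by (simp add: negligible_iff_null_sets)
    show "k s = h s" if "s \<in> {0..t} - N" for s
      using N(2) that \<open>t \<in> {0..T}\<close> by force
    show "(h has_integral (?y t - ?y 0)) {0..t}"
      using h(1) that by (auto simp: has_weak_deriv_def)
  qed
  from prim[OF ck this] have "(?y has_vector_derivative k t) (at t within {0..T})" if "t \<in> {0..T}" for t
    using that by blast
  then show ?thesis
    unfolding sol_def using dx by (simp add: v k_def)
qed

text \<open>Zero outside [0, T] to match the representatives in \<open>SL_dom\<close>; \<alpha> and
  \<beta> are the values at 0 of the quasi-derivative and of the function.\<close>

definition efun :: "real \<Rightarrow> complex \<Rightarrow> complex \<Rightarrow> real \<Rightarrow> complex" where
  "efun \<mu> \<alpha> \<beta> t = (if t \<in> {0..T} then \<alpha> * of_real (X1 \<mu> t) + \<beta> * of_real (X2 \<mu> t) else 0)"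

definition bv :: "real \<Rightarrow> complex \<Rightarrow> complex \<Rightarrow> bvals" where
  "bv \<mu> \<alpha> \<beta> = (vector [\<alpha>, \<beta>],
     vector [of_real (m11 \<mu>) * \<alpha> + of_real (m12 \<mu>) * \<beta>, of_real (m21 \<mu>) * \<alpha> + of_real (m22 \<mu>) * \<beta>])"

lemma efun_quasi_deriv:
  assumes "t \<in> {0..T}"
  shows "dot T (efun \<mu> \<alpha> \<beta>) t = \<alpha> * of_real (vel (Y1 \<mu>) (X1 \<mu>) t) + \<beta> * of_real (vel (Y2 \<mu>) (X2 \<mu>) t)"
    and "quasi_deriv T P Q (efun \<mu> \<alpha> \<beta>) t = \<alpha> * of_real (Y1 \<mu> t) + \<beta> * of_real (Y2 \<mu> t)"
    and "(efun \<mu> \<alpha> \<beta> has_vector_derivative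
      \<alpha> * of_real (vel (Y1 \<mu>) (X1 \<mu>) t) + \<beta> * of_real (vel (Y2 \<mu>) (X2 \<mu>) t)) (at t within {0..T})"
proof -
  have "((\<lambda>t. \<alpha> * of_real (X1 \<mu> t) + \<beta> * of_real (X2 \<mu> t)) has_vector_derivative
      \<alpha> * of_real (vel (Y1 \<mu>) (X1 \<mu>) t) + \<beta> * of_real (vel (Y2 \<mu>) (X2 \<mu>) t)) (at t within {0..T})"
    by (intro has_vector_derivative_add has_vector_derivative_mult_right has_vector_derivative_of_real
        sol_DERIV(2)[OF fund_sol assms])
  then show d: "(efun \<mu> \<alpha> \<beta> has_vector_derivative
      \<alpha> * of_real (vel (Y1 \<mu>) (X1 \<mu>) t) + \<beta> * of_real (vel (Y2 \<mu>) (X2 \<mu>) t)) (at t within {0..T})"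
    by (rule has_vector_derivative_transform[OF assms, rotated]) (simp add: efun_def)
  then show dot: "dot T (efun \<mu> \<alpha> \<beta>) t = \<alpha> * of_real (vel (Y1 \<mu>) (X1 \<mu>) t) + \<beta> * of_real (vel (Y2 \<mu>) (X2 \<mu>) t)"
    unfolding dot_def using T assms by (intro vector_derivative_within_closed_interval) auto
  have "of_real (P t) \<noteq> (0 :: complex)"
    using P_pos[OF assms] by simp
  then show "quasi_deriv T P Q (efun \<mu> \<alpha> \<beta>) t = \<alpha> * of_real (Y1 \<mu> t) + \<beta> * of_real (Y2 \<mu> t)"
    unfolding quasi_deriv_def dot efun_def vel_def using assms by (simp add: field_simps)
qed

text \<open>The domain asks for H2, so the velocity (y - Q x) / P must lie in H1. Here P and Q enter
  as H1 functions and not merely as continuous ones.\<close>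

lemma efun_mem_eigenspace:
  assumes "bv \<mu> \<alpha> \<beta> \<in> \<Lambda>"
  shows "efun \<mu> \<alpha> \<beta> \<in> eigenspace T P Q R \<Lambda> (of_real \<mu>)"
proof -
  let ?x = "efun \<mu> \<alpha> \<beta>"
  let ?g = "\<lambda>t. \<alpha> * of_real (vel (Y1 \<mu>) (X1 \<mu>) t) + \<beta> * of_real (vel (Y2 \<mu>) (X2 \<mu>) t)"
  let ?y = "\<lambda>t. \<alpha> * of_real (Y1 \<mu> t) + \<beta> * of_real (Y2 \<mu> t)"
  let ?h = "\<lambda>t. \<alpha> * of_real (Q t * vel (Y1 \<mu>) (X1 \<mu>) t + (R t - \<mu>) * X1 \<mu> t)
      + \<beta> * of_real (Q t * vel (Y2 \<mu>) (X2 \<mu>) t + (R t - \<mu>) * X2 \<mu> t) :: complex"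
  have velH1: "H1 T (vel (fst (fund a b) \<mu>) (snd (fund a b) \<mu>))" for a b
  proof -
    have s: "sol \<mu> (fst (fund a b) \<mu>) (snd (fund a b) \<mu>)"
      by (rule fund_sol)
    have y: "H1 T (fst (fund a b) \<mu>)"
    proof -
      have "continuous_on {0..T} (\<lambda>t. Q t * vel (fst (fund a b) \<mu>) (snd (fund a b) \<mu>) t + (R t - \<mu>) * snd (fund a b) \<mu> t)"
        by (intro continuous_on_add continuous_on_mult continuous_on_diff continuous_on_const
            sol_continuous[OF s] cont_coeffs R)
      from C1_has_weak_deriv[OF _ this] show ?thesis
        unfolding H1_def using solD(1)[OF s] by auto
    qed
    have x: "H1 T (snd (fund a b) \<mu>)"
      unfolding H1_def using C1_has_weak_deriv[OF solD(2)[OF s] sol_continuous(3)[OF s]] by blast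
    have "H1 T (\<lambda>t. 1 / P t * (fst (fund a b) \<mu> t - Q t * snd (fund a b) \<mu> t))"
      by (intro H1_mult H1_diff H1_inverse y x P Q) (use P_pos in force)
    then show ?thesis
      unfolding vel_def[abs_def] by simp
  qed
  have "continuous_on {0..T} ?g"
    by (intro continuous_intros sol_continuous[OF fund_sol])
  then have "has_weak_deriv T ?x ?g"
    using efun_quasi_deriv(3) C1_has_weak_deriv[where f = ?x and f' = ?g] by blast
  moreover have "H1 T ?g"
    by (intro H1_complex_combination velH1)
  ultimately have "H2 T ?x"
    unfolding H2_def by blast
  moreover have "(zvec T P Q ?x 0, zvec T P Q ?x T) \<in> \<Lambda>"
    using assms efun_quasi_deriv(2)[OF T_mem(1)] efun_quasi_deriv(2)[OF T_mem(2)] T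
    by (simp add: zvec_def bv_def efun_def m11_def m12_def m21_def m22_def mult.commute)
  moreover have "SL_maps T P Q R ?x (\<lambda>t. of_real \<mu> * ?x t)"
    unfolding SL_maps_def
  proof (intro exI conjI)
    show "has_weak_deriv T (quasi_deriv T P Q ?x) ?h"
    proof (rule C1_has_weak_deriv)
      fix t assume t: "t \<in> {0..T}"
      have "(?y has_vector_derivative ?h t) (at t within {0..T})"
        by (intro has_vector_derivative_add has_vector_derivative_mult_right has_vector_derivative_of_real
            sol_DERIV(1)[OF fund_sol t])
      then show "(quasi_deriv T P Q ?x has_vector_derivative ?h t) (at t within {0..T})"
        by (rule has_vector_derivative_transform[OF t, rotated]) (simp add: efun_quasi_deriv(2))
    next
      show "continuous_on {0..T} ?h"
        by (intro continuous_intros sol_continuous[OF fund_sol] cont_coeffs R)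
    qed
    show "AE t in lebesgue_on {0..T}. - ?h t + of_real (Q t) * dot T ?x t + of_real (R t) * ?x t = of_real \<mu> * ?x t"
    proof (rule AE_I2)
      fix t assume "t \<in> space (lebesgue_on {0..T})"
      then have t: "t \<in> {0..T}"
        by (simp add: space_restrict_space)
      show "- ?h t + of_real (Q t) * dot T ?x t + of_real (R t) * ?x t = of_real \<mu> * ?x t"
        unfolding efun_quasi_deriv(1)[OF t] using t by (simp add: efun_def algebra_simps)
    qed
  qed
  ultimately show ?thesis
    by (auto simp: eigenspace_def SL_dom_def efun_def)
qed

lemma eigenspace_real:
  "eigenspace T P Q R \<Lambda> (of_real \<mu>) =
     {fscale \<alpha> (efun \<mu> 1 0) + fscale \<beta> (efun \<mu> 0 1) |\<alpha> \<beta>. (\<alpha>, \<beta>) \<in> {(\<alpha>, \<beta>). bv \<mu> \<alpha> \<beta> \<in> \<Lambda>}}"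
proof -
  have comb: "fscale \<alpha> (efun \<mu> 1 0) + fscale \<beta> (efun \<mu> 0 1) = efun \<mu> \<alpha> \<beta>" for \<alpha> \<beta>
    by (auto simp: fun_eq_iff fscale_def efun_def)
  have "\<exists>\<alpha> \<beta>. x = efun \<mu> \<alpha> \<beta> \<and> bv \<mu> \<alpha> \<beta> \<in> \<Lambda>" if x: "x \<in> eigenspace T P Q R \<Lambda> (of_real \<mu>)" for x
  proof -
    note s = eigenspace_sol[OF x]
    let ?y = "quasi_deriv T P Q x"
    have "x t = efun \<mu> (?y 0) (x 0) t" for t
    proof (cases "t \<in> {0..T}")
      case True
      then show ?thesis
        unfolding efun_def using sol_representation(2)[OF s True] by (simp only: if_True)
    next
      case False
      then have "x t = 0"
        using x unfolding eigenspace_def SL_dom_def by blast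
      then show ?thesis
        unfolding efun_def if_not_P[OF False] .
    qed
    moreover have "bv \<mu> (?y 0) (x 0) \<in> \<Lambda>"
    proof -
      have "(zvec T P Q x 0, zvec T P Q x T) \<in> \<Lambda>"
        using x by (simp add: eigenspace_def SL_dom_def)
      then show ?thesis
        unfolding zvec_def bv_def m11_def m12_def m21_def m22_def sol_representation[OF s T_mem(1)]
        by (simp only: mult.commute)
    qed
    ultimately show ?thesis
      by blast
  qed
  then show ?thesis
    unfolding comb using efun_mem_eigenspace by blast
qed

lemma efun_independent:
  assumes "fscale \<alpha> (efun \<mu> 1 0) + fscale \<beta> (efun \<mu> 0 1) = 0"
  shows "\<alpha> = 0 \<and> \<beta> = 0"
proof -
  have z: "\<alpha> * of_real (X1 \<mu> t) + \<beta> * of_real (X2 \<mu> t) = 0" if "t \<in> {0..T}" for t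
    using fun_cong[OF assms, of t] that by (auto simp: fscale_def efun_def)
  then have "efun \<mu> \<alpha> \<beta> = efun \<mu> 0 0"
    by (auto simp: efun_def fun_eq_iff)
  then have "quasi_deriv T P Q (efun \<mu> \<alpha> \<beta>) 0 = quasi_deriv T P Q (efun \<mu> 0 0) 0"
    by simp
  then have "\<alpha> = 0"
    unfolding efun_quasi_deriv(2)[OF T_mem(2)] by simp
  then show ?thesis
    using z[OF T_mem(2)] by simp
qed

section \<open>The Dirichlet-to-Neumann form\<close>

lemma param_integral_continuous:
  fixes h :: "real \<Rightarrow> real \<Rightarrow> real"
  assumes "continuous_on (U \<times> {0..T}) (\<lambda>(\<mu>, t). h \<mu> t)"
  shows "continuous_on U (\<lambda>\<mu>. integral {0..T} (h \<mu>))"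
  using integral_continuous_on_param[of U 0 T h] assms by (simp add: cbox_interval)

lemma continuous_on_snd_coeff:
  fixes u :: "real \<Rightarrow> real"
  assumes "continuous_on {0..T} u"
  shows "continuous_on (U \<times> {0..T}) (\<lambda>q. u (snd q))"
  by (rule continuous_on_compose2[OF assms]) (auto intro!: continuous_intros)

lemma fund_cont_snd:
  "continuous_on (U \<times> {0..T}) (\<lambda>q. fst (fund a b) (fst q) (snd q))"
  "continuous_on (U \<times> {0..T}) (\<lambda>q. snd (fund a b) (fst q) (snd q))"
  by (rule continuous_on_subset[OF fund_cont(1)[unfolded case_prod_unfold]]; blast)
    (rule continuous_on_subset[OF fund_cont(2)[unfolded case_prod_unfold]]; blast)

lemma fund_integral_continuous:
  assumes "continuous_on {0..T} w"
  shows "continuous_on U (\<lambda>\<mu>. integral {0..T} (\<lambda>t. snd (fund a b) \<mu> t * w t))"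
  by (rule param_integral_continuous)
    (unfold case_prod_unfold, intro continuous_on_mult fund_cont_snd continuous_on_snd_coeff assms)

lemma fund_lagrange:
  "(\<nu> - \<mu>) * integral {0..T} (\<lambda>t. snd (fund a b) \<mu> t * snd (fund a' b') \<nu> t) =
     (fst (fund a b) \<mu> T * snd (fund a' b') \<nu> T - snd (fund a b) \<mu> T * fst (fund a' b') \<nu> T) - (a * b' - b * a')"
  using integral_unique[OF lagrange_integral[OF fund_sol[of \<mu> a b] fund_sol[of \<nu> a' b'] T_mem(1)]] by simp

lemma sol_zero:
  fixes \<mu> :: real
  assumes s: "sol \<mu> y x" and x: "\<And>t. t \<in> {0..T} \<Longrightarrow> x t = 0" and t: "t \<in> {0..T}"
  shows "y t = 0"
proof -
  have "(x has_vector_derivative 0) (at t within {0..T})"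
    by (rule has_vector_derivative_transform[OF t x]) auto
  then have "vel y x t = 0"
    using vector_derivative_unique_within_closed_interval[OF T, of t x "vel y x t" 0] t solD(2)[OF s t] by simp
  then show ?thesis
    using P_pos[OF t] x[OF t] by (simp add: vel_def)
qed

lemma sol_integral_pos:
  fixes \<mu> :: real
  assumes s: "sol \<mu> y x" and ne: "y 0 \<noteq> 0 \<or> x 0 \<noteq> 0 \<or> x T \<noteq> 0"
  shows "integral {0..T} (\<lambda>t. x t * x t) > 0"
proof -
  have c: "continuous_on {0..T} (\<lambda>t. x t * x t)"
    by (intro continuous_intros sol_continuous[OF s])
  have "integral {0..T} (\<lambda>t. x t * x t) \<ge> 0"
    by (intro integral_nonneg integrable_continuous_real c) auto
  moreover have "integral {0..T} (\<lambda>t. x t * x t) \<noteq> 0"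
  proof
    assume "integral {0..T} (\<lambda>t. x t * x t) = 0"
    then have x: "x t = 0" if "t \<in> {0..T}" for t
      using integral_eq_0_iff[OF c T] that by auto
    then show False
      using sol_zero[OF s x T_mem(2)] ne T_mem by auto
  qed
  ultimately show ?thesis
    by simp
qed

text \<open>The linear weight \<open>s\<close> with \<open>s 0 = - L\<close> and \<open>s T = L\<close> turns the boundary terms into
  an integral over \<open>[0,T]\<close> whose integrand is nonnegative for very negative \<open>\<mu>\<close>.\<close>

lemma energy_bound:
  fixes L :: real
  obtains K where "\<And>\<mu> y x. \<mu> \<le> K \<Longrightarrow> sol \<mu> y x \<Longrightarrow>
    y T * x T - y 0 * x 0 \<ge> L * ((x 0)\<^sup>2 + (x T)\<^sup>2) + integral {0..T} (\<lambda>t. x t * x t)"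
proof -
  define s where "s t = - L + 2 * L / T * t" for t
  \<comment> \<open>P v^2 + 2 (Q - s) x v + (Q - s)^2 x^2 / P is a square divided by P.
    \<open>B0\<close> collects what - \<mu> must then dominate: the completing term, - R, the slope
    2 L / T of s, and 1 for the integral of x^2 that is to be kept.\<close>
  define B0 where "B0 t = (Q t - s t)\<^sup>2 * (1 / P t) - R t + 2 * L / T + 1" for t
  have s_cont: "continuous_on {0..T} s"
    unfolding s_def by (intro continuous_intros)
  have "continuous_on {0..T} B0"
    unfolding B0_def by (intro continuous_intros s_cont cont_coeffs R)
  then obtain B where B: "\<And>t. t \<in> {0..T} \<Longrightarrow> \<bar>B0 t\<bar> \<le> B"
    using continuous_on_Icc_bound by metis
  show ?thesis
  proof (rule that[of "- B"])
    fix \<mu> :: real and y x assume \<mu>: "\<mu> \<le> - B" and sol: "sol \<mu> y x"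
    define v where "v = vel y x"
    define G where "G t = y t * x t - s t * (x t)\<^sup>2" for t
    define G' where "G' t = P t * (v t)\<^sup>2 + 2 * (Q t - s t) * (x t * v t) + (R t - \<mu> - 2 * L / T) * (x t)\<^sup>2" for t
    have dG: "(G has_real_derivative G' t) (at t within {0..T})" if t: "t \<in> {0..T}" for t
    proof -
      have y: "y t = P t * v t + Q t * x t"
        using P_pos[OF t] by (simp add: v_def vel_def)
      have ds: "(s has_real_derivative 2 * L / T) (at t within {0..T})"
        unfolding s_def using T by (auto intro!: derivative_eq_intros)
      have "(G has_real_derivative (Q t * v t + (R t - \<mu>) * x t) * x t + v t * y t
          - (2 * L / T * (x t)\<^sup>2 + (2 * x t * v t) * s t)) (at t within {0..T})"
        unfolding G_def
        by (rule derivative_eq_intros sol_DERIV[OF sol t] ds refl | simp add: v_def)+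
      moreover have "(Q t * v t + (R t - \<mu>) * x t) * x t + v t * y t
          - (2 * L / T * (x t)\<^sup>2 + (2 * x t * v t) * s t) = G' t"
        unfolding y G'_def by (simp add: algebra_simps power2_eq_square)
      ultimately show ?thesis
        by simp
    qed
    have G'_cont: "continuous_on {0..T} G'"
      unfolding G'_def v_def by (intro continuous_intros sol_continuous[OF sol] cont_coeffs s_cont R)
    have x_cont: "continuous_on {0..T} (\<lambda>t. x t * x t)"
      by (intro continuous_intros sol_continuous[OF sol])
    have "(G' has_integral (G T - G 0)) {0..T}"
      using dG T by (intro fundamental_theorem_of_calculus) (auto simp: has_real_derivative_iff_has_vector_derivative)
    then have "integral {0..T} G' = G T - G 0"
      by (rule integral_unique)
    moreover have "integral {0..T} (\<lambda>t. x t * x t) \<le> integral {0..T} G'"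
    proof (rule integral_le)
      fix t assume t: "t \<in> {0..T}"
      define b where "b = Q t - s t"
      have p: "P t > 0"
        using P_pos[OF t] .
      have "b\<^sup>2 * (1 / P t) \<le> R t - \<mu> - 2 * L / T - 1"
        using B[OF t] \<mu> by (simp add: B0_def b_def)
      then have "b\<^sup>2 * (1 / P t) * (x t)\<^sup>2 \<le> (R t - \<mu> - 2 * L / T - 1) * (x t)\<^sup>2"
        by (rule mult_right_mono) simp
      moreover have "0 \<le> (1 / P t) * (P t * v t + b * x t)\<^sup>2"
        using p by simp
      moreover have "(1 / P t) * (P t * v t + b * x t)\<^sup>2 = P t * (v t)\<^sup>2 + 2 * b * (x t * v t) + b\<^sup>2 * (1 / P t) * (x t)\<^sup>2"
        using p by (simp add: power2_eq_square field_simps)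
      ultimately show "x t * x t \<le> G' t"
        unfolding G'_def b_def[symmetric] by (simp add: algebra_simps power2_eq_square)
    qed (intro integrable_continuous_real x_cont G'_cont)+
    moreover have "G T - G 0 = y T * x T - y 0 * x 0 - L * ((x 0)\<^sup>2 + (x T)\<^sup>2)"
      using T by (simp add: G_def s_def algebra_simps)
    ultimately show "y T * x T - y 0 * x 0 \<ge> L * ((x 0)\<^sup>2 + (x T)\<^sup>2) + integral {0..T} (\<lambda>t. x t * x t)"
      by simp
  qed
qed

section \<open>Zeros of m21\<close>

definition dirichlet_spectrum :: "real set" where "dirichlet_spectrum = {\<mu>. m21 \<mu> = 0}"

text \<open>Lagrange's identity for \<open>X1\<close> at \<mu> and at d. As the integral is positive
  near d, the zero is simple and the sign of \<open>m21\<close> beside it is known, without any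
  derivative in \<mu>.\<close>

lemma m21_factor:
  assumes d: "m21 d = 0"
  shows "m21 \<mu> * m11 d = (\<mu> - d) * integral {0..T} (\<lambda>t. X1 \<mu> t * X1 d t)"
  using fund_lagrange[of d \<mu> 1 0 1 0] d unfolding m11_def m21_def by (simp add: algebra_simps)

lemma m21_local_sign:
  assumes d: "m21 d = 0"
  shows "\<exists>e>0. \<forall>\<mu>. \<bar>\<mu> - d\<bar> < e \<longrightarrow> integral {0..T} (\<lambda>t. X1 \<mu> t * X1 d t) > 0 \<and>
    (\<mu> \<noteq> d \<longrightarrow> (\<mu> - d) * (m21 \<mu> * m11 d) > 0)"
proof -
  let ?I = "\<lambda>\<mu>. integral {0..T} (\<lambda>t. X1 \<mu> t * X1 d t)"
  have "continuous_on UNIV ?I"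
    by (intro fund_integral_continuous sol_continuous[OF fund_sol])
  then have "isCont ?I d"
    by (simp add: continuous_on_eq_continuous_at)
  moreover have "?I d > 0"
    by (rule sol_integral_pos[OF fund_sol]) simp
  ultimately have "\<forall>\<^sub>F \<mu> in at d. ?I \<mu> > 0"
    unfolding isCont_def by (rule order_tendstoD)
  then obtain e where e: "e > 0" "\<And>\<mu>. \<mu> \<noteq> d \<Longrightarrow> dist \<mu> d < e \<Longrightarrow> ?I \<mu> > 0"
    unfolding eventually_at by auto
  have I: "?I \<mu> > 0" if "\<bar>\<mu> - d\<bar> < e" for \<mu>
    using e(2)[of \<mu>] that \<open>?I d > 0\<close> by (cases "\<mu> = d") (auto simp: dist_real_def)
  have "(\<mu> - d) * (m21 \<mu> * m11 d) > 0" if "\<bar>\<mu> - d\<bar> < e" "\<mu> \<noteq> d" for \<mu>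
  proof -
    have "(\<mu> - d)\<^sup>2 * ?I \<mu> > 0"
      using that by (intro mult_pos_pos I) auto
    then show ?thesis
      unfolding m21_factor[OF d] by (simp add: power2_eq_square mult.assoc)
  qed
  with I e(1) show ?thesis
    by blast
qed

section \<open>The quadratic form of N and its dependence on the parameter\<close>

definition qf :: "real \<Rightarrow> real \<Rightarrow> real \<Rightarrow> real" where
  "qf \<mu> u v = (m22 \<mu> * u\<^sup>2 - 2 * (u * v) + m11 \<mu> * v\<^sup>2) / m21 \<mu>"

text \<open>The value y(0) of the solution with x(0) = u and x(T) = v.\<close>

definition bvp_coeff :: "real \<Rightarrow> real \<Rightarrow> real \<Rightarrow> real" where
  "bvp_coeff \<mu> u v = (v - m22 \<mu> * u) / m21 \<mu>"

definition bvp_y :: "real \<Rightarrow> real \<Rightarrow> real \<Rightarrow> real \<Rightarrow> real" where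
  "bvp_y \<mu> u v t = bvp_coeff \<mu> u v * Y1 \<mu> t + u * Y2 \<mu> t"

definition bvp_x :: "real \<Rightarrow> real \<Rightarrow> real \<Rightarrow> real \<Rightarrow> real" where
  "bvp_x \<mu> u v t = bvp_coeff \<mu> u v * X1 \<mu> t + u * X2 \<mu> t"

lemma bvp_sol: "sol \<mu> (bvp_y \<mu> u v) (bvp_x \<mu> u v)"
  unfolding bvp_y_def bvp_x_def by (rule sol_combination[OF fund_sol fund_sol])

lemma bvp_boundary:
  assumes "m21 \<mu> \<noteq> 0"
  shows "bvp_x \<mu> u v 0 = u" "bvp_x \<mu> u v T = v"
    and "bvp_y \<mu> u v T * v - bvp_y \<mu> u v 0 * u = qf \<mu> u v"
proof -
  show "bvp_x \<mu> u v 0 = u" "bvp_x \<mu> u v T = v"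
    using assms by (simp_all add: bvp_x_def bvp_coeff_def m21_def m22_def)
  define a where "a = bvp_coeff \<mu> u v"
  have "a * m21 \<mu> = v - m22 \<mu> * u"
    using assms by (simp add: a_def bvp_coeff_def)
  have "((a * m11 \<mu> + u * m12 \<mu>) * v - a * u) * m21 \<mu>
      = (a * m21 \<mu>) * (m11 \<mu> * v - u) + u * v * (m21 \<mu> * m12 \<mu>)"
    by (simp add: algebra_simps)
  also have "\<dots> = (v - m22 \<mu> * u) * (m11 \<mu> * v - u) + u * v * (m11 \<mu> * m22 \<mu> - 1)"
    using det_m[of \<mu>] \<open>a * m21 \<mu> = _\<close> by simp
  also have "\<dots> = m22 \<mu> * u\<^sup>2 - 2 * (u * v) + m11 \<mu> * v\<^sup>2"
    by (simp add: algebra_simps power2_eq_square)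
  finally have "(a * m11 \<mu> + u * m12 \<mu>) * v - a * u = qf \<mu> u v"
    using assms by (simp add: qf_def eq_divide_eq)
  then show "bvp_y \<mu> u v T * v - bvp_y \<mu> u v 0 * u = qf \<mu> u v"
    by (simp add: bvp_y_def a_def m11_def m12_def)
qed

text \<open>The two solutions share the boundary values u and v, so the boundary terms of Lagrange's
  identity are exactly the two values of the form.\<close>

lemma qf_diff:
  assumes "m21 \<mu> \<noteq> 0" "m21 \<nu> \<noteq> 0"
  shows "qf \<mu> u v - qf \<nu> u v = (\<nu> - \<mu>) * integral {0..T} (\<lambda>t. bvp_x \<mu> u v t * bvp_x \<nu> u v t)"
proof -
  have "(\<nu> - \<mu>) * integral {0..T} (\<lambda>t. bvp_x \<mu> u v t * bvp_x \<nu> u v t) =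
      (bvp_y \<mu> u v T * bvp_x \<nu> u v T - bvp_x \<mu> u v T * bvp_y \<nu> u v T)
      - (bvp_y \<mu> u v 0 * bvp_x \<nu> u v 0 - bvp_x \<mu> u v 0 * bvp_y \<nu> u v 0)"
    using integral_unique[OF lagrange_integral[OF bvp_sol[of \<mu> u v] bvp_sol[of \<nu> u v] T_mem(1)]] by simp
  then show ?thesis
    using bvp_boundary[OF assms(1), of u v] bvp_boundary[OF assms(2), of u v]
    by (simp add: mult.commute)
qed

text \<open>By \<open>qf_diff\<close> the difference quotient is the negative of the integral of the
  product of two solutions. Its limit requires only continuity in \<mu>; no solution is
  differentiated with respect to the parameter.\<close>

lemma qf_DERIV:
  assumes m: "m21 \<kappa> \<noteq> 0"
  shows "((\<lambda>\<mu>. qf \<mu> u v) has_real_derivative - integral {0..T} (\<lambda>t. bvp_x \<kappa> u v t * bvp_x \<kappa> u v t)) (at \<kappa>)"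
proof -
  let ?w = "bvp_x \<kappa> u v"
  let ?I = "\<lambda>\<mu>. integral {0..T} (\<lambda>t. bvp_x \<mu> u v t * ?w t)"
  have w: "continuous_on {0..T} ?w"
    by (rule sol_continuous[OF bvp_sol])
  have f: "(\<lambda>t. snd (fund a b) \<mu> t * ?w t) integrable_on {0..T}" for a b \<mu>
    by (intro integrable_continuous_real continuous_intros w sol_continuous[OF fund_sol])
  have "?I \<mu> = integral {0..T} (\<lambda>t. bvp_coeff \<mu> u v * (X1 \<mu> t * ?w t) + u * (X2 \<mu> t * ?w t))" for \<mu>
    by (simp add: bvp_x_def algebra_simps)
  also have "\<dots> \<mu> = bvp_coeff \<mu> u v * integral {0..T} (\<lambda>t. X1 \<mu> t * ?w t)
      + u * integral {0..T} (\<lambda>t. X2 \<mu> t * ?w t)" for \<mu>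
    by (subst integral_add) (auto intro!: integrable_cmul[OF f, unfolded real_scaleR_def])
  finally have I: "?I = (\<lambda>\<mu>. bvp_coeff \<mu> u v * integral {0..T} (\<lambda>t. X1 \<mu> t * ?w t)
      + u * integral {0..T} (\<lambda>t. X2 \<mu> t * ?w t))"
    by (rule ext)
  have iso: "isCont g \<kappa>" if "continuous_on UNIV g" for g :: "real \<Rightarrow> real"
    using that by (simp add: continuous_on_eq_continuous_at)
  have "isCont ?I \<kappa>"
    unfolding I bvp_coeff_def
    by (intro isCont_add isCont_mult isCont_divide isCont_diff continuous_const m
        iso[OF fund_integral_continuous[OF w]] iso[OF m_cont(3)] iso[OF m_cont(4)])
  then have "(\<lambda>\<mu>. - ?I \<mu>) \<midarrow>\<kappa>\<rightarrow> - ?I \<kappa>"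
    unfolding isCont_def by (rule tendsto_minus)
  moreover have "\<forall>\<^sub>F \<mu> in at \<kappa>. m21 \<mu> \<noteq> 0"
    using iso[OF m_cont(3)] m unfolding isCont_def by (rule tendsto_imp_eventually_ne)
  then have "\<forall>\<^sub>F \<mu> in at \<kappa>. - ?I \<mu> = (qf \<mu> u v - qf \<kappa> u v) / (\<mu> - \<kappa>)"
    using eventually_neq_at_within[of \<kappa>]
  proof eventually_elim
    case (elim \<mu>)
    then show ?case
      unfolding qf_diff[OF elim(1) m] by (simp add: field_simps)
  qed
  ultimately have "(\<lambda>\<mu>. (qf \<mu> u v - qf \<kappa> u v) / (\<mu> - \<kappa>)) \<midarrow>\<kappa>\<rightarrow> - ?I \<kappa>"
    by (rule Lim_transform_eventually)
  then show ?thesis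
    by (simp add: has_field_derivative_iff)
qed

lemma qf_strict_decreasing:
  assumes "\<mu> < \<nu>" and m: "\<And>\<kappa>. \<mu> \<le> \<kappa> \<Longrightarrow> \<kappa> \<le> \<nu> \<Longrightarrow> m21 \<kappa> \<noteq> 0" and uv: "u \<noteq> 0 \<or> v \<noteq> 0"
  shows "qf \<nu> u v < qf \<mu> u v"
proof (rule DERIV_neg_imp_decreasing[OF assms(1)])
  fix \<kappa> assume \<kappa>: "\<mu> \<le> \<kappa>" "\<kappa> \<le> \<nu>"
  have "integral {0..T} (\<lambda>t. bvp_x \<kappa> u v t * bvp_x \<kappa> u v t) > 0"
    using uv bvp_boundary[OF m[OF \<kappa>], of u v] by (intro sol_integral_pos[OF bvp_sol]) auto
  then show "\<exists>D. ((\<lambda>\<mu>. qf \<mu> u v) has_real_derivative D) (at \<kappa>) \<and> D < 0"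
    using qf_DERIV[OF m[OF \<kappa>]] by (intro exI conjI) auto
qed

lemma qf_bounded_below:
  fixes L :: real
  shows "\<exists>K. \<forall>\<mu>\<le>K. m21 \<mu> \<noteq> 0 \<and> (\<forall>u v. qf \<mu> u v \<ge> L * (u\<^sup>2 + v\<^sup>2))"
proof -
  obtain K0 :: real where K0: "\<And>\<mu> y x. \<mu> \<le> K0 \<Longrightarrow> sol \<mu> y x \<Longrightarrow>
      y T * x T - y 0 * x 0 \<ge> 0 * ((x 0)\<^sup>2 + (x T)\<^sup>2) + integral {0..T} (\<lambda>t. x t * x t)"
    using energy_bound by blast
  obtain K :: real where K: "\<And>\<mu> y x. \<mu> \<le> K \<Longrightarrow> sol \<mu> y x \<Longrightarrow>
      y T * x T - y 0 * x 0 \<ge> L * ((x 0)\<^sup>2 + (x T)\<^sup>2) + integral {0..T} (\<lambda>t. x t * x t)"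
    using energy_bound by blast
  \<comment> \<open>The case L = 0 of the energy bound: if \<open>X1\<close> vanished at both ends,
    its boundary terms would be 0 while the integral of its square is positive.\<close>
  have m: "m21 \<mu> \<noteq> 0" if "\<mu> \<le> K0" for \<mu>
  proof
    assume "m21 \<mu> = 0"
    then show False
      using K0[OF that fund_sol[of \<mu> 1 0]] sol_integral_pos[OF fund_sol[of \<mu> 1 0]] by (simp add: m21_def)
  qed
  show ?thesis
  proof (intro exI[of _ "min K K0"] allI impI conjI)
    show "m21 \<mu> \<noteq> 0" if "\<mu> \<le> min K K0" for \<mu>
      using m that by simp
    fix \<mu> u v assume \<mu>: "\<mu> \<le> min K K0"
    have "integral {0..T} (\<lambda>t. bvp_x \<mu> u v t * bvp_x \<mu> u v t) \<ge> 0"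
      by (intro integral_nonneg integrable_continuous_real continuous_intros sol_continuous[OF bvp_sol]) auto
    then show "qf \<mu> u v \<ge> L * (u\<^sup>2 + v\<^sup>2)"
      using K[OF _ bvp_sol[of \<mu> u v]] bvp_boundary[OF m, of \<mu> u v] \<mu> by simp
  qed
qed

text \<open>With \<open>k = \<surd>\<mu>\<close> the scaled Pruefer angle \<open>\<Phi>\<close> of \<open>(y, k x)\<close> satisfies
  \<open>k x cos \<Phi> = y sin \<Phi>\<close> and grows at rate at least a multiple of \<open>k\<close>, so \<open>\<Phi> T\<close> passes
  through infinitely many multiples of \<open>\<pi>\<close> as \<open>\<mu>\<close> increases.\<close>

definition angle_rate :: "real \<Rightarrow> real \<Rightarrow> real" where
  "angle_rate \<mu> t = sqrt \<mu> * (P t * (vel (Y1 \<mu>) (X1 \<mu>) t)\<^sup>2 + (\<mu> - R t) * (X1 \<mu> t)\<^sup>2) /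
     ((Y1 \<mu> t)\<^sup>2 + \<mu> * (X1 \<mu> t)\<^sup>2)"

lemma angle_denom_pos:
  assumes "\<mu> > 0" "t \<in> {0..T}"
  shows "(Y1 \<mu> t)\<^sup>2 + \<mu> * (X1 \<mu> t)\<^sup>2 > 0"
proof -
  have "Y1 \<mu> t \<noteq> 0 \<or> X1 \<mu> t \<noteq> 0"
    using fund_wronskian[OF assms(2), of \<mu>] by auto
  then show ?thesis
    using assms(1) by (auto intro: add_pos_nonneg add_nonneg_pos)
qed

lemma angle_rate_continuous:
  "continuous_on ({0<..} \<times> {0..T}) (\<lambda>(\<mu>, t). angle_rate \<mu> t)"
  unfolding angle_rate_def vel_def case_prod_unfold of_real_eq_id id_apply
  by (intro continuous_on_divide continuous_on_mult continuous_on_add continuous_on_diff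
      continuous_on_power continuous_on_real_sqrt continuous_on_fst continuous_on_id
      fund_cont_snd continuous_on_snd_coeff cont_coeffs R ballI)
    (use angle_denom_pos in force)

lemma angle_rate_slice:
  assumes "\<mu> > 0"
  shows "continuous_on {0..T} (angle_rate \<mu>)"
proof -
  have "continuous_on {0..T} (\<lambda>t. (\<lambda>(\<mu>, t). angle_rate \<mu> t) (\<mu>, t))"
    by (rule continuous_on_compose2[OF angle_rate_continuous]) (use assms in \<open>auto intro!: continuous_intros\<close>)
  then show ?thesis
    by simp
qed

text \<open>The angle is defined as the integral of its intended rate, so no branch of an arctangent
  has to be followed. S = k x cos \<Phi> - y sin \<Phi> satisfies a linear equation S' = \<rho> S
  with S(0) = 0 and therefore vanishes.\<close>

lemma angle_identity:
  assumes \<mu>: "\<mu> > 0" and t: "t \<in> {0..T}"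
  shows "sqrt \<mu> * X1 \<mu> t * cos (integral {0..t} (angle_rate \<mu>)) = Y1 \<mu> t * sin (integral {0..t} (angle_rate \<mu>))"
proof -
  define k where "k = sqrt \<mu>"
  have k2: "k * k = \<mu>"
    using \<mu> by (simp add: k_def)
  define \<Phi> where "\<Phi> t = integral {0..t} (angle_rate \<mu>)" for t
  define y where "y = Y1 \<mu>"
  define x where "x = X1 \<mu>"
  define v where "v = vel y x"
  define dy where "dy t = Q t * v t + (R t - \<mu>) * x t" for t
  define N where "N t = (y t)\<^sup>2 + \<mu> * (x t)\<^sup>2" for t
  have N: "N t > 0" if "t \<in> {0..T}" for t
    using angle_denom_pos[OF \<mu> that] by (simp add: N_def y_def x_def)
  note s = fund_sol[of \<mu> 1 0, folded y_def x_def]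
  define \<rho> where "\<rho> t = (y t * dy t + \<mu> * (x t * v t)) / N t" for t
  have \<rho>_cont: "continuous_on {0..T} \<rho>"
    unfolding \<rho>_def dy_def v_def N_def
    by (intro continuous_intros sol_continuous[OF s] cont_coeffs R)
      (use N in \<open>force simp: N_def\<close>)
  define S where "S t = k * x t * cos (\<Phi> t) - y t * sin (\<Phi> t)" for t
  \<comment> \<open>Multiplication by the integrating factor of S' = \<rho> S yields a function with
    derivative 0.\<close>
  define H where "H t = S t * exp (- integral {0..t} \<rho>)" for t
  have dH: "(H has_real_derivative 0) (at t within {0..T})" if t: "t \<in> {0..T}" for t
  proof -
    define w where "w = angle_rate \<mu> t"
    have d\<Phi>: "(\<Phi> has_real_derivative w) (at t within {0..T})"
      unfolding \<Phi>_def has_real_derivative_iff_has_vector_derivative w_def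
      by (rule integral_has_vector_derivative[OF angle_rate_slice[OF \<mu>] t])
    have d\<rho>: "((\<lambda>t. integral {0..t} \<rho>) has_real_derivative \<rho> t) (at t within {0..T})"
      unfolding has_real_derivative_iff_has_vector_derivative
      by (rule integral_has_vector_derivative[OF \<rho>_cont t])
    have dx: "(x has_real_derivative v t) (at t within {0..T})" and dy: "(y has_real_derivative dy t) (at t within {0..T})"
      using sol_DERIV[OF s t] by (simp_all add: v_def dy_def)
    have dS: "(S has_real_derivative k * v t * cos (\<Phi> t) - k * x t * (sin (\<Phi> t) * w)
        - (dy t * sin (\<Phi> t) + y t * (cos (\<Phi> t) * w))) (at t within {0..T})"
      unfolding S_def
      by (rule derivative_eq_intros dx dy d\<Phi> refl | simp)+
    have y: "y t = P t * v t + Q t * x t"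
      using P_pos[OF t] by (simp add: v_def vel_def)
    have "w * N t = k * (P t * (v t)\<^sup>2 + (\<mu> - R t) * (x t)\<^sup>2)"
      using N[OF t] by (simp add: w_def angle_rate_def N_def y_def x_def v_def k_def)
    also have "P t * (v t)\<^sup>2 + (\<mu> - R t) * (x t)\<^sup>2 = v t * y t - x t * dy t"
      unfolding y dy_def by (simp add: algebra_simps power2_eq_square)
    finally have w: "w * N t = k * (v t * y t - x t * dy t)" .
    have "(k * v t * cos (\<Phi> t) - k * x t * (sin (\<Phi> t) * w) - (dy t * sin (\<Phi> t) + y t * (cos (\<Phi> t) * w))) * N t
        = k * v t * cos (\<Phi> t) * N t - dy t * sin (\<Phi> t) * N t
          - (k * x t * sin (\<Phi> t) + y t * cos (\<Phi> t)) * (w * N t)"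
      by (simp add: algebra_simps)
    also have "\<dots> = (y t * dy t + (k * k) * (x t * v t)) * S t"
      unfolding w unfolding N_def S_def k2[symmetric] by (simp add: algebra_simps power2_eq_square)
    also have "\<dots> = \<rho> t * S t * N t"
      using N[OF t] by (simp add: \<rho>_def k2)
    finally have "k * v t * cos (\<Phi> t) - k * x t * (sin (\<Phi> t) * w)
        - (dy t * sin (\<Phi> t) + y t * (cos (\<Phi> t) * w)) = \<rho> t * S t"
      using N[OF t] by simp
    with dS have dS': "(S has_real_derivative \<rho> t * S t) (at t within {0..T})"
      by simp
    show ?thesis
      unfolding H_def
      by (rule derivative_eq_intros dS' d\<rho> refl | simp)+
  qed
  have "((\<lambda>s. 0) has_integral (H t - H 0)) {0..t}"
  proof (rule fundamental_theorem_of_calculus)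
    fix s assume "s \<in> {0..t}"
    then have "(H has_vector_derivative 0) (at s within {0..T})"
      using dH[of s] t by (simp add: has_real_derivative_iff_has_vector_derivative)
    then show "(H has_vector_derivative 0) (at s within {0..t})"
      by (rule has_vector_derivative_within_subset) (use t in auto)
  qed (use t in simp)
  then have "H t = H 0"
    using has_integral_unique[OF _ has_integral_0] by fastforce
  also have "H 0 = 0"
    by (simp add: H_def S_def \<Phi>_def x_def)
  finally show ?thesis
    by (simp add: H_def S_def \<Phi>_def k_def x_def y_def)
qed

text \<open>Numerator and denominator are compared through y^2 <= 2 (P v)^2 + 2 (Q x)^2. The terms
  in v need 2 m P <= 1; for those in x, \<mu> >= 2 B gives Q^2 + \<mu> / 2 <= \<mu> - R, and 2 m <=
  1 finishes.\<close>

lemma angle_rate_lower_bound: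
  obtains m \<mu>0 where "m > 0" "\<mu>0 > 0"
    "\<And>\<mu> t. \<mu> \<ge> \<mu>0 \<Longrightarrow> t \<in> {0..T} \<Longrightarrow> angle_rate \<mu> t \<ge> sqrt \<mu> * m"
proof -
  obtain BP where BP: "BP > 0" "\<And>t. t \<in> {0..T} \<Longrightarrow> \<bar>P t\<bar> \<le> BP"
    using continuous_on_Icc_bound[OF cont_coeffs(1)] by blast
  have "continuous_on {0..T} (\<lambda>t. (Q t)\<^sup>2 + R t)"
    by (intro continuous_intros cont_coeffs R)
  then obtain B where B: "B > 0" "\<And>t. t \<in> {0..T} \<Longrightarrow> \<bar>(Q t)\<^sup>2 + R t\<bar> \<le> B"
    using continuous_on_Icc_bound by blast
  define m where "m = min (1 / 2) (1 / (2 * BP))"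
  have m: "m > 0" "2 * m \<le> 1" "2 * m * BP \<le> 1"
    using BP by (auto simp: m_def field_simps min_def)
  show ?thesis
  proof (rule that[of m "2 * B"])
    fix \<mu> t assume \<mu>: "\<mu> \<ge> 2 * B" and t: "t \<in> {0..T}"
    have \<mu>0: "\<mu> > 0"
      using \<mu> B by simp
    define y where "y = Y1 \<mu> t"
    define x where "x = X1 \<mu> t"
    define v where "v = vel (Y1 \<mu>) (X1 \<mu>) t"
    have p: "P t > 0" "P t \<le> BP"
      using P_pos[OF t] BP(2)[OF t] by auto
    have y: "y = P t * v + Q t * x"
      using p by (simp add: v_def vel_def y_def x_def)
    have "y\<^sup>2 \<le> 2 * (P t * v)\<^sup>2 + 2 * (Q t * x)\<^sup>2"
      using sum_squares_bound[of "P t * v" "Q t * x"] unfolding y by (simp add: power2_sum)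
    then have "m * y\<^sup>2 \<le> m * (2 * (P t * v)\<^sup>2 + 2 * (Q t * x)\<^sup>2)"
      using m by (intro mult_left_mono) auto
    moreover have "m * (2 * (P t * v)\<^sup>2) \<le> P t * v\<^sup>2"
    proof -
      have "2 * m * P t \<le> 2 * m * BP"
        using p m by (intro mult_left_mono) auto
      then have "2 * m * P t \<le> 1"
        using m by linarith
      then have "(2 * m * P t) * (P t * v\<^sup>2) \<le> 1 * (P t * v\<^sup>2)"
        using p by (intro mult_right_mono) auto
      then show ?thesis
        by (simp add: power2_eq_square algebra_simps)
    qed
    moreover have "m * (2 * (Q t * x)\<^sup>2) + m * (\<mu> * x\<^sup>2) \<le> (\<mu> - R t) * x\<^sup>2"
    proof -
      have "(2 * m) * ((Q t)\<^sup>2 + \<mu> / 2) \<le> 1 * ((Q t)\<^sup>2 + \<mu> / 2)"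
        using m \<mu>0 by (intro mult_right_mono) auto
      also have "\<dots> \<le> \<mu> - R t"
        using B(2)[OF t] \<mu> by auto
      finally have "((2 * m) * ((Q t)\<^sup>2 + \<mu> / 2)) * x\<^sup>2 \<le> (\<mu> - R t) * x\<^sup>2"
        by (rule mult_right_mono) simp
      then show ?thesis
        by (simp add: power2_eq_square algebra_simps)
    qed
    ultimately have "m * (y\<^sup>2 + \<mu> * x\<^sup>2) \<le> P t * v\<^sup>2 + (\<mu> - R t) * x\<^sup>2"
      by (simp add: algebra_simps)
    then have "sqrt \<mu> * (m * (y\<^sup>2 + \<mu> * x\<^sup>2)) \<le> sqrt \<mu> * (P t * v\<^sup>2 + (\<mu> - R t) * x\<^sup>2)"
      using \<mu>0 by (intro mult_left_mono) auto
    then show "angle_rate \<mu> t \<ge> sqrt \<mu> * m"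
      using angle_denom_pos[OF \<mu>0 t]
      by (simp add: angle_rate_def pos_le_divide_eq y_def x_def v_def mult.assoc)
  qed (use m B in auto)
qed

lemma dirichlet_spectrum_unbounded: "\<exists>\<mu>\<in>dirichlet_spectrum. \<mu> > B"
proof -
  obtain m \<mu>0 where m: "m > 0" "\<mu>0 > 0"
    "\<And>\<mu> t. \<mu> \<ge> \<mu>0 \<Longrightarrow> t \<in> {0..T} \<Longrightarrow> angle_rate \<mu> t \<ge> sqrt \<mu> * m"
    using angle_rate_lower_bound by blast
  define \<Phi> where "\<Phi> \<mu> = integral {0..T} (angle_rate \<mu>)" for \<mu>
  have \<Phi>_cont: "continuous_on {0<..} \<Phi>"
    unfolding \<Phi>_def by (rule param_integral_continuous[OF angle_rate_continuous])
  have \<Phi>_ge: "\<Phi> \<mu> \<ge> sqrt \<mu> * m * T" if "\<mu> \<ge> \<mu>0" for \<mu>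
  proof -
    have "integral {0..T} (\<lambda>t. sqrt \<mu> * m) \<le> \<Phi> \<mu>"
      unfolding \<Phi>_def using m that
      by (intro integral_le integrable_continuous_real angle_rate_slice continuous_on_const) auto
    then show ?thesis
      using T by (simp add: mult_ac)
  qed
  define b where "b = max \<mu>0 (B + 1)"
  have b: "b \<ge> \<mu>0" "b > B" "b > 0"
    using m by (auto simp: b_def)
  obtain n :: nat where n: "\<Phi> b / pi < real n"
    using reals_Archimedean2 by blast
  then have n': "\<Phi> b \<le> real n * pi"
    using pi_gt_zero by (simp add: field_simps)
  \<comment> \<open>Chosen so that r m T = n \<pi>; with b' >= r^2 the lower bound of \<Phi> at b'
    reaches n \<pi>, while \<Phi> b is at most n \<pi>.\<close>
  define r where "r = real n * pi / (m * T)"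
  have "r \<ge> 0"
    using m T by (simp add: r_def)
  define b' where "b' = max b (r\<^sup>2)"
  have "sqrt b' \<ge> r"
    using real_sqrt_le_mono[of "r\<^sup>2" b'] \<open>r \<ge> 0\<close> by (simp add: b'_def)
  then have "sqrt b' * (m * T) \<ge> r * (m * T)"
    using m T by (intro mult_right_mono) auto
  moreover have "r * (m * T) = real n * pi"
    using m T by (simp add: r_def)
  moreover have "sqrt b' * (m * T) \<le> \<Phi> b'"
    using \<Phi>_ge[of b'] b by (simp add: b'_def mult.assoc)
  ultimately have "\<Phi> b' \<ge> real n * pi"
    by linarith
  moreover have "b \<le> b'"
    by (simp add: b'_def)
  moreover have "{b..b'} \<subseteq> {0<..}"
    using b by auto
  ultimately obtain \<mu> where \<mu>: "b \<le> \<mu>" "\<mu> \<le> b'" "\<Phi> \<mu> = real n * pi"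
    using IVT'[of \<Phi> b "real n * pi" b'] n' continuous_on_subset[OF \<Phi>_cont] by blast
  \<comment> \<open>At a multiple of \<pi> the sine vanishes and the cosine does not, so x(T) =
    0.\<close>
  have "sqrt \<mu> * X1 \<mu> T * cos (\<Phi> \<mu>) = 0"
    using angle_identity[OF _ T_mem(1), of \<mu>] \<mu> b by (simp add: \<Phi>_def[symmetric])
  moreover have "cos (\<Phi> \<mu>) \<noteq> 0"
    using \<mu>(3) by simp
  ultimately have "m21 \<mu> = 0"
    using \<mu> b by (simp add: m21_def)
  then show ?thesis
    using \<mu> b by (auto simp: dirichlet_spectrum_def)
qed

text \<open>Zeros of \<open>m21\<close> are isolated by the sign lemma and absent below some K, so
  infinitely many of them below B would accumulate in a compact interval.\<close>

lemma dirichlet_spectrum_finite: "finite (dirichlet_spectrum \<inter> {..B})"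
proof -
  obtain K where K: "\<And>\<mu>. \<mu> \<le> K \<Longrightarrow> m21 \<mu> \<noteq> 0"
    using qf_bounded_below by blast
  have closed: "closed dirichlet_spectrum"
    unfolding dirichlet_spectrum_def using continuous_closed_vimage[of "{0}" m21] m_cont(3)[of UNIV]
    by (simp add: continuous_on_eq_continuous_at vimage_def)
  have "finite ({K..B} \<inter> dirichlet_spectrum)"
  proof (rule finite_not_islimpt_in_compact)
    fix d assume "d \<in> {K..B}"
    show "\<not> d islimpt dirichlet_spectrum"
    proof
      assume lim: "d islimpt dirichlet_spectrum"
      then have "d \<in> dirichlet_spectrum"
        using closed closed_limpt by blast
      then have "m21 d = 0"
        by (simp add: dirichlet_spectrum_def)
      from m21_local_sign[OF this] obtain e where e: "e > 0"
        "\<And>\<mu>. \<bar>\<mu> - d\<bar> < e \<Longrightarrow> \<mu> \<noteq> d \<Longrightarrow> (\<mu> - d) * (m21 \<mu> * m11 d) > 0"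
        by blast
      obtain \<mu> where "\<mu> \<in> dirichlet_spectrum" "\<mu> \<noteq> d" "dist \<mu> d < e"
        using lim e(1) unfolding islimpt_approachable by blast
      then show False
        using e(2)[of \<mu>] by (simp add: dirichlet_spectrum_def dist_real_def)
    qed
  qed simp
  moreover have "dirichlet_spectrum \<inter> {..B} \<subseteq> {K..B} \<inter> dirichlet_spectrum"
  proof
    fix z assume "z \<in> dirichlet_spectrum \<inter> {..B}"
    then show "z \<in> {K..B} \<inter> dirichlet_spectrum"
      using K[of z] by (cases "z \<le> K") (auto simp: dirichlet_spectrum_def)
  qed
  ultimately show ?thesis
    by (rule rev_finite_subset)
qed

text \<open>(1, m22 d) is the direction in which the rank-one pole of N is invisible: the numerator
  of \<open>qf\<close> vanishes there at d. The limit is found without differentiation, by writing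
  m11 \<mu> * m22 d - 1 as \<open>m21 \<mu> * r \<mu>\<close> with r convergent at d.\<close>

lemma qf_limit:
  assumes d: "m21 d = 0"
  shows "((\<lambda>\<mu>. qf \<mu> 1 (m22 d)) \<longlongrightarrow> m12 d * m22 d) (at d)"
proof -
  define w where "w = m22 d"
  have det: "m11 d * w = 1"
    using det_m[of d] d by (simp add: w_def)
  obtain e where e: "e > 0" "\<And>\<mu>. \<bar>\<mu> - d\<bar> < e \<Longrightarrow> integral {0..T} (\<lambda>t. X1 \<mu> t * X1 d t) > 0"
    "\<And>\<mu>. \<bar>\<mu> - d\<bar> < e \<Longrightarrow> \<mu> \<noteq> d \<Longrightarrow> (\<mu> - d) * (m21 \<mu> * m11 d) > 0"
    using m21_local_sign[OF d] by blast
  define I where "I \<mu> = integral {0..T} (\<lambda>t. X1 \<mu> t * X1 d t)" for \<mu>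
  define J where "J \<mu> = integral {0..T} (\<lambda>t. X1 \<mu> t * X2 d t)" for \<mu>
  define r where "r \<mu> = m12 d - m11 d * (J \<mu> / I \<mu>)" for \<mu>
  have iso: "g \<midarrow>d\<rightarrow> g d" if "continuous_on UNIV g" for g :: "real \<Rightarrow> real"
    using that by (simp add: continuous_on_eq_continuous_at isCont_def)
  have I: "I \<midarrow>d\<rightarrow> I d" and J: "J \<midarrow>d\<rightarrow> J d"
    unfolding I_def J_def
    by (intro iso fund_integral_continuous sol_continuous[OF fund_sol])+
  have Id: "I d \<noteq> 0"
    using e(2)[of d] e(1) by (simp add: I_def)
  have m11d: "m11 d \<noteq> 0"
    using det by auto
  have r: "r \<midarrow>d\<rightarrow> r d"
    unfolding r_def by (intro tendsto_intros I J Id)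
  have m11: "m11 \<midarrow>d\<rightarrow> m11 d" and m12: "m12 \<midarrow>d\<rightarrow> m12 d" and m21: "m21 \<midarrow>d\<rightarrow> 0"
    using iso[OF m_cont(1)] iso[OF m_cont(2)] iso[OF m_cont(3)] d by simp_all
  have "(\<lambda>\<mu>. m12 \<mu> / m11 \<mu> + m21 \<mu> * (r \<mu>)\<^sup>2 / m11 \<mu>) \<midarrow>d\<rightarrow> m12 d / m11 d + 0 * (r d)\<^sup>2 / m11 d"
    by (intro tendsto_intros m11 m12 m21 r m11d)
  moreover have "m12 d / m11 d + 0 * (r d)\<^sup>2 / m11 d = m12 d * m22 d"
    using det m11d by (simp add: w_def field_simps)
  ultimately have lim: "(\<lambda>\<mu>. m12 \<mu> / m11 \<mu> + m21 \<mu> * (r \<mu>)\<^sup>2 / m11 \<mu>) \<midarrow>d\<rightarrow> m12 d * m22 d"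
    by simp
  have "\<forall>\<^sub>F \<mu> in at d. m11 \<mu> \<noteq> 0"
    using m11 m11d by (rule tendsto_imp_eventually_ne)
  moreover have "\<forall>\<^sub>F \<mu> in at d. \<bar>\<mu> - d\<bar> < e \<and> \<mu> \<noteq> d"
    unfolding eventually_at using e(1) by (auto simp: dist_real_def)
  ultimately have "\<forall>\<^sub>F \<mu> in at d. m12 \<mu> / m11 \<mu> + m21 \<mu> * (r \<mu>)\<^sup>2 / m11 \<mu> = qf \<mu> 1 (m22 d)"
  proof eventually_elim
    case (elim \<mu>)
    have I0: "I \<mu> \<noteq> 0"
      using e(2)[of \<mu>] elim by (simp add: I_def)
    have m0: "m21 \<mu> \<noteq> 0"
      using e(3)[of \<mu>] elim by auto
    have "(\<mu> - d) = m21 \<mu> * m11 d / I \<mu>"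
      using m21_factor[OF d, of \<mu>] I0 by (simp add: I_def[symmetric] field_simps)
    \<comment> \<open>Lagrange's identity between \<open>X1\<close> at \<mu> and \<open>X2\<close>
      at d; the factor d - \<mu> is then traded for \<open>m21 \<mu>\<close> by
      \<open>m21_factor\<close>.\<close>
    moreover have "m11 \<mu> * w - m21 \<mu> * m12 d - 1 = (d - \<mu>) * J \<mu>"
      using fund_lagrange[of d \<mu> 1 0 0 1] by (simp add: J_def w_def m11_def m12_def m21_def m22_def)
    moreover have "(d - \<mu>) * J \<mu> = - ((\<mu> - d) * J \<mu>)"
      by (simp add: algebra_simps)
    ultimately have "m11 \<mu> * w - m21 \<mu> * m12 d - 1 = - (m21 \<mu> * m11 d / I \<mu> * J \<mu>)"
      by simp
    then have rr: "m11 \<mu> * w - 1 = m21 \<mu> * r \<mu>"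
      by (simp add: r_def algebra_simps)
    have "m22 \<mu> * m11 \<mu> = 1 + m12 \<mu> * m21 \<mu>"
      using det_m[of \<mu>] by (simp add: algebra_simps)
    \<comment> \<open>Completing the square with the determinant relation exposes a factor
      \<open>m21 \<mu>\<close> that cancels the pole.\<close>
    then have "(m22 \<mu> * 1\<^sup>2 - 2 * (1 * w) + m11 \<mu> * w\<^sup>2) * m11 \<mu> = m12 \<mu> * m21 \<mu> + (m11 \<mu> * w - 1)\<^sup>2"
      by (simp add: algebra_simps power2_eq_square)
    also have "\<dots> = (m12 \<mu> + m21 \<mu> * (r \<mu>)\<^sup>2) * m21 \<mu>"
      unfolding rr by (simp add: algebra_simps power2_eq_square)
    finally have "(m22 \<mu> * 1\<^sup>2 - 2 * (1 * w) + m11 \<mu> * w\<^sup>2) / m21 \<mu> = (m12 \<mu> + m21 \<mu> * (r \<mu>)\<^sup>2) / m11 \<mu>"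
      using m0 elim by (simp add: frac_eq_eq)
    then show ?case
      unfolding qf_def w_def[symmetric] by (simp add: add_divide_distrib)
  qed
  with lim show ?thesis
    by (rule Lim_transform_eventually)
qed

section \<open>Dirichlet eigenvalues and multiplicities\<close>

text \<open>Indexed from 0: \<open>dn k\<close> is the Dirichlet eigenvalue number k + 1.\<close>

definition dn :: "nat \<Rightarrow> real" where
  "dn = (SOME d. strict_mono d \<and> range d = dirichlet_spectrum)"

lemma dn: "strict_mono dn" "range dn = dirichlet_spectrum"
proof -
  have "\<exists>d :: nat \<Rightarrow> real. strict_mono d \<and> range d = dirichlet_spectrum"
    using enumerate_discrete[OF dirichlet_spectrum_finite, of thesis for thesis] dirichlet_spectrum_unbounded by metis
  then have "strict_mono dn \<and> range dn = dirichlet_spectrum"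
    unfolding dn_def by (rule someI_ex)
  then show "strict_mono dn" "range dn = dirichlet_spectrum"
    by simp_all
qed

lemma m21_eq_0_iff: "m21 \<mu> = 0 \<longleftrightarrow> (\<exists>k. \<mu> = dn k)"
  using dn(2) by (auto simp: dirichlet_spectrum_def)

lemma m21_dn [simp]: "m21 (dn k) = 0"
  by (auto simp: m21_eq_0_iff)

lemma dn_less_iff [simp]: "dn j < dn k \<longleftrightarrow> j < k"
  using dn(1) by (rule strict_mono_less)

lemma dn_le_iff [simp]: "dn j \<le> dn k \<longleftrightarrow> j \<le> k"
  using dn(1) by (rule strict_mono_less_eq)

lemma dn_eq_iff [simp]: "dn j = dn k \<longleftrightarrow> j = k"
  using dn(1) by (rule strict_mono_eq)

text \<open>\<open>gap k\<close> ends at the pole \<open>dn k\<close>; the guard makes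
  \<open>gap 0\<close> the half line below all poles.\<close>

definition gap :: "nat \<Rightarrow> real set" where
  "gap k = {\<mu>. (k > 0 \<longrightarrow> dn (k - 1) < \<mu>) \<and> \<mu> < dn k}"

lemma gap_Suc: "\<mu> \<in> gap (Suc k) \<longleftrightarrow> dn k < \<mu> \<and> \<mu> < dn (Suc k)"
  by (simp add: gap_def)

lemma gap_less: "\<mu> \<in> gap k \<Longrightarrow> \<mu> < dn k"
  by (simp add: gap_def)

lemma gap_between: "a \<in> gap k \<Longrightarrow> b \<in> gap k \<Longrightarrow> a \<le> x \<Longrightarrow> x \<le> b \<Longrightarrow> x \<in> gap k"
  by (auto simp: gap_def)

lemma gap_unique: "\<mu> \<in> gap j \<Longrightarrow> \<mu> \<in> gap k \<Longrightarrow> j = k"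
proof (induction j k rule: linorder_wlog)
  case (le j k)
  show ?case
  proof (rule ccontr)
    assume "j \<noteq> k"
    then have "k > 0" "dn j \<le> dn (k - 1)"
      using le(1) by simp_all
    moreover have "\<mu> < dn j" "k > 0 \<longrightarrow> dn (k - 1) < \<mu>"
      using le(2,3) unfolding gap_def by blast+
    ultimately show False
      by linarith
  qed
next
  case (sym j k)
  then show ?case by auto
qed

lemma gap_neq_dn: "\<mu> \<in> gap k \<Longrightarrow> \<mu> \<noteq> dn i"
proof
  assume "\<mu> \<in> gap k" "\<mu> = dn i"
  then have "i < k" "k > 0 \<longrightarrow> k - 1 < i"
    by (auto simp: gap_def)
  then show False by simp
qed

lemma m21_gap: "\<mu> \<in> gap k \<Longrightarrow> m21 \<mu> \<noteq> 0"
  using gap_neq_dn m21_eq_0_iff by blast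

lemma gap_cases:
  obtains k where "\<mu> \<in> gap k" | k where "\<mu> = dn k"
proof -
  have ex: "\<exists>k. \<mu> \<le> dn k"
    using dirichlet_spectrum_unbounded[of \<mu>] dn(2) by (metis imageE less_imp_le)
  define k where "k = (LEAST k. \<mu> \<le> dn k)"
  have k: "\<mu> \<le> dn k"
    unfolding k_def using ex by (rule LeastI_ex)
  have "\<not> \<mu> \<le> dn (k - 1)" if "k > 0"
    unfolding k_def using not_less_Least[of "k - 1" "\<lambda>k. \<mu> \<le> dn k"] that by (simp add: k_def)
  then have "\<mu> \<in> gap k \<or> \<mu> = dn k"
    using k unfolding gap_def by (auto simp: not_le)
  then show ?thesis
    using that by blast
qed

lemma gap_open: "open (gap k)"
proof (cases k)
  case 0
  then have "gap k = {..<dn 0}"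
    by (auto simp: gap_def)
  then show ?thesis by simp
next
  case (Suc i)
  then have "gap k = {dn i<..<dn (Suc i)}"
    by (auto simp: gap_def)
  then show ?thesis by simp
qed

lemma gap_near_left: "e > 0 \<Longrightarrow> \<exists>\<mu>\<in>gap k. dn k - e < \<mu>"
proof (cases k)
  case 0
  assume "e > 0"
  then show ?thesis
    using 0 by (intro bexI[of _ "dn 0 - e / 2"]) (auto simp: gap_def)
next
  case (Suc i)
  assume "e > 0"
  moreover have "dn i < dn (Suc i)"
    by simp
  ultimately obtain \<mu> where "max (dn i) (dn (Suc i) - e) < \<mu>" "\<mu> < dn (Suc i)"
    using dense[of "max (dn i) (dn (Suc i) - e)" "dn (Suc i)"] by auto
  then show ?thesis
    using Suc by (intro bexI[of _ \<mu>]) (auto simp: gap_def)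
qed

lemma gap_near_right: "e > 0 \<Longrightarrow> \<exists>\<mu>\<in>gap (Suc k). \<mu> < dn k + e"
proof -
  assume "e > 0"
  moreover have "dn k < dn (Suc k)"
    by simp
  ultimately obtain \<mu> where "dn k < \<mu>" "\<mu> < min (dn (Suc k)) (dn k + e)"
    using dense[of "dn k" "min (dn (Suc k)) (dn k + e)"] by auto
  then show ?thesis
    by (intro bexI[of _ \<mu>]) (auto simp: gap_def)
qed

lemma bv_combination:
  "bv \<mu> (a * \<alpha> + b * \<alpha>') (a * \<beta> + b * \<beta>') = bscale a (bv \<mu> \<alpha> \<beta>) + bscale b (bv \<mu> \<alpha>' \<beta>')"
  by (rule bvals_eqI) (simp_all add: bv_def algebra_simps)

lemma bv_comps [simp]:
  "fst (bv \<mu> \<alpha> \<beta>) $ 1 = \<alpha>" "fst (bv \<mu> \<alpha> \<beta>) $ 2 = \<beta>"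
  "snd (bv \<mu> \<alpha> \<beta>) $ 1 = of_real (m11 \<mu>) * \<alpha> + of_real (m12 \<mu>) * \<beta>"
  "snd (bv \<mu> \<alpha> \<beta>) $ 2 = of_real (m21 \<mu>) * \<alpha> + of_real (m22 \<mu>) * \<beta>"
  by (simp_all add: bv_def)

text \<open>The dimension of the space of initial data (y(0), x(0)) = (\<alpha>, \<beta>) whose
  solution satisfies the condition; a subspace of pairs has only these three dimensions.\<close>

definition geom_mult :: "bvals set \<Rightarrow> real \<Rightarrow> nat" where
  "geom_mult \<Lambda> \<mu> = (if \<forall>\<alpha> \<beta>. bv \<mu> \<alpha> \<beta> \<in> \<Lambda> then 2
     else if \<forall>\<alpha> \<beta>. bv \<mu> \<alpha> \<beta> \<in> \<Lambda> \<longrightarrow> \<alpha> = 0 \<and> \<beta> = 0 then 0 else 1)"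

lemma dim_eigenspace:
  assumes sub: "bvec.subspace \<Lambda>"
  shows "fvec.dim (eigenspace T P Q R \<Lambda> (of_real \<mu>)) = geom_mult \<Lambda> \<mu>"
proof -
  define S where "S = {(\<alpha>, \<beta>). bv \<mu> \<alpha> \<beta> \<in> \<Lambda>}"
  have comb: "bscale a (bv \<mu> \<alpha> \<beta>) + bscale b (bv \<mu> \<alpha>' \<beta>') \<in> \<Lambda>"
    if "bv \<mu> \<alpha> \<beta> \<in> \<Lambda>" "bv \<mu> \<alpha>' \<beta>' \<in> \<Lambda>" for a b \<alpha> \<beta> \<alpha>' \<beta>'
    using that sub by (intro bvec.subspace_add bvec.subspace_scale)
  have zero: "bv \<mu> 0 0 \<in> \<Lambda>"
  proof -
    have "bv \<mu> 0 0 = 0"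
      by (rule bvals_eqI) simp_all
    then show ?thesis
      using bvec.subspace_0[OF sub] by simp
  qed
  have "fvec.dim (eigenspace T P Q R \<Lambda> (of_real \<mu>)) = (if S = UNIV then 2 else if S = {(0, 0)} then 0 else 1)"
    unfolding eigenspace_real S_def[symmetric]
  proof (rule fvec.dim_param)
    show "(fst u + fst v, snd u + snd v) \<in> S" if "u \<in> S" "v \<in> S" for u v
      using comb[of "fst u" "snd u" "fst v" "snd v" 1 1] that
        bv_combination[of \<mu> 1 "fst u" 1 "fst v" "snd u" "snd v"]
      by (auto simp: S_def)
    show "(k * fst u, k * snd u) \<in> S" if "u \<in> S" for k u
      using comb[of "fst u" "snd u" "fst u" "snd u" k 0] that
        bv_combination[of \<mu> k "fst u" 0 "fst u" "snd u" "snd u"]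
      by (auto simp: S_def)
    show "(0, 0) \<in> S"
      using zero by (simp add: S_def)
  qed (use efun_independent in blast)
  moreover have "S = UNIV \<longleftrightarrow> (\<forall>\<alpha> \<beta>. bv \<mu> \<alpha> \<beta> \<in> \<Lambda>)"
    by (auto simp: S_def)
  moreover have "S = {(0, 0)} \<longleftrightarrow> (\<forall>\<alpha> \<beta>. bv \<mu> \<alpha> \<beta> \<in> \<Lambda> \<longrightarrow> \<alpha> = 0 \<and> \<beta> = 0)"
    using zero by (auto simp: S_def)
  ultimately show ?thesis
    by (simp add: geom_mult_def)
qed

text \<open>Lagrange's identity for x and its conjugate: the boundary terms are \<open>Omega\<close>
  of the boundary vector with itself and vanish, so (cnj \<mu> - \<mu>) times the integral of |x|^2
  is 0.\<close>

lemma eigenspace_nonreal: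
  assumes iso: "\<And>v. v \<in> \<Lambda> \<Longrightarrow> Omega v v = 0" and \<mu>: "Im \<mu> \<noteq> 0"
    and x: "x \<in> eigenspace T P Q R \<Lambda> \<mu>"
  shows "x = 0"
proof -
  let ?y = "quasi_deriv T P Q x"
  note s = eigenspace_sol[OF x]
  have "(zvec T P Q x 0, zvec T P Q x T) \<in> \<Lambda>"
    using x unfolding eigenspace_def SL_dom_def by blast
  from iso[OF this] have bd: "(?y T * cnj (x T) - x T * cnj (?y T)) - (?y 0 * cnj (x 0) - x 0 * cnj (?y 0)) = 0"
    by (simp add: Omega_eq zvec_def algebra_simps)
  have "((\<lambda>t. (cnj \<mu> - \<mu>) * (x t * cnj (x t))) has_integral 0) {0..T}"
    using lagrange_integral[OF s sol_cnj[OF s] T_mem(1)] unfolding bd .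
  from has_integral_mult_right[OF this, of "1 / (cnj \<mu> - \<mu>)"]
  have "((\<lambda>t. x t * cnj (x t)) has_integral 0) {0..T}"
    using \<mu> by (simp add: complex_eq_iff)
  then have "((\<lambda>t. Re (x t * cnj (x t))) has_integral Re 0) {0..T}"
    using has_integral_linear[OF _ bounded_linear_Re, unfolded o_def] by blast
  then have int: "integral {0..T} (\<lambda>t. (cmod (x t))\<^sup>2) = 0"
  proof -
    have "Re (x t * cnj (x t)) = (cmod (x t))\<^sup>2" for t
      unfolding cmod_power2 by (simp add: power2_eq_square)
    then show ?thesis
      using integral_unique[OF \<open>((\<lambda>t. Re (x t * cnj (x t))) has_integral Re 0) {0..T}\<close>] by simp
  qed
  have "x t = 0" for t
  proof (cases "t \<in> {0..T}")
    case True
    have "continuous_on {0..T} (\<lambda>t. (cmod (x t))\<^sup>2)"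
      by (intro continuous_intros sol_continuous[OF s])
    then show ?thesis
      using integral_eq_0_iff[of 0 T "\<lambda>t. (cmod (x t))\<^sup>2"] T int True by simp
  next
    case False
    then show ?thesis
      using x unfolding eigenspace_def SL_dom_def by blast
  qed
  then show ?thesis
    by (simp add: fun_eq_iff)
qed

text \<open>z is indexed from 0, eigenvalues from 1. An enumeration has to match the multiplicities
  of all complex \<mu>, so trivial eigenspaces at non-real \<mu> are part of the claim.\<close>

lemma eigenvalue_enumerationI:
  fixes z :: "nat \<Rightarrow> real"
  assumes Lag: "\<Lambda> \<in> Lag" and mono: "mono z"
    and count: "\<And>\<mu>. finite {k. z k = \<mu>} \<and> card {k. z k = \<mu>} = geom_mult \<Lambda> \<mu>"
  shows "eigenvalue_enumeration T P Q R \<Lambda> (\<lambda>j. z (j - 1))"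
  unfolding eigenvalue_enumeration_def
proof (intro conjI allI)
  show "mono_on {1..} (\<lambda>j. z (j - 1))"
    by (rule mono_onI) (simp add: monoD[OF mono] diff_le_mono)
  fix \<mu> :: complex
  have "finite {j. j \<ge> 1 \<and> of_real (z (j - 1)) = \<mu>} \<and>
      card {j. j \<ge> 1 \<and> of_real (z (j - 1)) = \<mu>} = fvec.dim (eigenspace T P Q R \<Lambda> \<mu>)"
  proof (cases "Im \<mu> = 0")
    case True
    then have \<mu>: "\<mu> = of_real (Re \<mu>)"
      by (simp add: complex_eq_iff)
    have "{j. j \<ge> 1 \<and> z (j - 1) = Re \<mu>} = Suc ` {k. z k = Re \<mu>}"
    proof (intro equalityI subsetI)
      fix j assume "j \<in> {j. j \<ge> 1 \<and> z (j - 1) = Re \<mu>}"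
      then show "j \<in> Suc ` {k. z k = Re \<mu>}"
        by (intro image_eqI[of _ _ "j - 1"]) auto
    qed auto
    then have eq: "{j. j \<ge> 1 \<and> of_real (z (j - 1)) = \<mu>} = Suc ` {k. z k = Re \<mu>}"
      by (subst \<mu>) (simp only: of_real_eq_iff)
    have "fvec.dim (eigenspace T P Q R \<Lambda> \<mu>) = geom_mult \<Lambda> (Re \<mu>)"
      by (subst \<mu>) (rule dim_eigenspace[OF LagD(1)[OF Lag]])
    then show ?thesis
      unfolding eq using count[of "Re \<mu>"] by (simp add: card_image)
  next
    case False
    then have "of_real (z (j - 1)) \<noteq> \<mu>" for j
      by auto
    then have "{j. j \<ge> 1 \<and> of_real (z (j - 1)) = \<mu>} = {}"
      by blast
    moreover have "0 \<in> eigenspace T P Q R \<Lambda> \<mu>"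
    proof -
      have "efun 0 0 0 = (\<lambda>t. 0)"
        by (simp add: fun_eq_iff efun_def)
      then have q: "quasi_deriv T P Q (\<lambda>t. 0) t = 0" and d: "dot T (\<lambda>t. 0) t = 0" if "t \<in> {0..T}" for t
        using efun_quasi_deriv(1,2)[OF that, of 0 0 0] by simp_all
      have w: "has_weak_deriv T f (\<lambda>t. 0)" if "\<And>t. t \<in> {0..T} \<Longrightarrow> f t = 0" for f :: "real \<Rightarrow> complex"
        using that T by (simp add: has_weak_deriv_def)
      have "zvec T P Q (\<lambda>t. 0) s = 0" if "s \<in> {0..T}" for s
        unfolding zvec_def using q[OF that] by (simp add: vec_eq_iff forall_2)
      then have "(zvec T P Q (\<lambda>t. 0) 0, zvec T P Q (\<lambda>t. 0) T) \<in> \<Lambda>"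
        using bvec.subspace_0[OF LagD(1)[OF Lag]] T_mem by (simp add: zero_prod_def)
      moreover have "H2 T (\<lambda>t. 0 :: complex)"
        unfolding H2_def H1_def using w[of "\<lambda>t. 0"] by blast
      moreover have "SL_maps T P Q R (\<lambda>t. 0) (\<lambda>t. \<mu> * 0)"
        unfolding SL_maps_def
      proof (intro exI conjI)
        show "has_weak_deriv T (quasi_deriv T P Q (\<lambda>t. 0)) (\<lambda>t. 0)"
          by (rule w) (rule q)
        show "AE t in lebesgue_on {0..T}. - 0 + of_real (Q t) * dot T (\<lambda>t. 0) t + of_real (R t) * 0 = \<mu> * 0"
          by (rule AE_I2) (simp add: d space_restrict_space)
      qed
      ultimately have "(\<lambda>t. 0) \<in> eigenspace T P Q R \<Lambda> \<mu>"
        unfolding eigenspace_def SL_dom_def by simp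
      then show ?thesis
        by (simp add: zero_fun_def)
    qed
    then have "eigenspace T P Q R \<Lambda> \<mu> = {0}"
      using eigenspace_nonreal[OF LagD(3)[OF Lag] False] by blast
    ultimately show ?thesis
      by (simp only: finite.emptyI card.empty fvec.dim_zero)
  qed
  then show "finite {j. j \<ge> 1 \<and> of_real (z (j - 1)) = \<mu>}"
    "card {j. j \<ge> 1 \<and> of_real (z (j - 1)) = \<mu>} = fvec.dim (eigenspace T P Q R \<Lambda> \<mu>)"
    by blast+
qed

lemma eigval_Dirichlet:
  assumes "j \<ge> 1"
  shows "eigval T P Q R j Lambda_D = dn (j - 1)"
proof (rule eigval_eq[OF eigenvalue_enumerationI assms])
  show "Lambda_D \<in> Lag"
    using layer2_eq by (auto simp: layer_def)
  show "mono dn"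
    using dn(1) by (rule strict_mono_mono)
  fix \<mu>
  have bv: "bv \<mu> \<alpha> \<beta> \<in> Lambda_D \<longleftrightarrow> \<beta> = 0 \<and> of_real (m21 \<mu>) * \<alpha> = 0" for \<alpha> \<beta>
    by (auto simp: Lambda_D_iff)
  have "\<not> (\<forall>\<alpha> \<beta>. bv \<mu> \<alpha> \<beta> \<in> Lambda_D)"
    unfolding bv by (auto intro: exI[of _ 1])
  moreover have "(\<forall>\<alpha> \<beta>. bv \<mu> \<alpha> \<beta> \<in> Lambda_D \<longrightarrow> \<alpha> = 0 \<and> \<beta> = 0) \<longleftrightarrow> m21 \<mu> \<noteq> 0"
    unfolding bv by (auto dest: spec[of _ 1])
  ultimately have geom_mult: "geom_mult Lambda_D \<mu> = (if m21 \<mu> = 0 then 1 else 0)"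
    by (simp add: geom_mult_def)
  show "finite {k. dn k = \<mu>} \<and> card {k. dn k = \<mu>} = geom_mult Lambda_D \<mu>"
  proof (cases "m21 \<mu> = 0")
    case True
    then obtain k where "\<mu> = dn k"
      by (auto simp: m21_eq_0_iff)
    then have "{k. dn k = \<mu>} = {k}"
      by auto
    then show ?thesis
      using True by (simp add: geom_mult)
  next
    case False
    then have "{k. dn k = \<mu>} = {}"
      by auto
    then show ?thesis
      using False by (simp add: geom_mult)
  qed
qed

end

section \<open>Conditions transversal to the Dirichlet condition\<close>

text \<open>\<open>hmin\<close> and \<open>hmax\<close> are the eigenvalues of the Hermitian matrix
  [[p, q], [cnj q, r]]. Half the square root of the discriminant is written as the norm of a pair,
  which makes the triangle inequality available.\<close>

definition hmin :: "real \<Rightarrow> real \<Rightarrow> complex \<Rightarrow> real" where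
  "hmin p r q = (p + r) / 2 - norm ((p - r) / 2, q)"

definition hmax :: "real \<Rightarrow> real \<Rightarrow> complex \<Rightarrow> real" where
  "hmax p r q = (p + r) / 2 + norm ((p - r) / 2, q)"

lemma hmin_le_hmax: "hmin p r q \<le> hmax p r q"
  using norm_ge_zero[of "((p - r) / 2, q)"] unfolding hmin_def hmax_def by linarith

lemma hmin_shift: "hmin (c + p) (c + r) q = c + hmin p r q"
  by (simp add: hmin_def add_divide_distrib)

lemma norm_real_pair: "norm (a :: real, q :: 'a::real_normed_vector) = sqrt (a\<^sup>2 + (norm q)\<^sup>2)"
  by (simp add: norm_Pair)

lemma norm_disc: "(norm ((p - r) / 2, q :: complex))\<^sup>2 = ((p + r) / 2)\<^sup>2 - (p * r - (norm q)\<^sup>2)" for p r :: real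
proof -
  have "(norm ((p - r) / 2, q))\<^sup>2 = ((p - r) / 2)\<^sup>2 + (norm q)\<^sup>2"
    unfolding norm_real_pair by (rule real_sqrt_pow2) simp
  then show ?thesis
    by (simp add: power2_eq_square field_simps)
qed

lemma hmin_times_hmax: "hmin p r q * hmax p r q = p * r - (norm q)\<^sup>2"
proof -
  have "hmin p r q * hmax p r q = ((p + r) / 2)\<^sup>2 - (norm ((p - r) / 2, q))\<^sup>2"
    unfolding hmin_def hmax_def power2_eq_square by (simp only: algebra_simps)
  then show ?thesis
    unfolding norm_disc by simp
qed

lemma hmin_hmax_zero_iff: "hmin p r q = 0 \<and> hmax p r q = 0 \<longleftrightarrow> p = 0 \<and> r = 0 \<and> q = 0"
proof
  assume "hmin p r q = 0 \<and> hmax p r q = 0"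
  then have h: "(p + r) / 2 - norm ((p - r) / 2, q) = 0" "(p + r) / 2 + norm ((p - r) / 2, q) = 0"
    unfolding hmin_def hmax_def by auto
  define N where "N = norm ((p - r) / 2, q)"
  have "p + r = 0"
    using h unfolding N_def[symmetric] by simp
  moreover have "norm ((p - r) / 2, q) = 0"
    using h unfolding N_def[symmetric] by simp
  then have "(p - r) / 2 = 0 \<and> q = 0"
    by (simp only: norm_eq_zero zero_prod_def prod.inject)
  ultimately show "p = 0 \<and> r = 0 \<and> q = 0"
    by auto
qed (simp add: hmin_def hmax_def zero_prod_def[symmetric])

text \<open>Sylvester's criterion; the test vector (- q, p) gives p (p r - q^2).\<close>

lemma positive_form:
  fixes p q r :: real
  assumes "\<And>u v. u \<noteq> 0 \<or> v \<noteq> 0 \<Longrightarrow> p * u\<^sup>2 + 2 * q * (u * v) + r * v\<^sup>2 > 0"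
  shows "p > 0" "p * r > q\<^sup>2"
proof -
  show p: "p > 0"
    using assms[of 1 0] by simp
  have "p * (- q)\<^sup>2 + 2 * q * (- q * p) + r * p\<^sup>2 > 0"
    using p by (intro assms) simp
  moreover have "p * (- q)\<^sup>2 + 2 * q * (- q * p) + r * p\<^sup>2 = p * (p * r - q\<^sup>2)"
    by (simp add: power2_eq_square algebra_simps)
  ultimately show "p * r > q\<^sup>2"
    using p by (simp add: zero_less_mult_iff)
qed

text \<open>Adding a positive definite real matrix raises the half trace by (p' + r') / 2. Its
  positive determinant says that this exceeds the norm of its traceless part, so by the triangle
  inequality both eigenvalues increase.\<close>

lemma hmin_hmax_strict_mono:
  fixes p r p' r' q' :: real
  assumes "p' > 0" "p' * r' > q'\<^sup>2"
  shows "hmin p r q < hmin (p + p') (r + r') (q + of_real q')"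
    and "hmax p r q < hmax (p + p') (r + r') (q + of_real q')"
proof -
  have "p' * r' > 0"
    using assms(2) zero_le_power2[of q'] by linarith
  then have r': "r' > 0"
    using assms(1) by (simp add: zero_less_mult_iff)
  let ?d = "((p' - r') / 2, of_real q' :: complex)"
  have "norm ?d = sqrt (((p' - r') / 2)\<^sup>2 + q'\<^sup>2)"
    unfolding norm_real_pair by simp
  also have "\<dots> < (p' + r') / 2"
  proof (rule real_less_lsqrt)
    show "((p' - r') / 2)\<^sup>2 + q'\<^sup>2 < ((p' + r') / 2)\<^sup>2"
      using assms(2) by (simp add: power2_eq_square field_simps)
  qed (use assms(1) r' in auto)
  finally have d: "norm ?d < (p' + r') / 2" .
  define X where "X = ((p - r) / 2, q)"
  define Y where "Y = ((p + p' - (r + r')) / 2, q + of_real q')"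
  have "Y = X + ?d"
    by (simp add: X_def Y_def field_simps)
  then have "norm Y \<le> norm X + norm ?d" "norm X \<le> norm Y + norm ?d"
    using norm_triangle_ineq[of X ?d] norm_triangle_ineq4[of Y ?d] by simp_all
  then show "hmin p r q < hmin (p + p') (r + r') (q + of_real q')"
    "hmax p r q < hmax (p + p') (r + r') (q + of_real q')"
    using d unfolding hmin_def hmax_def X_def[symmetric] Y_def[symmetric] by (simp_all add: field_simps)
qed

text \<open>Continuity carries monotonicity across d; an intermediate point c on either side keeps
  the limiting inequality strict.\<close>

lemma strict_decreasing_glue:
  fixes f :: "real \<Rightarrow> real"
  assumes cont: "isCont f d"
    and left: "\<And>a b. a \<in> window \<Longrightarrow> a < b \<Longrightarrow> b < d \<Longrightarrow> b \<in> window \<and> f b < f a"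
    and right: "\<And>a b. b \<in> window \<Longrightarrow> d < a \<Longrightarrow> a < b \<Longrightarrow> a \<in> window \<and> f b < f a"
    and ab: "a \<in> window" "b \<in> window" "a < b"
  shows "f b < f a"
proof -
  have l: "f d < f a" if a: "a \<in> window" "a < d" for a
  proof -
    obtain c where c: "a < c" "c < d"
      using dense[OF a(2)] by blast
    have "\<forall>\<^sub>F x in at_left d. f x \<le> f c"
      unfolding eventually_at_left_field using left[OF a(1) c] left[of c] c by (intro exI[of _ c]) force
    then have "f d \<le> f c"
      using cont by (intro tendsto_upperbound[of f "f d" "at_left d"])
        (auto simp: isCont_def intro: filterlim_mono[OF _ order_refl at_le])
    then show ?thesis
      using left[OF a(1) c] by simp
  qed
  have r: "f b < f d" if b: "b \<in> window" "d < b" for b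
  proof -
    obtain c where c: "d < c" "c < b"
      using dense[OF b(2)] by blast
    have "\<forall>\<^sub>F x in at_right d. f c \<le> f x"
      unfolding eventually_at_right_field using right[OF b(1) c] right[of c] c by (intro exI[of _ c]) force
    then have "f c \<le> f d"
      using cont by (intro tendsto_lowerbound[of f "f d" "at_right d"])
        (auto simp: isCont_def intro: filterlim_mono[OF _ order_refl at_le])
    then show ?thesis
      using right[OF b(1) c] by simp
  qed
  consider "b < d" | "b = d" | "a < d" "d < b" | "a = d" | "d < a"
    using ab(3) by linarith
  then show ?thesis
  proof cases
    case 1
    then show ?thesis
      using left[OF ab(1,3)] by blast
  next
    case 2
    then show ?thesis
      using l[OF ab(1)] ab(3) by simp
  next
    case 3
    then show ?thesis
      using l[OF ab(1)] r[OF ab(2)] by simp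
  next
    case 4
    then show ?thesis
      using r[OF ab(2)] ab(3) by simp
  next
    case 5
    then show ?thesis
      using right[OF ab(2) 5 ab(3)] by blast
  qed
qed

context sturm_liouville
begin

text \<open>Two neighbouring gaps and the pole between them, the expected range of the eigenvalue
  number k + 1 over the layer of graphs. It is unbounded below for k <= 1 and reduces to
  \<open>gap 0\<close> for k = 0.\<close>

definition window :: "nat \<Rightarrow> real set" where
  "window k = {\<mu>. (k \<ge> 2 \<longrightarrow> dn (k - 2) < \<mu>) \<and> \<mu> < dn k}"

lemma window_0: "window 0 = gap 0"
  by (auto simp: window_def gap_def)

lemma window_Suc: "\<mu> \<in> window (Suc i) \<longleftrightarrow> \<mu> \<in> gap i \<or> \<mu> = dn i \<or> \<mu> \<in> gap (Suc i)"
proof (cases i)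
  case 0
  have "dn 0 < dn (Suc 0)"
    by simp
  then show ?thesis
    using 0 by (auto simp: window_def gap_def simp del: dn_less_iff)
next
  case (Suc n)
  have "dn n < dn (Suc n)" "dn (Suc n) < dn (Suc (Suc n))"
    by simp_all
  then show ?thesis
    unfolding Suc by (auto simp: window_def gap_def simp del: dn_less_iff)
qed

lemma window_between: "a \<in> window k \<Longrightarrow> b \<in> window k \<Longrightarrow> a \<le> x \<Longrightarrow> x \<le> b \<Longrightarrow> x \<in> window k"
  by (auto simp: window_def)

lemma gap_subset_window: "\<mu> \<in> gap k \<Longrightarrow> \<mu> \<in> window k" "\<mu> \<in> gap k \<Longrightarrow> \<mu> \<in> window (Suc k)"
  by (cases k; simp add: window_0 window_Suc)+

end

locale graph_condition = sturm_liouville +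
  fixes h11 h22 :: real and h12 :: complex
begin

text \<open>\<open>e11\<close>, \<open>e22\<close> and \<open>e12\<close> are the entries of N - H;
  \<open>th1\<close> and \<open>th2\<close> are its eigenvalues.\<close>

definition e11 :: "real \<Rightarrow> real" where "e11 \<mu> = m22 \<mu> / m21 \<mu> - h11"
definition e22 :: "real \<Rightarrow> real" where "e22 \<mu> = m11 \<mu> / m21 \<mu> - h22"
definition e12 :: "real \<Rightarrow> complex" where "e12 \<mu> = of_real (- 1 / m21 \<mu>) - h12"
definition th1 :: "real \<Rightarrow> real" where "th1 \<mu> = hmin (e11 \<mu>) (e22 \<mu>) (e12 \<mu>)"
definition th2 :: "real \<Rightarrow> real" where "th2 \<mu> = hmax (e11 \<mu>) (e22 \<mu>) (e12 \<mu>)"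

text \<open>Comparison with a real symmetric matrix [[a, c], [c, b]] below N: in the difference the
  complex H cancels and a real positive definite matrix remains. It is applied to N at a larger
  parameter and to a multiple of the identity.\<close>

lemma th_less:
  assumes c: "\<And>u v. u \<noteq> 0 \<or> v \<noteq> 0 \<Longrightarrow>
    a * u\<^sup>2 + 2 * c * (u * v) + b * v\<^sup>2 < qf \<mu> u v"
  shows "hmin (a - h11) (b - h22) (of_real c - h12) < th1 \<mu>"
    "hmax (a - h11) (b - h22) (of_real c - h12) < th2 \<mu>"
proof -
  define p' where "p' = m22 \<mu> / m21 \<mu> - a"
  define r' where "r' = m11 \<mu> / m21 \<mu> - b"
  define q' where "q' = - 1 / m21 \<mu> - c"
  have "p' * u\<^sup>2 + 2 * q' * (u * v) + r' * v\<^sup>2 > 0" if "u \<noteq> 0 \<or> v \<noteq> 0" for u v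
  proof -
    have "p' * u\<^sup>2 + 2 * q' * (u * v) + r' * v\<^sup>2 = qf \<mu> u v - (a * u\<^sup>2 + 2 * c * (u * v) + b * v\<^sup>2)"
      by (simp add: p'_def q'_def r'_def qf_def add_divide_distrib diff_divide_distrib algebra_simps)
    then show ?thesis
      using c[OF that] by simp
  qed
  note pos = positive_form[OF this]
  have eqs: "a - h11 + p' = e11 \<mu>" "b - h22 + r' = e22 \<mu>" "of_real c - h12 + of_real q' = e12 \<mu>"
    by (simp_all add: p'_def r'_def q'_def e11_def e22_def e12_def)
  show "hmin (a - h11) (b - h22) (of_real c - h12) < th1 \<mu>"
    "hmax (a - h11) (b - h22) (of_real c - h12) < th2 \<mu>"
    using hmin_hmax_strict_mono[OF pos, of "a - h11" "b - h22" "of_real c - h12"]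
    unfolding eqs th1_def th2_def by simp_all
qed

lemma th_strict:
  assumes "\<mu> < \<nu>" "\<And>\<kappa>. \<mu> \<le> \<kappa> \<Longrightarrow> \<kappa> \<le> \<nu> \<Longrightarrow> m21 \<kappa> \<noteq> 0"
  shows "th1 \<nu> < th1 \<mu>" "th2 \<nu> < th2 \<mu>"
proof -
  have "m22 \<nu> / m21 \<nu> * u\<^sup>2 + 2 * (- 1 / m21 \<nu>) * (u * v) + m11 \<nu> / m21 \<nu> * v\<^sup>2 < qf \<mu> u v"
    if "u \<noteq> 0 \<or> v \<noteq> 0" for u v
    using qf_strict_decreasing[OF assms that]
    by (simp add: qf_def add_divide_distrib diff_divide_distrib)
  from th_less[OF this] show "th1 \<nu> < th1 \<mu>" "th2 \<nu> < th2 \<mu>"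
    unfolding th1_def[of \<nu>] th2_def[of \<nu>] e11_def e22_def e12_def by simp_all
qed

lemma th_strict_gap:
  assumes "\<mu> \<in> gap k" "\<nu> \<in> gap k" "\<mu> < \<nu>"
  shows "th1 \<nu> < th1 \<mu>" "th2 \<nu> < th2 \<mu>"
  using th_strict[OF assms(3)] m21_gap gap_between[OF assms(1,2)] by blast+

lemma th1_le_th2: "th1 \<mu> \<le> th2 \<mu>"
  unfolding th1_def th2_def by (rule hmin_le_hmax)

lemma th_positive: "\<exists>K. \<forall>\<mu>\<le>K. th1 \<mu> > 0"
proof -
  \<comment> \<open>This makes the smaller eigenvalue of L I - H equal to 0, so that N above L I
    forces \<open>th1\<close> to be positive.\<close>
  define L where "L = - hmin (- h11) (- h22) (- h12)"
  obtain K where K: "\<And>\<mu>. \<mu> \<le> K \<Longrightarrow> (\<forall>u v. qf \<mu> u v \<ge> (L + 1) * (u\<^sup>2 + v\<^sup>2))"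
    using qf_bounded_below[of "L + 1"] by blast
  have "th1 \<mu> > 0" if "\<mu> \<le> K" for \<mu>
  proof -
    have "L * u\<^sup>2 + 2 * 0 * (u * v) + L * v\<^sup>2 < qf \<mu> u v" if "u \<noteq> 0 \<or> v \<noteq> 0" for u v
    proof -
      have "u\<^sup>2 + v\<^sup>2 > 0"
        using that by (simp add: sum_power2_gt_zero_iff)
      moreover have "(L + 1) * (u\<^sup>2 + v\<^sup>2) \<le> qf \<mu> u v"
        using K \<open>\<mu> \<le> K\<close> by blast
      ultimately show ?thesis
        by (simp add: algebra_simps)
    qed
    from th_less(1)[OF this] have "hmin (L + - h11) (L + - h22) (- h12) < th1 \<mu>"
      by simp
    then show ?thesis
      unfolding hmin_shift by (simp add: L_def)
  qed
  then show ?thesis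
    by blast
qed

lemma m_isCont: "isCont m11 \<mu>" "isCont m12 \<mu>" "isCont m21 \<mu>" "isCont m22 \<mu>"
  using m_cont[of UNIV] by (simp_all add: continuous_on_eq_continuous_at)

lemma th_isCont:
  assumes "m21 \<mu> \<noteq> 0"
  shows "isCont th1 \<mu>" "isCont th2 \<mu>"
  unfolding th1_def th2_def hmin_def hmax_def e11_def e22_def e12_def
  by (intro continuous_intros m_isCont assms; simp)+

text \<open>\<open>tau\<close> / \<open>m21\<close> and \<open>Del\<close> / \<open>m21\<close> are
  the trace and the determinant of N - H, and \<open>sd\<close> is the square root of its
  discriminant times |m21|. All three are continuous across the Dirichlet eigenvalues.\<close>

definition tau :: "real \<Rightarrow> real" where
  "tau \<mu> = m11 \<mu> + m22 \<mu> - (h11 + h22) * m21 \<mu>"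

definition Del :: "real \<Rightarrow> real" where
  "Del \<mu> = m12 \<mu> - h11 * m11 \<mu> - h22 * m22 \<mu> + (h11 * h22 - (norm h12)\<^sup>2) * m21 \<mu> - 2 * Re h12"

definition sd :: "real \<Rightarrow> real" where
  "sd \<mu> = sqrt ((tau \<mu>)\<^sup>2 - 4 * m21 \<mu> * Del \<mu>)"

text \<open>Products of entries produce 1 / m21^2, which m11 m22 = 1 + m21 m12 cancels; the
  determinant keeps a simple pole, as befits a pole of rank one.\<close>

lemma trace_det:
  assumes "m21 \<mu> \<noteq> 0"
  shows "e11 \<mu> + e22 \<mu> = tau \<mu> / m21 \<mu>" "e11 \<mu> * e22 \<mu> - (norm (e12 \<mu>))\<^sup>2 = Del \<mu> / m21 \<mu>"
proof -
  define c where "c = m21 \<mu>"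
  have c: "c \<noteq> 0"
    using assms by (simp add: c_def)
  show "e11 \<mu> + e22 \<mu> = tau \<mu> / m21 \<mu>"
    using assms by (simp add: e11_def e22_def tau_def field_simps)
  have "(norm (e12 \<mu>))\<^sup>2 = (1 / c)\<^sup>2 + 2 * Re h12 / c + (norm h12)\<^sup>2"
    unfolding cmod_power2 e12_def c_def[symmetric] by (simp add: power2_eq_square algebra_simps)
  moreover have "e11 \<mu> * e22 \<mu> = (m11 \<mu> * m22 \<mu>) / c\<^sup>2 - h22 * (m22 \<mu> / c) - h11 * (m11 \<mu> / c) + h11 * h22"
    unfolding e11_def e22_def c_def[symmetric] by (simp add: power2_eq_square algebra_simps)
  moreover have "(m11 \<mu> * m22 \<mu>) / c\<^sup>2 = (1 / c)\<^sup>2 + m12 \<mu> / c"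
  proof -
    have "m11 \<mu> * m22 \<mu> = 1 + c * m12 \<mu>"
      using det_m[of \<mu>] by (simp add: c_def)
    then show ?thesis
      using c by (simp add: power2_eq_square add_divide_distrib)
  qed
  ultimately have "e11 \<mu> * e22 \<mu> - (norm (e12 \<mu>))\<^sup>2
      = m12 \<mu> / c - h22 * (m22 \<mu> / c) - h11 * (m11 \<mu> / c) + (h11 * h22 - (norm h12)\<^sup>2) - 2 * Re h12 / c"
    by simp
  also have "\<dots> = Del \<mu> / c"
    using c by (simp add: Del_def c_def[symmetric] add_divide_distrib diff_divide_distrib)
  finally show "e11 \<mu> * e22 \<mu> - (norm (e12 \<mu>))\<^sup>2 = Del \<mu> / m21 \<mu>"
    by (simp add: c_def)
qed

lemma th_formula:
  assumes "m21 \<mu> \<noteq> 0"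
  shows "th1 \<mu> = tau \<mu> / (2 * m21 \<mu>) - sd \<mu> / (2 * \<bar>m21 \<mu>\<bar>)"
    and "th2 \<mu> = tau \<mu> / (2 * m21 \<mu>) + sd \<mu> / (2 * \<bar>m21 \<mu>\<bar>)"
    and "(sd \<mu>)\<^sup>2 = (tau \<mu>)\<^sup>2 - 4 * m21 \<mu> * Del \<mu>"
proof -
  define c where "c = m21 \<mu>"
  have c: "c \<noteq> 0"
    using assms by (simp add: c_def)
  define N where "N = norm ((e11 \<mu> - e22 \<mu>) / 2, e12 \<mu>)"
  have "N\<^sup>2 = ((e11 \<mu> + e22 \<mu>) / 2)\<^sup>2 - (e11 \<mu> * e22 \<mu> - (norm (e12 \<mu>))\<^sup>2)"
    unfolding N_def by (rule norm_disc)
  then have "N\<^sup>2 = (tau \<mu> / c / 2)\<^sup>2 - Del \<mu> / c"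
    unfolding trace_det[OF assms] c_def .
  then have sq: "(2 * \<bar>c\<bar> * N)\<^sup>2 = (tau \<mu>)\<^sup>2 - 4 * c * Del \<mu>"
    using c by (simp add: power_mult_distrib field_simps power2_eq_square)
  have "N \<ge> 0"
    by (simp add: N_def)
  then have sd: "sd \<mu> = 2 * \<bar>c\<bar> * N"
    unfolding sd_def c_def[symmetric] sq[symmetric] by (simp add: abs_mult)
  then show "(sd \<mu>)\<^sup>2 = (tau \<mu>)\<^sup>2 - 4 * m21 \<mu> * Del \<mu>"
    using sq by (simp add: c_def)
  have "N = sd \<mu> / (2 * \<bar>c\<bar>)"
    using sd c by simp
  then show "th1 \<mu> = tau \<mu> / (2 * m21 \<mu>) - sd \<mu> / (2 * \<bar>m21 \<mu>\<bar>)"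
    "th2 \<mu> = tau \<mu> / (2 * m21 \<mu>) + sd \<mu> / (2 * \<bar>m21 \<mu>\<bar>)"
    unfolding th1_def th2_def hmin_def hmax_def N_def[symmetric] trace_det(1)[OF assms] c_def
    by simp_all
qed

text \<open>At a zero \<open>d\<close> of \<open>m21\<close> one of the two roots of \<open>m21 \<theta>\<^sup>2 - tau \<theta> + Del\<close> escapes to
  infinity; the other one is \<open>F\<close>, which is \<open>th2\<close> to the left and \<open>th1\<close> to the right of \<open>d\<close>.\<close>

lemma th_near_dn:
  assumes d: "m21 d = 0"
  shows "\<exists>F e. e > 0 \<and> isCont F d \<and> F d = Del d / tau d \<and> tau d \<noteq> 0 \<and>
    (\<forall>\<mu>. \<bar>\<mu> - d\<bar> < e \<longrightarrow> (\<mu> < d \<longrightarrow> th1 \<mu> < 0 \<and> th2 \<mu> = F \<mu>) \<and> (d < \<mu> \<longrightarrow> th2 \<mu> > 0 \<and> th1 \<mu> = F \<mu>))"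
proof -
  \<comment> \<open>Since m11 d * m22 d = 1 and m21 d = 0, the numbers m11 d, m22 d and tau d all
    have this sign.\<close>
  define \<sigma> where "\<sigma> = sgn (m11 d)"
  have det: "m11 d * m22 d = 1"
    using det_m[of d] d by simp
  then have "m11 d \<noteq> 0"
    by auto
  then have \<sigma>2: "\<sigma> * \<sigma> = 1"
    by (simp add: \<sigma>_def sgn_if)
  have \<sigma>m: "\<sigma> * m11 d > 0"
    using \<open>m11 d \<noteq> 0\<close> by (simp add: \<sigma>_def sgn_if)
  have "(\<sigma> * m11 d) * (\<sigma> * m22 d) = (\<sigma> * \<sigma>) * (m11 d * m22 d)"
    by (simp add: algebra_simps)
  then have "(\<sigma> * m11 d) * (\<sigma> * m22 d) > 0"
    by (simp add: \<sigma>2 det)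
  then have "\<sigma> * m22 d > 0"
    using \<sigma>m by (simp add: zero_less_mult_iff)
  then have \<sigma>tau: "\<sigma> * tau d > 0"
    using \<sigma>m d by (simp add: tau_def algebra_simps)
  \<comment> \<open>The bounded root in rationalised form: \<plusminus> (sd - \<sigma> tau) / (2
    |m21|) is multiplied out with sd + \<sigma> tau, and m21 cancels. At d the new denominator is 2
    |tau d|, which is not 0.\<close>
  define F where "F \<mu> = 2 * \<sigma> * Del \<mu> / (sd \<mu> + \<sigma> * tau \<mu>)" for \<mu>
  have tau_cont: "isCont tau \<mu>" for \<mu>
    unfolding tau_def by (intro continuous_intros m_isCont)
  have Del_cont: "isCont Del \<mu>" for \<mu>
    unfolding Del_def by (intro continuous_intros m_isCont)
  have sd_cont: "isCont sd \<mu>" for \<mu>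
    unfolding sd_def by (intro continuous_intros m_isCont tau_cont Del_cont)
  have sdd: "sd d = \<bar>tau d\<bar>"
    by (simp add: sd_def d)
  have abs_tau: "\<bar>tau d\<bar> = \<sigma> * tau d"
  proof -
    have "\<bar>\<sigma> * tau d\<bar> = \<bar>\<sigma>\<bar> * \<bar>tau d\<bar>"
      by (rule abs_mult)
    moreover have "\<bar>\<sigma>\<bar> = 1"
      using \<open>m11 d \<noteq> 0\<close> by (simp add: \<sigma>_def sgn_if)
    ultimately show ?thesis
      using \<sigma>tau by simp
  qed
  have Fc: "isCont F d"
    unfolding F_def using \<sigma>tau sdd by (intro continuous_intros tau_cont Del_cont sd_cont) auto
  have tau0: "tau d \<noteq> 0" and \<sigma>0: "\<sigma> \<noteq> 0"
    using \<sigma>tau by auto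
  have Fd: "F d = Del d / tau d"
    unfolding F_def sdd abs_tau using tau0 \<sigma>0 by (simp add: field_simps)
  have "isCont (\<lambda>\<mu>. \<sigma> * tau \<mu>) d"
    by (intro continuous_intros tau_cont)
  then have "\<forall>\<^sub>F \<mu> in at d. \<sigma> * tau \<mu> > 0"
    unfolding isCont_def using \<sigma>tau by (rule order_tendstoD)
  then obtain e1 where e1: "e1 > 0" "\<And>\<mu>. \<mu> \<noteq> d \<Longrightarrow> dist \<mu> d < e1 \<Longrightarrow> \<sigma> * tau \<mu> > 0"
    unfolding eventually_at by auto
  obtain e2 where e2: "e2 > 0" "\<And>\<mu>. \<bar>\<mu> - d\<bar> < e2 \<Longrightarrow> \<mu> \<noteq> d \<Longrightarrow> (\<mu> - d) * (m21 \<mu> * m11 d) > 0"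
    using m21_local_sign[OF d] by blast
  have "(\<mu> < d \<longrightarrow> th1 \<mu> < 0 \<and> th2 \<mu> = F \<mu>) \<and> (d < \<mu> \<longrightarrow> th2 \<mu> > 0 \<and> th1 \<mu> = F \<mu>)"
    if \<mu>: "\<bar>\<mu> - d\<bar> < min e1 e2" for \<mu>
  proof (cases "\<mu> = d")
    case False
    have st: "\<sigma> * tau \<mu> > 0"
      using e1(2)[OF False] \<mu> by (simp add: dist_real_def)
    have sgn: "(\<mu> - d) * (m21 \<mu> * m11 d) > 0"
      using e2(2)[of \<mu>] \<mu> False by simp
    then have c0: "m21 \<mu> \<noteq> 0"
      by auto
    define M where "M = \<bar>m21 \<mu>\<bar>"
    have M: "M > 0"
      using c0 by (simp add: M_def)
    have s: "sd \<mu> \<ge> 0"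
      unfolding sd_def using th_formula(3)[OF c0] by (metis real_sqrt_ge_zero zero_le_power2)
    have den: "sd \<mu> + \<sigma> * tau \<mu> > 0"
      using s st by simp
    have prod: "(sd \<mu> - \<sigma> * tau \<mu>) * (sd \<mu> + \<sigma> * tau \<mu>) = - (4 * m21 \<mu> * Del \<mu>)"
    proof -
      have "(sd \<mu> - \<sigma> * tau \<mu>) * (sd \<mu> + \<sigma> * tau \<mu>) = (sd \<mu>)\<^sup>2 - (\<sigma> * \<sigma>) * (tau \<mu>)\<^sup>2"
        by (simp add: algebra_simps power2_eq_square)
      then show ?thesis
        unfolding \<sigma>2 th_formula(3)[OF c0] by simp
    qed
    show ?thesis
    proof (cases "\<mu> < d")
      case True
      then have "m21 \<mu> * m11 d < 0"
        using sgn by (simp add: zero_less_mult_iff)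
      then have m: "m21 \<mu> = - (\<sigma> * M)"
        unfolding \<sigma>_def M_def by (auto simp: mult_less_0_iff sgn_if abs_if)
      have half: "tau \<mu> / (2 * m21 \<mu>) = - (\<sigma> * tau \<mu>) / (2 * M)"
        using M \<sigma>0 \<sigma>2 unfolding m by (simp add: field_simps)
      have t1: "th1 \<mu> = - (\<sigma> * tau \<mu> + sd \<mu>) / (2 * M)" and t2: "th2 \<mu> = (sd \<mu> - \<sigma> * tau \<mu>) / (2 * M)"
        unfolding th_formula[OF c0] half M_def[symmetric]
        by (simp_all add: add_divide_distrib diff_divide_distrib)
      have "th1 \<mu> < 0"
        unfolding t1 using M den by (simp add: divide_neg_pos)
      moreover have "th2 \<mu> = F \<mu>"
        unfolding t2 F_def using M den prod by (simp add: frac_eq_eq m algebra_simps)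
      ultimately show ?thesis
        using True by simp
    next
      case False
      then have "m21 \<mu> * m11 d > 0"
        using sgn \<open>\<mu> \<noteq> d\<close> by (simp add: zero_less_mult_iff)
      then have m: "m21 \<mu> = \<sigma> * M"
        unfolding \<sigma>_def M_def by (auto simp: zero_less_mult_iff sgn_if abs_if)
      have half: "tau \<mu> / (2 * m21 \<mu>) = (\<sigma> * tau \<mu>) / (2 * M)"
        using M \<sigma>0 \<sigma>2 unfolding m by (simp add: field_simps)
      have t1: "th1 \<mu> = (\<sigma> * tau \<mu> - sd \<mu>) / (2 * M)" and t2: "th2 \<mu> = (sd \<mu> + \<sigma> * tau \<mu>) / (2 * M)"
        unfolding th_formula[OF c0] half M_def[symmetric]
        by (simp_all add: add_divide_distrib diff_divide_distrib)
      have "th2 \<mu> > 0"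
        unfolding t2 using M den by simp
      moreover have "th1 \<mu> = F \<mu>"
        unfolding t1 F_def using M den prod by (simp add: frac_eq_eq m algebra_simps)
      ultimately show ?thesis
        using False by simp
    qed
  qed simp
  then show ?thesis
    using e1(1) e2(1) Fc Fd tau0 by (intro exI[of _ F] exI[of _ "min e1 e2"]) auto
qed

text \<open>\<open>Del\<close> / \<open>tau\<close> is the value at the pole of the bounded root.
  For k = 0 the window contains no pole, and k - 1 would be truncated to 0.\<close>

definition Th :: "nat \<Rightarrow> real \<Rightarrow> real" where
  "Th k \<mu> = (if k = 0 then th1 \<mu> else if \<mu> < dn (k - 1) then th2 \<mu>
     else if \<mu> = dn (k - 1) then Del \<mu> / tau \<mu> else th1 \<mu>)"

lemma Th_gap:
  "\<mu> \<in> gap k \<Longrightarrow> Th k \<mu> = th1 \<mu>" "\<mu> \<in> gap k \<Longrightarrow> Th (Suc k) \<mu> = th2 \<mu>"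
  by (auto simp: Th_def gap_def)

lemma Th_isCont:
  assumes "\<mu> \<in> window k"
  shows "isCont (Th k) \<mu>"
proof -
  have inJ: "isCont (Th k) \<mu>" if \<mu>: "\<mu> \<in> gap i" and e12: "\<And>\<nu>. \<nu> \<in> gap i \<Longrightarrow> Th k \<nu> = g \<nu>" and g: "isCont g \<mu>" for i g
  proof -
    have "\<forall>\<^sub>F \<nu> in nhds \<mu>. \<nu> \<in> gap i"
      using gap_open \<mu> by (rule eventually_nhds_in_open)
    then have "\<forall>\<^sub>F \<nu> in nhds \<mu>. Th k \<nu> = g \<nu>"
      by eventually_elim (rule e12)
    from isCont_cong[OF this] g show ?thesis
      by blast
  qed
  show ?thesis
  proof (cases k)
    case 0
    then show ?thesis
      using assms inJ[of 0 th1] Th_gap(1) th_isCont(1)[OF m21_gap] by (auto simp: window_0)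
  next
    case (Suc i)
    consider "\<mu> \<in> gap i" | "\<mu> = dn i" | "\<mu> \<in> gap (Suc i)"
      using assms unfolding Suc window_Suc by blast
    then show ?thesis
    proof cases
      case 1
      then show ?thesis
        using inJ[OF 1, of th2] Th_gap(2)[of _ i] th_isCont(2)[OF m21_gap[OF 1]] unfolding Suc by blast
    next
      case 3
      then show ?thesis
        using inJ[OF 3, of th1] Th_gap(1)[of _ "Suc i"] th_isCont(1)[OF m21_gap[OF 3]] unfolding Suc by blast
    next
      case 2
      obtain F e where F: "e > 0" "isCont F \<mu>" "F \<mu> = Del \<mu> / tau \<mu>"
        "\<And>\<nu>. \<bar>\<nu> - \<mu>\<bar> < e \<Longrightarrow> \<nu> < \<mu> \<Longrightarrow> th2 \<nu> = F \<nu>"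
        "\<And>\<nu>. \<bar>\<nu> - \<mu>\<bar> < e \<Longrightarrow> \<mu> < \<nu> \<Longrightarrow> th1 \<nu> = F \<nu>"
        using th_near_dn[of \<mu>] 2 by (metis m21_dn)
      have "\<forall>\<^sub>F \<nu> in nhds \<mu>. Th k \<nu> = F \<nu>"
        unfolding eventually_nhds_metric
      proof (intro exI[of _ e] conjI allI impI)
        fix \<nu> assume "dist \<nu> \<mu> < e"
        then have "\<bar>\<nu> - \<mu>\<bar> < e"
          by (simp add: dist_real_def)
        then show "Th k \<nu> = F \<nu>"
          using F(3) F(4)[of \<nu>] F(5)[of \<nu>] 2 unfolding Th_def Suc by simp
      qed (rule F(1))
      from isCont_cong[OF this] F(2) show ?thesis
        by blast
    qed
  qed
qed

lemma Th_strict: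
  assumes "a \<in> window k" "b \<in> window k" "a < b"
  shows "Th k b < Th k a"
proof (cases k)
  case 0
  then show ?thesis
    using assms th_strict_gap(1)[of a 0 b] by (simp add: window_0 Th_def)
next
  case (Suc i)
  show ?thesis
  proof (rule strict_decreasing_glue[where d = "dn i" and window = "window k" and f = "Th k" and a = a and b = b])
    show "isCont (Th k) (dn i)"
      by (rule Th_isCont) (simp add: Suc window_Suc)
    fix x y
    show "y \<in> window k \<and> Th k y < Th k x" if "x \<in> window k" "x < y" "y < dn i"
    proof -
      have "x \<in> gap i"
        using that unfolding Suc window_Suc by (auto simp: gap_def)
      then have "y \<in> gap i"
        using that by (auto simp: gap_def)
      then show ?thesis
        using \<open>x \<in> gap i\<close> th_strict_gap(2)[of x i y] that unfolding Suc by (simp add: Th_gap window_Suc)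
    qed
    show "x \<in> window k \<and> Th k y < Th k x" if "y \<in> window k" "dn i < x" "x < y"
    proof -
      have "y \<in> gap (Suc i)"
        using that gap_less[of y i] unfolding Suc window_Suc by auto
      then have "x \<in> gap (Suc i)"
        using that by (auto simp: gap_def)
      then show ?thesis
        using \<open>y \<in> gap (Suc i)\<close> th_strict_gap(1)[of x "Suc i" y] that unfolding Suc by (simp add: Th_gap window_Suc)
    qed
  qed (use assms in auto)
qed

text \<open>Near the right end of the window the escaping root \<open>th1\<close> is negative. Near
  the left end \<open>th2\<close> is positive because it escapes to the right of
  \<open>dn (k - 2)\<close>, or, without such a pole, because N dominates every multiple of the
  identity at -infinity.\<close>

lemma Th_zero_exists: "\<exists>\<mu>\<in>window k. Th k \<mu> = 0"
proof -
  have neg: "\<exists>b\<in>window k. Th k b < 0"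
  proof -
    obtain e where e: "e > 0" "\<And>\<mu>. \<bar>\<mu> - dn k\<bar> < e \<Longrightarrow> \<mu> < dn k \<Longrightarrow> th1 \<mu> < 0"
      using th_near_dn[OF m21_dn[of k]] by blast
    obtain b where b: "b \<in> gap k" "dn k - e < b"
      using gap_near_left[OF e(1)] by blast
    then have "th1 b < 0"
      using gap_less[OF b(1)] by (intro e(2)) auto
    then show ?thesis
      using b(1) gap_subset_window(1) Th_gap(1) by (intro bexI[of _ b]) auto
  qed
  have pos: "\<exists>a\<in>window k. Th k a > 0"
  proof (cases "k \<le> 1")
    case True
    obtain K where K: "\<And>\<mu>. \<mu> \<le> K \<Longrightarrow> th1 \<mu> > 0"
      using th_positive by blast
    define a where "a = min K (dn 0 - 1)"
    have a: "a \<in> gap 0" "th1 a > 0" "th2 a > 0"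
      using K[of a] th1_le_th2[of a] by (auto simp: a_def gap_def)
    then show ?thesis
      using True gap_subset_window[OF a(1)] Th_gap[OF a(1)] by (intro bexI[of _ a]) (auto simp: le_Suc_eq)
  next
    case False
    define i where "i = k - 2"
    have k: "k = Suc (Suc i)"
      using False by (simp add: i_def)
    obtain e where e: "e > 0" "\<And>\<mu>. \<bar>\<mu> - dn i\<bar> < e \<Longrightarrow> dn i < \<mu> \<Longrightarrow> th2 \<mu> > 0"
      using th_near_dn[OF m21_dn[of i]] by blast
    obtain a where a: "a \<in> gap (Suc i)" "a < dn i + e"
      using gap_near_right[OF e(1)] by blast
    then have "th2 a > 0"
      by (intro e(2)) (auto simp: gap_Suc)
    then show ?thesis
      using a(1) gap_subset_window(2) Th_gap(2) unfolding k by (intro bexI[of _ a]) auto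
  qed
  obtain a b where ab: "a \<in> window k" "b \<in> window k" "Th k a > 0" "Th k b < 0"
    using neg pos by blast
  then have "a < b"
    using Th_strict[of b k a] by (cases a b rule: linorder_cases) auto
  moreover have "\<forall>x. a \<le> x \<and> x \<le> b \<longrightarrow> isCont (Th k) x"
    using window_between[OF ab(1,2)] Th_isCont by blast
  ultimately obtain \<mu> where "a \<le> \<mu>" "\<mu> \<le> b" "Th k \<mu> = 0"
    using IVT2[of "Th k" b 0 a] ab by auto
  then show ?thesis
    using window_between[OF ab(1,2)] by blast
qed

definition lz :: "nat \<Rightarrow> real" where
  "lz k = (SOME \<mu>. \<mu> \<in> window k \<and> Th k \<mu> = 0)"

lemma lz: "lz k \<in> window k" "Th k (lz k) = 0"
  using someI_ex[of "\<lambda>\<mu>. \<mu> \<in> window k \<and> Th k \<mu> = 0"] Th_zero_exists[of k] unfolding lz_def by blast+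

lemma lz_eq_iff: "lz k = \<mu> \<longleftrightarrow> \<mu> \<in> window k \<and> Th k \<mu> = 0"
  using lz[of k] Th_strict[of "lz k" k \<mu>] Th_strict[of \<mu> k "lz k"]
  by (cases "lz k" \<mu> rule: linorder_cases) auto

text \<open>A reversed order would put both zeros into \<open>gap k\<close>. There
  \<open>th1\<close> vanishes at the larger one, hence is positive at the smaller one, where
  \<open>th2\<close> vanishes, against \<open>th1\<close> <= \<open>th2\<close>.\<close>

lemma lz_mono: "mono lz"
  unfolding mono_iff_le_Suc
proof
  fix k
  show "lz k \<le> lz (Suc k)"
  proof (rule ccontr)
    assume "\<not> lz k \<le> lz (Suc k)"
    then have less: "lz (Suc k) < lz k"
      by simp
    have "lz k < dn k"
      using lz(1)[of k] by (simp add: window_def)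
    then have b: "lz (Suc k) \<in> gap k"
      using lz(1)[of "Suc k"] less unfolding window_Suc by (auto simp: gap_def)
    then have a: "lz k \<in> gap k"
      using less \<open>lz k < dn k\<close> by (auto simp: gap_def)
    have "th1 (lz k) = 0" "th2 (lz (Suc k)) = 0"
      using lz(2)[of k] lz(2)[of "Suc k"] Th_gap(1)[OF a] Th_gap(2)[OF b] by simp_all
    moreover have "th1 (lz k) < th1 (lz (Suc k))"
      using th_strict_gap(1)[OF b a less] .
    ultimately show False
      using th1_le_th2[of "lz (Suc k)"] by simp
  qed
qed

section \<open>Multiplicities for graph conditions\<close>

lemma bv_mem_graph:
  "bv \<mu> \<alpha> \<beta> \<in> Lag_graph h11 h22 h12 \<longleftrightarrow>
     - \<alpha> = of_real h11 * \<beta> + h12 * (of_real (m21 \<mu>) * \<alpha> + of_real (m22 \<mu>) * \<beta>) \<and>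
     of_real (m11 \<mu>) * \<alpha> + of_real (m12 \<mu>) * \<beta> = cnj h12 * \<beta> + of_real h22 * (of_real (m21 \<mu>) * \<alpha> + of_real (m22 \<mu>) * \<beta>)"
  by (simp add: Lag_graph_def)

text \<open>Here w is x(T) and \<beta> is x(0). Away from the poles the condition reads (N - H)
  applied to (x(0), x(T)) equals 0.\<close>

lemma bv_mem_graph_regular:
  assumes c: "m21 \<mu> \<noteq> 0"
  defines "w \<equiv> \<lambda>\<alpha> \<beta>. of_real (m21 \<mu>) * \<alpha> + of_real (m22 \<mu>) * \<beta>"
  shows "bv \<mu> \<alpha> \<beta> \<in> Lag_graph h11 h22 h12 \<longleftrightarrow>
     of_real (e11 \<mu>) * \<beta> + e12 \<mu> * w \<alpha> \<beta> = 0 \<and> cnj (e12 \<mu>) * \<beta> + of_real (e22 \<mu>) * w \<alpha> \<beta> = 0"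
proof -
  let ?c = "of_real (m21 \<mu>) :: complex"
  have c0: "?c \<noteq> 0"
    using c by simp
  have "of_real (e11 \<mu>) * \<beta> + e12 \<mu> * w \<alpha> \<beta>
      = (of_real (m22 \<mu>) * \<beta> - w \<alpha> \<beta>) / ?c - of_real h11 * \<beta> - h12 * w \<alpha> \<beta>"
    by (simp add: e11_def e12_def algebra_simps diff_divide_distrib)
  also have "of_real (m22 \<mu>) * \<beta> - w \<alpha> \<beta> = ?c * (- \<alpha>)"
    by (simp add: w_def)
  finally have 1: "of_real (e11 \<mu>) * \<beta> + e12 \<mu> * w \<alpha> \<beta> = - \<alpha> - (of_real h11 * \<beta> + h12 * w \<alpha> \<beta>)"
    using c0 by simp
  have "cnj (e12 \<mu>) * \<beta> + of_real (e22 \<mu>) * w \<alpha> \<beta>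
      = (of_real (m11 \<mu>) * w \<alpha> \<beta> - \<beta>) / ?c - cnj h12 * \<beta> - of_real h22 * w \<alpha> \<beta>"
    by (simp add: e22_def e12_def algebra_simps diff_divide_distrib)
  also have "of_real (m11 \<mu>) * w \<alpha> \<beta> - \<beta> = of_real (m11 \<mu>) * ?c * \<alpha> + (of_real (m11 \<mu>) * of_real (m22 \<mu>) - 1) * \<beta>"
    by (simp add: w_def algebra_simps)
  also have "\<dots> = ?c * (of_real (m11 \<mu>) * \<alpha> + of_real (m12 \<mu>) * \<beta>)"
    unfolding det_m_complex by (simp add: algebra_simps)
  finally have 2: "cnj (e12 \<mu>) * \<beta> + of_real (e22 \<mu>) * w \<alpha> \<beta> =
      of_real (m11 \<mu>) * \<alpha> + of_real (m12 \<mu>) * \<beta> - (cnj h12 * \<beta> + of_real h22 * w \<alpha> \<beta>)"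
    using c0 by simp
  show ?thesis
    unfolding bv_mem_graph 1 2 by (simp add: w_def)
qed

lemma mult_regular:
  assumes c: "m21 \<mu> \<noteq> 0"
  shows "geom_mult (Lag_graph h11 h22 h12) \<mu> = (if th1 \<mu> = 0 then 1 else 0) + (if th2 \<mu> = 0 then 1 else 0)"
proof -
  define w where "w \<alpha> \<beta> = of_real (m21 \<mu>) * \<alpha> + of_real (m22 \<mu>) * \<beta>" for \<alpha> \<beta> :: complex
  note mem = bv_mem_graph_regular[OF c, folded w_def]
  have c0: "of_real (m21 \<mu>) \<noteq> (0 :: complex)"
    using c by simp
  have solve: "\<exists>\<alpha>. w \<alpha> \<beta> = x" for \<beta> x
    using c0 by (intro exI[of _ "(x - of_real (m22 \<mu>) * \<beta>) / of_real (m21 \<mu>)"]) (simp add: w_def)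
  have w0: "w \<alpha> 0 = 0 \<Longrightarrow> \<alpha> = 0" for \<alpha>
    using c by (simp add: w_def)
  have all: "(\<forall>\<alpha> \<beta>. bv \<mu> \<alpha> \<beta> \<in> Lag_graph h11 h22 h12) \<longleftrightarrow> th1 \<mu> = 0 \<and> th2 \<mu> = 0"
  proof
    assume L: "\<forall>\<alpha> \<beta>. bv \<mu> \<alpha> \<beta> \<in> Lag_graph h11 h22 h12"
    obtain \<alpha>1 \<alpha>2 where "w \<alpha>1 1 = 0" "w \<alpha>2 0 = 1"
      using solve by metis
    then have "e11 \<mu> = 0 \<and> e22 \<mu> = 0 \<and> e12 \<mu> = 0"
      using L[rule_format, of \<alpha>1 1] L[rule_format, of \<alpha>2 0] unfolding mem by simp
    then show "th1 \<mu> = 0 \<and> th2 \<mu> = 0"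
      unfolding th1_def th2_def hmin_hmax_zero_iff .
  next
    assume "th1 \<mu> = 0 \<and> th2 \<mu> = 0"
    then have "e11 \<mu> = 0 \<and> e22 \<mu> = 0 \<and> e12 \<mu> = 0"
      unfolding th1_def th2_def hmin_hmax_zero_iff .
    then show "\<forall>\<alpha> \<beta>. bv \<mu> \<alpha> \<beta> \<in> Lag_graph h11 h22 h12"
      unfolding mem by simp
  qed
  have prod: "th1 \<mu> * th2 \<mu> = e11 \<mu> * e22 \<mu> - (norm (e12 \<mu>))\<^sup>2"
    unfolding th1_def th2_def by (rule hmin_times_hmax)
  have normsq: "e12 \<mu> * cnj (e12 \<mu>) = of_real ((norm (e12 \<mu>))\<^sup>2)"
    by (rule complex_norm_square[symmetric])
  have none: "(\<forall>\<alpha> \<beta>. bv \<mu> \<alpha> \<beta> \<in> Lag_graph h11 h22 h12 \<longrightarrow> \<alpha> = 0 \<and> \<beta> = 0) \<longleftrightarrow> th1 \<mu> * th2 \<mu> \<noteq> 0"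
  proof
    assume L: "\<forall>\<alpha> \<beta>. bv \<mu> \<alpha> \<beta> \<in> Lag_graph h11 h22 h12 \<longrightarrow> \<alpha> = 0 \<and> \<beta> = 0"
    show "th1 \<mu> * th2 \<mu> \<noteq> 0"
    proof
      assume "th1 \<mu> * th2 \<mu> = 0"
      then have z: "of_real (e11 \<mu>) * of_real (e22 \<mu>) = e12 \<mu> * cnj (e12 \<mu>)"
        using prod unfolding normsq by (simp flip: of_real_mult)
      \<comment> \<open>The vector (- e12, e11) is annihilated by the first row, and by the second
        because the determinant is 0. If it is the zero vector, (1, 0) lies in the kernel
        instead.\<close>
      obtain \<alpha> where \<alpha>: "w \<alpha> (- e12 \<mu>) = of_real (e11 \<mu>)"
        using solve by blast
      have "bv \<mu> \<alpha> (- e12 \<mu>) \<in> Lag_graph h11 h22 h12"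
        unfolding mem \<alpha> using z by (simp add: mult.commute)
      then have "\<alpha> = 0 \<and> - e12 \<mu> = 0"
        using L by blast
      then have eq0: "e12 \<mu> = 0" and ep0: "e11 \<mu> = 0"
        using \<alpha> by (simp_all add: w_def)
      obtain \<alpha>' where "w \<alpha>' 1 = 0"
        using solve by blast
      then have "bv \<mu> \<alpha>' 1 \<in> Lag_graph h11 h22 h12"
        unfolding mem using eq0 ep0 by simp
      then show False
        using L by force
    qed
  next
    assume t: "th1 \<mu> * th2 \<mu> \<noteq> 0"
    show "\<forall>\<alpha> \<beta>. bv \<mu> \<alpha> \<beta> \<in> Lag_graph h11 h22 h12 \<longrightarrow> \<alpha> = 0 \<and> \<beta> = 0"
    proof (intro allI impI)
      fix \<alpha> \<beta> assume "bv \<mu> \<alpha> \<beta> \<in> Lag_graph h11 h22 h12"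
      then have e: "of_real (e11 \<mu>) * \<beta> + e12 \<mu> * w \<alpha> \<beta> = 0" "cnj (e12 \<mu>) * \<beta> + of_real (e22 \<mu>) * w \<alpha> \<beta> = 0"
        unfolding mem by blast+
      have det: "of_real (e11 \<mu>) * of_real (e22 \<mu>) - e12 \<mu> * cnj (e12 \<mu>) \<noteq> 0"
        using t unfolding prod normsq by (metis of_real_diff of_real_eq_0_iff of_real_mult)
      have "(of_real (e11 \<mu>) * of_real (e22 \<mu>) - e12 \<mu> * cnj (e12 \<mu>)) * \<beta>
          = of_real (e22 \<mu>) * (of_real (e11 \<mu>) * \<beta> + e12 \<mu> * w \<alpha> \<beta>) - e12 \<mu> * (cnj (e12 \<mu>) * \<beta> + of_real (e22 \<mu>) * w \<alpha> \<beta>)"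
        "(of_real (e11 \<mu>) * of_real (e22 \<mu>) - e12 \<mu> * cnj (e12 \<mu>)) * w \<alpha> \<beta>
          = of_real (e11 \<mu>) * (cnj (e12 \<mu>) * \<beta> + of_real (e22 \<mu>) * w \<alpha> \<beta>) - cnj (e12 \<mu>) * (of_real (e11 \<mu>) * \<beta> + e12 \<mu> * w \<alpha> \<beta>)"
        by (simp_all add: algebra_simps)
      then have "\<beta> = 0" "w \<alpha> \<beta> = 0"
        unfolding e using det by simp_all
      then show "\<alpha> = 0 \<and> \<beta> = 0"
        using w0 by simp
    qed
  qed
  show ?thesis
    unfolding geom_mult_def all none by simp
qed

text \<open>At a pole x(T) = m22 x(0) irrespective of y(0). The first equation determines y(0) from
  x(0) and the second becomes \<open>Del\<close> x(0) = 0, matching the value \<open>Del\<close> /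
  \<open>tau\<close> of the glued branch.\<close>

lemma mult_singular:
  assumes c: "m21 \<mu> = 0"
  shows "geom_mult (Lag_graph h11 h22 h12) \<mu> = (if Del \<mu> = 0 then 1 else 0)"
proof -
  define t where "t = of_real h11 + h12 * of_real (m22 \<mu>)"
  have d: "of_real (m11 \<mu>) * of_real (m22 \<mu>) = (1 :: complex)"
    using det_m_complex[of \<mu>] c by simp
  have Del: "of_real (Del \<mu>) = of_real (m12 \<mu>) - cnj h12 - of_real h22 * of_real (m22 \<mu>) - of_real (m11 \<mu>) * t"
  proof -
    have "of_real (2 * Re h12) = h12 + cnj h12"
      by (simp add: complex_add_cnj)
    moreover have "of_real (m11 \<mu>) * t = of_real h11 * of_real (m11 \<mu>) + h12 * (of_real (m11 \<mu>) * of_real (m22 \<mu>))"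
      by (simp add: t_def algebra_simps)
    ultimately show ?thesis
      unfolding d Del_def c by (simp add: algebra_simps)
  qed
  have mem: "bv \<mu> \<alpha> \<beta> \<in> Lag_graph h11 h22 h12 \<longleftrightarrow> \<alpha> = - (t * \<beta>) \<and> of_real (Del \<mu>) * \<beta> = 0" for \<alpha> \<beta>
  proof -
    have 1: "- \<alpha> = of_real h11 * \<beta> + h12 * (of_real (m22 \<mu>) * \<beta>) \<longleftrightarrow> \<alpha> = - (t * \<beta>)"
      unfolding t_def by (simp add: algebra_simps minus_equation_iff[of \<alpha>] eq_commute)
    have 2: "of_real (m11 \<mu>) * (- (t * \<beta>)) + of_real (m12 \<mu>) * \<beta> - (cnj h12 * \<beta> + of_real h22 * (of_real (m22 \<mu>) * \<beta>))
        = of_real (Del \<mu>) * \<beta>"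
      unfolding Del by (simp add: algebra_simps)
    have "of_real (m11 \<mu>) * (- (t * \<beta>)) + of_real (m12 \<mu>) * \<beta> = cnj h12 * \<beta> + of_real h22 * (of_real (m22 \<mu>) * \<beta>)
        \<longleftrightarrow> of_real (Del \<mu>) * \<beta> = 0"
      unfolding 2[symmetric] by simp
    note 3 = this
    have E: "bv \<mu> \<alpha> \<beta> \<in> Lag_graph h11 h22 h12 \<longleftrightarrow>
        - \<alpha> = of_real h11 * \<beta> + h12 * (of_real (m22 \<mu>) * \<beta>) \<and>
        of_real (m11 \<mu>) * \<alpha> + of_real (m12 \<mu>) * \<beta> = cnj h12 * \<beta> + of_real h22 * (of_real (m22 \<mu>) * \<beta>)"
      unfolding bv_mem_graph c by simp
    show ?thesis
    proof (cases "\<alpha> = - (t * \<beta>)")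
      case True
      then show ?thesis
        unfolding E 1 unfolding True 3 by blast
    next
      case False
      then show ?thesis
        unfolding E 1 by blast
    qed
  qed
  have "bv \<mu> 1 0 \<notin> Lag_graph h11 h22 h12"
    unfolding mem by simp
  then have all: "\<not> (\<forall>\<alpha> \<beta>. bv \<mu> \<alpha> \<beta> \<in> Lag_graph h11 h22 h12)"
    by blast
  have none: "(\<forall>\<alpha> \<beta>. bv \<mu> \<alpha> \<beta> \<in> Lag_graph h11 h22 h12 \<longrightarrow> \<alpha> = 0 \<and> \<beta> = 0) \<longleftrightarrow> Del \<mu> \<noteq> 0"
  proof
    assume L: "\<forall>\<alpha> \<beta>. bv \<mu> \<alpha> \<beta> \<in> Lag_graph h11 h22 h12 \<longrightarrow> \<alpha> = 0 \<and> \<beta> = 0"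
    show "Del \<mu> \<noteq> 0"
    proof
      assume "Del \<mu> = 0"
      then have "bv \<mu> (- (t * 1)) 1 \<in> Lag_graph h11 h22 h12"
        unfolding mem by simp
      then show False
        using L by (metis zero_neq_one)
    qed
  qed (simp add: mem)
  show ?thesis
    unfolding geom_mult_def if_not_P[OF all] none by simp
qed

lemma graph_Lag: "Lag_graph h11 h22 h12 \<in> Lag"
  using layer0_iff by (auto simp: layer_def)

text \<open>A point of \<open>gap i\<close> lies in the windows i and i + 1 only, which contribute
  the zeros of \<open>th1\<close> and of \<open>th2\<close>; the pole \<open>dn i\<close> lies in
  window i + 1 only.\<close>

lemma eigval_graph:
  assumes "j \<ge> 1"
  shows "eigval T P Q R j (Lag_graph h11 h22 h12) = lz (j - 1)"
proof (rule eigval_eq[OF eigenvalue_enumerationI[OF graph_Lag lz_mono] assms])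
  fix \<mu>
  show "finite {k. lz k = \<mu>} \<and> card {k. lz k = \<mu>} = geom_mult (Lag_graph h11 h22 h12) \<mu>"
  proof (cases rule: gap_cases[of \<mu>])
    case (1 i)
    have "\<mu> \<in> window k \<longleftrightarrow> k = i \<or> k = Suc i" for k
    proof (cases k)
      case 0
      then show ?thesis
        using 1 gap_unique[of \<mu> 0 i] by (auto simp: window_0)
    next
      case (Suc n)
      then show ?thesis
        using 1 gap_unique[OF 1, of n] gap_unique[OF 1, of "Suc n"] gap_neq_dn[OF 1] by (auto simp: window_Suc)
    qed
    then have "{k. lz k = \<mu>} = (if th1 \<mu> = 0 then {i} else {}) \<union> (if th2 \<mu> = 0 then {Suc i} else {})"
      using Th_gap[OF 1] by (auto simp: lz_eq_iff)
    then show ?thesis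
      unfolding mult_regular[OF m21_gap[OF 1]] by auto
  next
    case (2 i)
    have m: "m21 \<mu> = 0"
      using 2 by simp
    then have tau: "tau \<mu> \<noteq> 0"
      using th_near_dn by blast
    have memD: "\<mu> \<in> window k \<longleftrightarrow> k = Suc i" for k
    proof (cases k)
      case 0
      then show ?thesis
        using 2 gap_neq_dn[of \<mu> 0 i] by (auto simp: window_0)
    next
      case (Suc n)
      then show ?thesis
        using 2 gap_neq_dn[of \<mu> n i] gap_neq_dn[of \<mu> "Suc n" i] by (auto simp: window_Suc)
    qed
    have Th: "Th (Suc i) \<mu> = Del \<mu> / tau \<mu>"
      using 2 by (simp add: Th_def)
    have lz: "lz k = \<mu> \<longleftrightarrow> k = Suc i \<and> Del \<mu> = 0" for k
      unfolding lz_eq_iff memD using Th tau by (cases "k = Suc i") simp_all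
    show ?thesis
      unfolding lz mult_singular[OF m] by simp
  qed
qed

end

section \<open>Conditions meeting the Dirichlet condition in a line\<close>

lemma limit_le_left:
  fixes line_form :: "real \<Rightarrow> real"
  assumes "(line_form \<longlongrightarrow> L) (at d)" "a < d" "\<And>x. a < x \<Longrightarrow> x < d \<Longrightarrow> line_form x \<le> c"
  shows "L \<le> c"
proof -
  have "\<forall>\<^sub>F x in at_left d. line_form x \<le> c"
    unfolding eventually_at_left_field using assms by blast
  then show ?thesis
    using filterlim_mono[OF assms(1) order_refl at_le[OF subset_UNIV]]
    by (intro tendsto_upperbound[of line_form L "at_left d"]) auto
qed

lemma limit_ge_left:
  fixes line_form :: "real \<Rightarrow> real"
  assumes "(line_form \<longlongrightarrow> L) (at d)" "a < d" "\<And>x. a < x \<Longrightarrow> x < d \<Longrightarrow> line_form x \<ge> c"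
  shows "L \<ge> c"
  using limit_le_left[of "\<lambda>x. - line_form x" "- L" d a "- c"] assms by (auto intro: tendsto_minus)

lemma limit_le_right:
  fixes line_form :: "real \<Rightarrow> real"
  assumes "(line_form \<longlongrightarrow> L) (at d)" "d < b" "\<And>x. d < x \<Longrightarrow> x < b \<Longrightarrow> line_form x \<le> c"
  shows "L \<le> c"
proof -
  have "\<forall>\<^sub>F x in at_right d. line_form x \<le> c"
    unfolding eventually_at_right_field using assms by blast
  then show ?thesis
    using filterlim_mono[OF assms(1) order_refl at_le[OF subset_UNIV]]
    by (intro tendsto_upperbound[of line_form L "at_right d"]) auto
qed

lemma limit_ge_right:
  fixes line_form :: "real \<Rightarrow> real"
  assumes "(line_form \<longlongrightarrow> L) (at d)" "d < b" "\<And>x. d < x \<Longrightarrow> x < b \<Longrightarrow> line_form x \<ge> c"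
  shows "L \<ge> c"
  using limit_le_right[of "\<lambda>x. - line_form x" "- L" d b "- c"] assms by (auto intro: tendsto_minus)

locale line_condition = sturm_liouville +
  fixes \<xi>0 \<xi>1 :: complex and h :: real
  assumes \<xi>: "\<xi>0 \<noteq> 0 \<or> \<xi>1 \<noteq> 0"
begin

text \<open><N \<xi>, \<xi>> - h. As N is real and symmetric, real and imaginary parts of \<xi>
  contribute separately and the form on real vectors suffices.\<close>

definition line_form :: "real \<Rightarrow> real" where
  "line_form \<mu> = qf \<mu> (Re \<xi>0) (Re \<xi>1) + qf \<mu> (Im \<xi>0) (Im \<xi>1) - h"

text \<open>\<open>m21\<close> times <N \<xi>, \<xi>>, regular across the poles.\<close>

definition gram :: "real \<Rightarrow> real" where
  "gram \<mu> = m22 \<mu> * (norm \<xi>0)\<^sup>2 - 2 * Re (\<xi>0 * cnj \<xi>1) + m11 \<mu> * (norm \<xi>1)\<^sup>2"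

lemma line_form_gram: "line_form \<mu> = gram \<mu> / m21 \<mu> - h"
proof -
  have "gram \<mu> = (m22 \<mu> * (Re \<xi>0)\<^sup>2 - 2 * (Re \<xi>0 * Re \<xi>1) + m11 \<mu> * (Re \<xi>1)\<^sup>2)
      + (m22 \<mu> * (Im \<xi>0)\<^sup>2 - 2 * (Im \<xi>0 * Im \<xi>1) + m11 \<mu> * (Im \<xi>1)\<^sup>2)"
    unfolding gram_def cmod_power2 by (simp add: algebra_simps)
  then show ?thesis
    unfolding line_form_def qf_def by (simp only: add_divide_distrib)
qed

lemma gram_complex:
  "of_real (gram \<mu>) = of_real (m22 \<mu>) * (\<xi>0 * cnj \<xi>0) - \<xi>1 * cnj \<xi>0 - \<xi>0 * cnj \<xi>1 + of_real (m11 \<mu>) * (\<xi>1 * cnj \<xi>1)"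
  unfolding gram_def cmod_power2 by (simp add: complex_eq_iff power2_eq_square algebra_simps)

lemma line_form_strict:
  assumes "\<mu> < \<nu>" "\<And>\<kappa>. \<mu> \<le> \<kappa> \<Longrightarrow> \<kappa> \<le> \<nu> \<Longrightarrow> m21 \<kappa> \<noteq> 0"
  shows "line_form \<nu> < line_form \<mu>"
proof -
  have le: "qf \<nu> u v \<le> qf \<mu> u v" for u v
    using qf_strict_decreasing[OF assms, of u v] by (cases "u = 0 \<and> v = 0") (auto simp: qf_def)
  have "(Re \<xi>0 \<noteq> 0 \<or> Re \<xi>1 \<noteq> 0) \<or> (Im \<xi>0 \<noteq> 0 \<or> Im \<xi>1 \<noteq> 0)"
    using \<xi> by (auto simp: complex_eq_iff)
  then have "qf \<nu> (Re \<xi>0) (Re \<xi>1) < qf \<mu> (Re \<xi>0) (Re \<xi>1) \<or> qf \<nu> (Im \<xi>0) (Im \<xi>1) < qf \<mu> (Im \<xi>0) (Im \<xi>1)"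
    using qf_strict_decreasing[OF assms] by blast
  then show ?thesis
    using le[of "Re \<xi>0" "Re \<xi>1"] le[of "Im \<xi>0" "Im \<xi>1"] unfolding line_form_def by linarith
qed

lemma line_form_strict_gap: "a \<in> gap k \<Longrightarrow> b \<in> gap k \<Longrightarrow> a < b \<Longrightarrow> line_form b < line_form a"
  using line_form_strict[of a b] m21_gap gap_between[of a k b] by blast

lemma line_form_isCont: "m21 \<mu> \<noteq> 0 \<Longrightarrow> isCont line_form \<mu>"
  unfolding line_form_def by (intro continuous_intros DERIV_isCont[OF qf_DERIV])

lemma line_form_positive: "\<exists>K. \<forall>\<mu>\<le>K. line_form \<mu> > 0"
proof -
  define n where "n = (norm \<xi>0)\<^sup>2 + (norm \<xi>1)\<^sup>2"
  have n: "n > 0"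
    using \<xi> by (auto simp: n_def sum_power2_gt_zero_iff)
  define C where "C = (\<bar>h\<bar> + 1) / n"
  obtain K where K: "\<And>\<mu>. \<mu> \<le> K \<Longrightarrow> (\<forall>u v. qf \<mu> u v \<ge> C * (u\<^sup>2 + v\<^sup>2))"
    using qf_bounded_below[of C] by blast
  have "line_form \<mu> > 0" if "\<mu> \<le> K" for \<mu>
  proof -
    have "C * ((Re \<xi>0)\<^sup>2 + (Re \<xi>1)\<^sup>2) + C * ((Im \<xi>0)\<^sup>2 + (Im \<xi>1)\<^sup>2) = C * n"
      unfolding n_def cmod_power2 by (simp add: algebra_simps)
    moreover have "C * n = \<bar>h\<bar> + 1"
      using n by (simp add: C_def)
    ultimately show ?thesis
      using K[OF that, rule_format, of "Re \<xi>0" "Re \<xi>1"] K[OF that, rule_format, of "Im \<xi>0" "Im \<xi>1"]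
      unfolding line_form_def by linarith
  qed
  then show ?thesis
    by blast
qed

text \<open>Because m11 d * m22 d = 1, the numerator is a square up to the factor m11 d; it vanishes
  only for \<xi> proportional to (1, m22 d).\<close>

lemma gram_singular:
  assumes d: "m21 d = 0"
  shows "gram d = m11 d * (norm (\<xi>1 - of_real (m22 d) * \<xi>0))\<^sup>2"
proof -
  have det: "m11 d * m22 d = 1"
    using det_m[of d] d by simp
  have "m11 d * (norm (\<xi>1 - of_real (m22 d) * \<xi>0))\<^sup>2
      = m11 d * ((Re \<xi>1)\<^sup>2 + (Im \<xi>1)\<^sup>2) - 2 * (m11 d * m22 d) * (Re \<xi>0 * Re \<xi>1 + Im \<xi>0 * Im \<xi>1)
        + (m11 d * m22 d) * m22 d * ((Re \<xi>0)\<^sup>2 + (Im \<xi>0)\<^sup>2)"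
    unfolding cmod_power2 by (simp only: minus_complex.sel times_complex.sel Re_complex_of_real Im_complex_of_real)
      (simp add: power2_eq_square algebra_simps)
  then show ?thesis
    unfolding det gram_def cmod_power2 by simp
qed

text \<open>Multiplied by m11 d, the numerator is positive near d, and
  \<open>m21 \<mu> * m11 d\<close> has the sign of \<mu> - d.\<close>

lemma line_form_near_pole:
  assumes d: "m21 d = 0" and ne: "\<xi>1 \<noteq> of_real (m22 d) * \<xi>0"
  shows "\<exists>e>0. \<forall>\<mu>. \<bar>\<mu> - d\<bar> < e \<longrightarrow> (\<mu> < d \<longrightarrow> line_form \<mu> < 0) \<and> (d < \<mu> \<longrightarrow> line_form \<mu> > 0)"
proof -
  have m11: "m11 d \<noteq> 0"
    using det_m[of d] d by auto
  define g where "g \<mu> = m11 d * (gram \<mu> - h * m21 \<mu>)" for \<mu>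
  have iso: "isCont m11 d" "isCont m21 d" "isCont m22 d"
    using m_cont[of UNIV] by (simp_all add: continuous_on_eq_continuous_at)
  have gd: "g d > 0"
  proof -
    have "g d = (m11 d)\<^sup>2 * (norm (\<xi>1 - of_real (m22 d) * \<xi>0))\<^sup>2"
      unfolding g_def gram_singular[OF d] d by (simp add: power2_eq_square)
    then show ?thesis
      using m11 ne by simp
  qed
  have "isCont g d"
    unfolding g_def gram_def by (intro continuous_intros iso)
  then have "\<forall>\<^sub>F \<mu> in at d. g \<mu> > 0"
    unfolding isCont_def using gd by (rule order_tendstoD)
  then obtain e1 where e1: "e1 > 0" "\<And>\<mu>. \<mu> \<noteq> d \<Longrightarrow> dist \<mu> d < e1 \<Longrightarrow> g \<mu> > 0"
    unfolding eventually_at by auto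
  obtain e2 where e2: "e2 > 0" "\<And>\<mu>. \<bar>\<mu> - d\<bar> < e2 \<Longrightarrow> \<mu> \<noteq> d \<Longrightarrow> (\<mu> - d) * (m21 \<mu> * m11 d) > 0"
    using m21_local_sign[OF d] by blast
  have "(\<mu> < d \<longrightarrow> line_form \<mu> < 0) \<and> (d < \<mu> \<longrightarrow> line_form \<mu> > 0)" if \<mu>: "\<bar>\<mu> - d\<bar> < min e1 e2" for \<mu>
  proof (cases "\<mu> = d")
    case False
    have g: "g \<mu> > 0"
      using e1(2)[OF False] \<mu> by (simp add: dist_real_def)
    have s: "(\<mu> - d) * (m21 \<mu> * m11 d) > 0"
      using e2(2)[of \<mu>] \<mu> False by simp
    then have "m21 \<mu> \<noteq> 0"
      by auto
    then have "line_form \<mu> = g \<mu> / (m21 \<mu> * m11 d)"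
      using m11 by (simp add: line_form_gram g_def field_simps)
    then show ?thesis
      using g s by (auto simp: zero_less_mult_iff divide_pos_neg)
  qed simp
  then show ?thesis
    using e1(1) e2(1) by (intro exI[of _ "min e1 e2"]) auto
qed

definition lim_value :: "real \<Rightarrow> real" where
  "lim_value d = (norm \<xi>0)\<^sup>2 * (m12 d * m22 d) - h"

lemma line_form_limit:
  assumes d: "m21 d = 0" and eq: "\<xi>1 = of_real (m22 d) * \<xi>0"
  shows "(line_form \<longlongrightarrow> lim_value d) (at d)"
proof -
  have qf: "qf \<mu> u (m22 d * u) = u\<^sup>2 * qf \<mu> 1 (m22 d)" for \<mu> u
    by (simp add: qf_def power2_eq_square algebra_simps add_divide_distrib diff_divide_distrib)
  have "((\<lambda>\<mu>. (Re \<xi>0)\<^sup>2 * qf \<mu> 1 (m22 d) + (Im \<xi>0)\<^sup>2 * qf \<mu> 1 (m22 d) - h) \<longlongrightarrow>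
      (Re \<xi>0)\<^sup>2 * (m12 d * m22 d) + (Im \<xi>0)\<^sup>2 * (m12 d * m22 d) - h) (at d)"
    by (intro tendsto_intros qf_limit[OF d])
  moreover have "(\<lambda>\<mu>. (Re \<xi>0)\<^sup>2 * qf \<mu> 1 (m22 d) + (Im \<xi>0)\<^sup>2 * qf \<mu> 1 (m22 d) - h) = line_form"
    unfolding line_form_def using eq by (simp add: fun_eq_iff qf)
  moreover have "(Re \<xi>0)\<^sup>2 * (m12 d * m22 d) + (Im \<xi>0)\<^sup>2 * (m12 d * m22 d) - h = lim_value d"
    by (simp add: lim_value_def cmod_power2 distrib_right)
  ultimately show ?thesis
    by simp
qed

text \<open>Unless \<xi> has the direction (1, m22), the form is negative just left of the pole. In
  that direction it decreases strictly to \<open>lim_value\<close>, so it stays positive exactly if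
  the limit is nonnegative.\<close>

lemma line_form_left_iff:
  "(\<forall>\<mu>\<in>gap k. line_form \<mu> > 0) \<longleftrightarrow> \<xi>1 = of_real (m22 (dn k)) * \<xi>0 \<and> lim_value (dn k) \<ge> 0"
proof (cases "\<xi>1 = of_real (m22 (dn k)) * \<xi>0")
  case True
  note lim = line_form_limit[OF m21_dn True]
  obtain a where a: "a \<in> gap k"
    using gap_near_left[of 1 k] by auto
  have in_gap: "x \<in> gap k" if "b \<in> gap k" "b < x" "x < dn k" for b x
    using that by (auto simp: gap_def)
  have "lim_value (dn k) \<ge> 0" if "\<forall>\<mu>\<in>gap k. line_form \<mu> > 0"
    by (rule limit_ge_left[OF lim gap_less[OF a]]) (use in_gap[OF a] that in \<open>auto intro: less_imp_le\<close>)
  moreover have "line_form b > 0" if L: "lim_value (dn k) \<ge> 0" and b: "b \<in> gap k" for b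
  proof -
    obtain c where c: "b < c" "c < dn k"
      using dense[OF gap_less[OF b]] by blast
    have cJ: "c \<in> gap k"
      using in_gap[OF b c] .
    have "lim_value (dn k) \<le> line_form c"
    proof (rule limit_le_left[OF lim c(2)])
      fix x assume "c < x" "x < dn k"
      then show "line_form x \<le> line_form c"
        using line_form_strict_gap[OF cJ in_gap[OF cJ]] by (simp add: less_imp_le)
    qed
    then show ?thesis
      using line_form_strict_gap[OF b cJ c(1)] L by linarith
  qed
  ultimately show ?thesis
    using True by blast
next
  case False
  then obtain e where e: "e > 0" "\<And>\<mu>. \<bar>\<mu> - dn k\<bar> < e \<Longrightarrow> \<mu> < dn k \<Longrightarrow> line_form \<mu> < 0"
    using line_form_near_pole[OF m21_dn] by blast
  obtain a where a: "a \<in> gap k" "dn k - e < a"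
    using gap_near_left[OF e(1)] by blast
  then have "line_form a < 0"
    using gap_less[OF a(1)] by (intro e(2)) auto
  then have "\<not> (\<forall>\<mu>\<in>gap k. line_form \<mu> > 0)"
    using a(1) less_asym by blast
  then show ?thesis
    using False by blast
qed

lemma line_form_right_iff:
  "(\<forall>\<mu>\<in>gap (Suc k). line_form \<mu> < 0) \<longleftrightarrow> \<xi>1 = of_real (m22 (dn k)) * \<xi>0 \<and> lim_value (dn k) \<le> 0"
proof (cases "\<xi>1 = of_real (m22 (dn k)) * \<xi>0")
  case True
  note lim = line_form_limit[OF m21_dn True]
  obtain a where a: "a \<in> gap (Suc k)"
    using gap_near_left[of 1 "Suc k"] by auto
  have gt: "dn k < b" if "b \<in> gap (Suc k)" for b
    using that by (simp add: gap_Suc)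
  have in_gap: "x \<in> gap (Suc k)" if "b \<in> gap (Suc k)" "x < b" "dn k < x" for b x
    using that by (auto simp: gap_Suc)
  have "lim_value (dn k) \<le> 0" if "\<forall>\<mu>\<in>gap (Suc k). line_form \<mu> < 0"
    by (rule limit_le_right[OF lim gt[OF a]]) (use in_gap[OF a] that in \<open>auto intro: less_imp_le\<close>)
  moreover have "line_form b < 0" if L: "lim_value (dn k) \<le> 0" and b: "b \<in> gap (Suc k)" for b
  proof -
    obtain c where c: "dn k < c" "c < b"
      using dense[OF gt[OF b]] by blast
    have cJ: "c \<in> gap (Suc k)"
      using in_gap[OF b c(2,1)] .
    have "lim_value (dn k) \<ge> line_form c"
    proof (rule limit_ge_right[OF lim c(1)])
      fix x assume "dn k < x" "x < c"
      then show "line_form c \<le> line_form x"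
        using line_form_strict_gap[OF in_gap[OF cJ] cJ] by (simp add: less_imp_le)
    qed
    then show ?thesis
      using line_form_strict_gap[OF cJ b c(2)] L by linarith
  qed
  ultimately show ?thesis
    using True by blast
next
  case False
  then obtain e where e: "e > 0" "\<And>\<mu>. \<bar>\<mu> - dn k\<bar> < e \<Longrightarrow> dn k < \<mu> \<Longrightarrow> line_form \<mu> > 0"
    using line_form_near_pole[OF m21_dn] by blast
  obtain a where a: "a \<in> gap (Suc k)" "a < dn k + e"
    using gap_near_right[OF e(1)] by blast
  then have "line_form a > 0"
    by (intro e(2)) (auto simp: gap_Suc)
  then have "\<not> (\<forall>\<mu>\<in>gap (Suc k). line_form \<mu> < 0)"
    using a(1) less_asym by blast
  then show ?thesis
    using False by blast
qed

text \<open>In \<open>gap 0\<close> the form cannot be negative throughout, being positive near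
  -infinity.\<close>

lemma line_form_trichotomy: "(\<exists>\<mu>\<in>gap k. line_form \<mu> = 0) \<or> (\<forall>\<mu>\<in>gap k. line_form \<mu> > 0) \<or> (k > 0 \<and> (\<forall>\<mu>\<in>gap k. line_form \<mu> < 0))"
proof (rule ccontr)
  assume no: "\<not> ?thesis"
  have "\<exists>a\<in>gap k. line_form a > 0"
  proof (cases "k > 0")
    case True
    then show ?thesis
      using no by (metis linorder_cases)
  next
    case False
    obtain K where "\<And>\<mu>. \<mu> \<le> K \<Longrightarrow> line_form \<mu> > 0"
      using line_form_positive by blast
    then show ?thesis
      using False by (intro bexI[of _ "min K (dn 0 - 1)"]) (auto simp: gap_def)
  qed
  moreover have "\<exists>b\<in>gap k. line_form b < 0"
    using no by (metis linorder_cases)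
  ultimately obtain a b where ab: "a \<in> gap k" "line_form a > 0" "b \<in> gap k" "line_form b < 0"
    by blast
  have "a < b"
    using line_form_strict_gap[OF ab(3,1)] ab by (cases a b rule: linorder_cases) auto
  moreover have "\<forall>x. a \<le> x \<and> x \<le> b \<longrightarrow> isCont line_form x"
    using line_form_isCont m21_gap gap_between[OF ab(1,3)] by blast
  ultimately obtain \<mu> where "a \<le> \<mu>" "\<mu> \<le> b" "line_form \<mu> = 0"
    using IVT2[of line_form b 0 a] ab by auto
  then show False
    using no gap_between[OF ab(1,3)] by blast
qed

text \<open>A form that stays positive on the gap has its zero pushed to the right end, one that
  stays negative to the left end; by the trichotomy the latter occurs only for k > 0.\<close>

definition lz1 :: "nat \<Rightarrow> real" where
  "lz1 k = (if \<exists>\<mu>\<in>gap k. line_form \<mu> = 0 then SOME \<mu>. \<mu> \<in> gap k \<and> line_form \<mu> = 0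
     else if \<forall>\<mu>\<in>gap k. line_form \<mu> > 0 then dn k else dn (k - 1))"

lemma lz1_cases:
  "(lz1 k \<in> gap k \<and> line_form (lz1 k) = 0) \<or> (lz1 k = dn k \<and> (\<forall>\<mu>\<in>gap k. line_form \<mu> > 0)) \<or>
   (k > 0 \<and> lz1 k = dn (k - 1) \<and> (\<forall>\<mu>\<in>gap k. line_form \<mu> < 0))"
proof (cases "\<exists>\<mu>\<in>gap k. line_form \<mu> = 0")
  case True
  then have "\<exists>\<mu>. \<mu> \<in> gap k \<and> line_form \<mu> = 0"
    by blast
  from someI_ex[OF this] show ?thesis
    unfolding lz1_def if_P[OF True] by blast
next
  case False
  obtain a where a: "a \<in> gap k"
    using gap_near_left[of 1 k] by auto
  show ?thesis
  proof (cases "\<forall>\<mu>\<in>gap k. line_form \<mu> > 0")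
    case pos: True
    show ?thesis
      unfolding lz1_def if_not_P[OF False] if_P[OF pos] using pos by blast
  next
    case notpos: False
    then show ?thesis
      unfolding lz1_def if_not_P[OF False] if_not_P[OF notpos] using line_form_trichotomy[of k] False by blast
  qed
qed

lemma lz1_bounds: "lz1 k \<le> dn k" "dn k \<le> lz1 (Suc k)"
proof -
  show "lz1 k \<le> dn k"
    using lz1_cases[of k] gap_less[of "lz1 k" k] by (auto intro: less_imp_le)
  show "dn k \<le> lz1 (Suc k)"
    using lz1_cases[of "Suc k"] by (auto simp: gap_Suc)
qed

lemma lz1_mono: "mono lz1"
  unfolding mono_iff_le_Suc using lz1_bounds order_trans by blast

lemma lz1_gap_iff:
  assumes "\<mu> \<in> gap k"
  shows "lz1 i = \<mu> \<longleftrightarrow> i = k \<and> line_form \<mu> = 0"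
proof
  assume eq: "lz1 i = \<mu>"
  then have "\<mu> \<in> gap i \<and> line_form \<mu> = 0"
    using lz1_cases[of i] gap_neq_dn[OF assms] by metis
  then show "i = k \<and> line_form \<mu> = 0"
    using gap_unique[OF assms] by blast
next
  assume a: "i = k \<and> line_form \<mu> = 0"
  then have "lz1 i \<in> gap k \<and> line_form (lz1 i) = 0"
    using lz1_cases[of i] assms by force
  then show "lz1 i = \<mu>"
    using line_form_strict_gap[of "lz1 i" k \<mu>] line_form_strict_gap[of \<mu> k "lz1 i"] assms a
    by (cases "lz1 i" \<mu> rule: linorder_cases) auto
qed

text \<open>The two alternatives concern different indices and may both occur for one k; then
  \<open>dn k\<close> is a double eigenvalue.\<close>

lemma lz1_dn_iff:
  "lz1 i = dn k \<longleftrightarrow> (i = k \<and> (\<forall>\<mu>\<in>gap k. line_form \<mu> > 0)) \<or> (i = Suc k \<and> (\<forall>\<mu>\<in>gap (Suc k). line_form \<mu> < 0))"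
proof -
  obtain a where a: "a \<in> gap i"
    using gap_near_left[of 1 i] by auto
  have n: "lz1 i \<in> gap i \<Longrightarrow> lz1 i \<noteq> dn k"
    by (rule gap_neq_dn)
  consider (zero) "lz1 i \<in> gap i" "line_form (lz1 i) = 0" | (pos) "lz1 i = dn i" "\<forall>\<mu>\<in>gap i. line_form \<mu> > 0"
    | (neg) "i > 0" "lz1 i = dn (i - 1)" "\<forall>\<mu>\<in>gap i. line_form \<mu> < 0"
    using lz1_cases[of i] by blast
  then show ?thesis
  proof cases
    case zero
    then show ?thesis
      using n[OF zero(1)] by force
  next
    case pos
    have "\<not> (\<forall>\<mu>\<in>gap i. line_form \<mu> < 0)"
      using pos(2) a by force
    then show ?thesis
      using pos by auto
  next
    case neg
    have "\<not> (\<forall>\<mu>\<in>gap i. line_form \<mu> > 0)"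
      using neg(3) a by force
    then show ?thesis
      using neg by (cases i) auto
  qed
qed

lemma bv_mem_line:
  "bv \<mu> \<alpha> \<beta> \<in> Lag_line \<xi>0 \<xi>1 h \<longleftrightarrow> (\<exists>s. \<beta> = s * \<xi>0 \<and>
     of_real (m21 \<mu>) * \<alpha> + of_real (m22 \<mu>) * \<beta> = s * \<xi>1 \<and>
     - \<alpha> * cnj \<xi>0 + (of_real (m11 \<mu>) * \<alpha> + of_real (m12 \<mu>) * \<beta>) * cnj \<xi>1 = of_real h * s)"
  by (simp add: Lag_line_def)

text \<open>Multiplying the last equation by \<open>m21\<close> eliminates \<alpha>, and the
  determinant relation turns its left side into \<open>gram\<close> times s. What remains is
  \<open>line_form\<close> times s equal to 0.\<close>

lemma mult_line_regular:
  assumes c: "m21 \<mu> \<noteq> 0"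
  shows "geom_mult (Lag_line \<xi>0 \<xi>1 h) \<mu> = (if line_form \<mu> = 0 then 1 else 0)"
proof -
  let ?c = "of_real (m21 \<mu>) :: complex"
  have c0: "?c \<noteq> 0"
    using c by simp
  have key: "?c * (- \<alpha> * cnj \<xi>0 + (of_real (m11 \<mu>) * \<alpha> + of_real (m12 \<mu>) * \<beta>) * cnj \<xi>1) = ?c * (of_real (line_form \<mu> + h) * s)"
    if s: "\<beta> = s * \<xi>0" "?c * \<alpha> + of_real (m22 \<mu>) * \<beta> = s * \<xi>1" for \<alpha> \<beta> s
  proof -
    have \<alpha>: "?c * \<alpha> = s * \<xi>1 - of_real (m22 \<mu>) * (s * \<xi>0)"
      using s by (simp add: algebra_simps)
    have "?c * (- \<alpha> * cnj \<xi>0 + (of_real (m11 \<mu>) * \<alpha> + of_real (m12 \<mu>) * \<beta>) * cnj \<xi>1)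
        = - (?c * \<alpha>) * cnj \<xi>0 + (of_real (m11 \<mu>) * (?c * \<alpha>) + ?c * of_real (m12 \<mu>) * (s * \<xi>0)) * cnj \<xi>1"
      unfolding s(1) by (simp add: algebra_simps)
    also have "\<dots> = s * (of_real (m22 \<mu>) * (\<xi>0 * cnj \<xi>0) - \<xi>1 * cnj \<xi>0 + of_real (m11 \<mu>) * (\<xi>1 * cnj \<xi>1)
        - (of_real (m11 \<mu>) * of_real (m22 \<mu>) - ?c * of_real (m12 \<mu>)) * (\<xi>0 * cnj \<xi>1))"
      unfolding \<alpha> by (simp add: algebra_simps)
    also have "\<dots> = s * of_real (gram \<mu>)"
      unfolding gram_complex det_m_complex by (simp add: algebra_simps)
    also have "gram \<mu> = m21 \<mu> * (line_form \<mu> + h)"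
      using c by (simp add: line_form_gram)
    finally show ?thesis
      by (simp add: mult_ac)
  qed
  have all: "\<not> (\<forall>\<alpha> \<beta>. bv \<mu> \<alpha> \<beta> \<in> Lag_line \<xi>0 \<xi>1 h)"
  proof
    assume "\<forall>\<alpha> \<beta>. bv \<mu> \<alpha> \<beta> \<in> Lag_line \<xi>0 \<xi>1 h"
    then have "bv \<mu> 1 0 \<in> Lag_line \<xi>0 \<xi>1 h" "bv \<mu> 0 1 \<in> Lag_line \<xi>0 \<xi>1 h"
      by blast+
    then obtain s s' where "0 = s * \<xi>0" "?c = s * \<xi>1" "1 = s' * \<xi>0"
      unfolding bv_mem_line by auto
    then show False
      using c0 by auto
  qed
  have none: "(\<forall>\<alpha> \<beta>. bv \<mu> \<alpha> \<beta> \<in> Lag_line \<xi>0 \<xi>1 h \<longrightarrow> \<alpha> = 0 \<and> \<beta> = 0) \<longleftrightarrow> line_form \<mu> \<noteq> 0"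
  proof
    assume L: "\<forall>\<alpha> \<beta>. bv \<mu> \<alpha> \<beta> \<in> Lag_line \<xi>0 \<xi>1 h \<longrightarrow> \<alpha> = 0 \<and> \<beta> = 0"
    show "line_form \<mu> \<noteq> 0"
    proof
      assume f0: "line_form \<mu> = 0"
      define \<alpha> where "\<alpha> = (\<xi>1 - of_real (m22 \<mu>) * \<xi>0) / ?c"
      have e: "?c * \<alpha> + of_real (m22 \<mu>) * \<xi>0 = 1 * \<xi>1"
        using c0 by (simp add: \<alpha>_def)
      have "- \<alpha> * cnj \<xi>0 + (of_real (m11 \<mu>) * \<alpha> + of_real (m12 \<mu>) * \<xi>0) * cnj \<xi>1 = of_real h * 1"
        using key[OF _ e] f0 c0 by simp
      then have "bv \<mu> \<alpha> \<xi>0 \<in> Lag_line \<xi>0 \<xi>1 h"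
        unfolding bv_mem_line using e by (intro exI[of _ 1]) simp
      then have "\<alpha> = 0 \<and> \<xi>0 = 0"
        using L by blast
      then show False
        using \<xi> e by auto
    qed
  next
    assume f0: "line_form \<mu> \<noteq> 0"
    show "\<forall>\<alpha> \<beta>. bv \<mu> \<alpha> \<beta> \<in> Lag_line \<xi>0 \<xi>1 h \<longrightarrow> \<alpha> = 0 \<and> \<beta> = 0"
    proof (intro allI impI)
      fix \<alpha> \<beta> assume "bv \<mu> \<alpha> \<beta> \<in> Lag_line \<xi>0 \<xi>1 h"
      then obtain s where s: "\<beta> = s * \<xi>0" "?c * \<alpha> + of_real (m22 \<mu>) * \<beta> = s * \<xi>1"
        "- \<alpha> * cnj \<xi>0 + (of_real (m11 \<mu>) * \<alpha> + of_real (m12 \<mu>) * \<beta>) * cnj \<xi>1 = of_real h * s"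
        unfolding bv_mem_line by blast
      have "?c * (of_real h * s) = ?c * (of_real (line_form \<mu> + h) * s)"
        using key[OF s(1,2)] unfolding s(3) .
      then have "of_real (line_form \<mu>) * s = 0"
        using c0 by (simp add: algebra_simps)
      then have "s = 0"
        using f0 by simp
      then show "\<alpha> = 0 \<and> \<beta> = 0"
        using s c0 by simp
    qed
  qed
  show ?thesis
    unfolding geom_mult_def if_not_P[OF all] none by simp
qed

text \<open>At a pole y(0) drops out of x(T). For \<xi> in the direction (1, m22) it drops out of
  the relation for Y too, so the solution vanishing at both ends satisfies the condition, and all
  solutions do if \<open>lim_value\<close> is 0. In any other direction both x(0) and y(0) are
  forced to be 0.\<close>

lemma mult_line_singular:
  assumes c: "m21 \<mu> = 0"
  shows "geom_mult (Lag_line \<xi>0 \<xi>1 h) \<mu> =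
    (if \<xi>1 \<noteq> of_real (m22 \<mu>) * \<xi>0 then 0 else if lim_value \<mu> = 0 then 2 else 1)"
proof -
  have d: "of_real (m11 \<mu>) * of_real (m22 \<mu>) = (1 :: complex)"
    using det_m_complex[of \<mu>] c by simp
  have d0: "of_real (m22 \<mu>) \<noteq> (0 :: complex)"
    using d by auto
  show ?thesis
  proof (cases "\<xi>1 = of_real (m22 \<mu>) * \<xi>0")
    case False
    have "\<alpha> = 0 \<and> \<beta> = 0" if m: "bv \<mu> \<alpha> \<beta> \<in> Lag_line \<xi>0 \<xi>1 h" for \<alpha> \<beta>
    proof -
      obtain s where s: "\<beta> = s * \<xi>0" "of_real (m22 \<mu>) * \<beta> = s * \<xi>1"
        "- \<alpha> * cnj \<xi>0 + (of_real (m11 \<mu>) * \<alpha> + of_real (m12 \<mu>) * \<beta>) * cnj \<xi>1 = of_real h * s"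
        using m unfolding bv_mem_line c of_real_0 mult_zero_left add_0_left by blast
      have "s * (\<xi>1 - of_real (m22 \<mu>) * \<xi>0) = s * \<xi>1 - of_real (m22 \<mu>) * (s * \<xi>0)"
        by (simp add: algebra_simps)
      also have "\<dots> = 0"
        unfolding s(1)[symmetric] s(2)[symmetric] by simp
      finally have "s * (\<xi>1 - of_real (m22 \<mu>) * \<xi>0) = 0" .
      then have s0: "s = 0"
        using False by auto
      then have \<beta>: "\<beta> = 0"
        using s by simp
      have "\<alpha> * (of_real (m11 \<mu>) * cnj \<xi>1 - cnj \<xi>0) = 0"
        using s(3) s0 \<beta> by (simp add: algebra_simps)
      moreover have "of_real (m11 \<mu>) * cnj \<xi>1 - cnj \<xi>0 \<noteq> 0"
      proof
        assume "of_real (m11 \<mu>) * cnj \<xi>1 - cnj \<xi>0 = 0"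
        then have "cnj (of_real (m11 \<mu>) * cnj \<xi>1) = cnj (cnj \<xi>0)"
          by simp
        then have "of_real (m11 \<mu>) * \<xi>1 = \<xi>0"
          by simp
        then have "of_real (m22 \<mu>) * \<xi>0 = (of_real (m11 \<mu>) * of_real (m22 \<mu>)) * \<xi>1"
          by (simp add: mult_ac)
        then show False
          using False unfolding d by simp
      qed
      ultimately show ?thesis
        using \<beta> by simp
    qed
    moreover have "\<not> (\<forall>\<alpha> \<beta>. bv \<mu> \<alpha> \<beta> \<in> Lag_line \<xi>0 \<xi>1 h)"
      using calculation[of 1 0] by auto
    ultimately show ?thesis
      using False unfolding geom_mult_def by auto
  next
    case True
    have \<xi>0: "\<xi>0 \<noteq> 0"
      using \<xi> True by auto
    have mem: "bv \<mu> \<alpha> \<beta> \<in> Lag_line \<xi>0 \<xi>1 h \<longleftrightarrow> of_real (lim_value \<mu>) * \<beta> = 0" for \<alpha> \<beta>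
    proof -
      define s where "s = \<beta> / \<xi>0"
      have \<beta>: "\<beta> = s * \<xi>0"
        using \<xi>0 by (simp add: s_def)
      have uniq: "\<beta> = s' * \<xi>0 \<longleftrightarrow> s' = s" for s'
        using \<xi>0 by (auto simp: \<beta>)
      have "- \<alpha> * cnj \<xi>0 + (of_real (m11 \<mu>) * \<alpha> + of_real (m12 \<mu>) * \<beta>) * cnj \<xi>1
          = (of_real (m11 \<mu>) * of_real (m22 \<mu>) - 1) * (\<alpha> * cnj \<xi>0) + of_real (m12 \<mu>) * of_real (m22 \<mu>) * (\<xi>0 * cnj \<xi>0) * s"
        unfolding \<beta> True by (simp add: algebra_simps)
      also have "\<dots> = of_real ((norm \<xi>0)\<^sup>2 * (m12 \<mu> * m22 \<mu>)) * s"
        unfolding d complex_norm_square[symmetric] by (simp add: mult_ac)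
      finally have e: "- \<alpha> * cnj \<xi>0 + (of_real (m11 \<mu>) * \<alpha> + of_real (m12 \<mu>) * \<beta>) * cnj \<xi>1
          = of_real ((norm \<xi>0)\<^sup>2 * (m12 \<mu> * m22 \<mu>)) * s" .
      have "bv \<mu> \<alpha> \<beta> \<in> Lag_line \<xi>0 \<xi>1 h \<longleftrightarrow> of_real ((norm \<xi>0)\<^sup>2 * (m12 \<mu> * m22 \<mu>)) * s = of_real h * s"
        unfolding bv_mem_line e uniq using c True \<beta> by (simp add: mult_ac)
      also have "\<dots> \<longleftrightarrow> of_real (lim_value \<mu>) * s = 0"
        unfolding lim_value_def of_real_diff left_diff_distrib by simp
      also have "\<dots> \<longleftrightarrow> of_real (lim_value \<mu>) * \<beta> = 0"
        using \<xi>0 by (simp add: s_def)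
      finally show ?thesis .
    qed
    have none: "\<not> (\<forall>\<alpha> \<beta>. bv \<mu> \<alpha> \<beta> \<in> Lag_line \<xi>0 \<xi>1 h \<longrightarrow> \<alpha> = 0 \<and> \<beta> = 0)"
      unfolding mem by (metis mult_zero_right zero_neq_one)
    have all: "(\<forall>\<alpha> \<beta>. bv \<mu> \<alpha> \<beta> \<in> Lag_line \<xi>0 \<xi>1 h) \<longleftrightarrow> lim_value \<mu> = 0"
      unfolding mem by (metis mult_cancel_right1 mult_zero_left of_real_eq_0_iff mult.right_neutral)
    show ?thesis
      unfolding geom_mult_def if_not_P[OF none] all using True by simp
  qed
qed

lemma line_Lag: "Lag_line \<xi>0 \<xi>1 h \<in> Lag"
  using layer1_iff[of "Lag_line \<xi>0 \<xi>1 h"] \<xi> by (auto simp: layer_def)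

text \<open>The indices i and i + 1 both yield \<open>dn i\<close> exactly if \<xi> has the
  direction (1, m22) and \<open>lim_value\<close> is 0, in agreement with multiplicity 2.\<close>

lemma eigval_line:
  assumes "j \<ge> 1"
  shows "eigval T P Q R j (Lag_line \<xi>0 \<xi>1 h) = lz1 (j - 1)"
proof (rule eigval_eq[OF eigenvalue_enumerationI[OF line_Lag lz1_mono] assms])
  fix \<mu>
  show "finite {k. lz1 k = \<mu>} \<and> card {k. lz1 k = \<mu>} = geom_mult (Lag_line \<xi>0 \<xi>1 h) \<mu>"
  proof (cases rule: gap_cases[of \<mu>])
    case (1 i)
    show ?thesis
      unfolding lz1_gap_iff[OF 1] mult_line_regular[OF m21_gap[OF 1]] by simp
  next
    case (2 i)
    have m: "m21 \<mu> = 0"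
      using 2 by simp
    have "lz1 k = \<mu> \<longleftrightarrow> (k = i \<and> \<xi>1 = of_real (m22 \<mu>) * \<xi>0 \<and> lim_value \<mu> \<ge> 0)
        \<or> (k = Suc i \<and> \<xi>1 = of_real (m22 \<mu>) * \<xi>0 \<and> lim_value \<mu> \<le> 0)" for k
      unfolding 2 lz1_dn_iff line_form_left_iff line_form_right_iff by blast
    then have "{k. lz1 k = \<mu>} = (if \<xi>1 = of_real (m22 \<mu>) * \<xi>0 \<and> lim_value \<mu> \<ge> 0 then {i} else {})
        \<union> (if \<xi>1 = of_real (m22 \<mu>) * \<xi>0 \<and> lim_value \<mu> \<le> 0 then {Suc i} else {})"
      by auto
    then show ?thesis
      unfolding mult_line_singular[OF m] by auto
  qed
qed

end

section \<open>Ranges of the eigenvalues\<close>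

context sturm_liouville
begin

lemma dirichlet_eigval_eq:
  "dirichlet_eigval T P Q R i = (if i \<le> 0 then -\<infinity> else ereal (dn (nat i - 1)))"
  by (simp add: dirichlet_eigval_def eigval_Dirichlet)

lemma range_layer0:
  assumes j: "j \<ge> 1"
  shows "eigval_range T P Q R j (layer 0) =
    {dirichlet_eigval T P Q R (int j - 2) <..< dirichlet_eigval T P Q R (int j)}"
proof -
  define k where "k = j - 1"
  have up: "dirichlet_eigval T P Q R (int j) = ereal (dn k)"
    using j by (simp add: dirichlet_eigval_eq k_def)
  \<comment> \<open>With j = k + 1, the index j - 2 is positive exactly if k >= 2; the Dirichlet
    eigenvalue number k - 1 is \<open>dn (k - 2)\<close>.\<close>
  have low: "dirichlet_eigval T P Q R (int j - 2) = (if k \<ge> 2 then ereal (dn (k - 2)) else -\<infinity>)"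
  proof (cases "k \<ge> 2")
    case True
    then have "nat (int j - 2) - 1 = k - 2" "\<not> int j - 2 \<le> 0"
      by (simp_all add: k_def)
    then show ?thesis
      using True by (simp add: dirichlet_eigval_eq)
  next
    case False
    then have "int j - 2 \<le> 0"
      by (simp add: k_def)
    then show ?thesis
      using False by (simp add: dirichlet_eigval_eq)
  qed
  have mem: "ereal \<mu> \<in> {dirichlet_eigval T P Q R (int j - 2) <..< dirichlet_eigval T P Q R (int j)} \<longleftrightarrow> \<mu> \<in> window k" for \<mu>
    unfolding up low by (auto simp: window_def)
  show ?thesis
  proof (intro equalityI subsetI)
    fix x assume "x \<in> eigval_range T P Q R j (layer 0)"
    then obtain h11 h22 h12 where x: "x = ereal (eigval T P Q R j (Lag_graph h11 h22 h12))"
      unfolding eigval_range_def layer0_iff by blast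
    interpret graph_condition T P Q R h11 h22 h12
      by unfold_locales
    show "x \<in> {dirichlet_eigval T P Q R (int j - 2) <..< dirichlet_eigval T P Q R (int j)}"
      unfolding x eigval_graph[OF j] mem k_def by (rule lz)
  next
    fix x assume x: "x \<in> {dirichlet_eigval T P Q R (int j - 2) <..< dirichlet_eigval T P Q R (int j)}"
    then obtain \<mu> where \<mu>: "x = ereal \<mu>"
      unfolding up by (cases x) auto
    have window: "\<mu> \<in> window k"
      using x unfolding \<mu> mem .
    have realise: "x \<in> eigval_range T P Q R j (layer 0)"
      if "graph_condition.Th T P Q R h11 h22 h12 k \<mu> = 0" for h11 h22 h12
    proof -
      interpret graph_condition T P Q R h11 h22 h12
        by unfold_locales
      have "lz k = \<mu>"
        using window that by (simp add: lz_eq_iff)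
      then have "x = ereal (eigval T P Q R j (Lag_graph h11 h22 h12))"
        using eigval_graph[OF j] by (simp add: \<mu> k_def)
      then show ?thesis
        unfolding eigval_range_def layer0_iff by blast
    qed
    have regular: "x \<in> eigval_range T P Q R j (layer 0)" if "\<mu> \<in> gap i" "i = k \<or> k = Suc i" for i
    proof -
      \<comment> \<open>For this H both eigenvalues of N - H vanish at \<mu>, so it does not matter
        which of the two branches runs through the gap.\<close>
      interpret graph_condition T P Q R "m22 \<mu> / m21 \<mu>" "m11 \<mu> / m21 \<mu>" "of_real (- 1 / m21 \<mu>)"
        by unfold_locales
      have "th1 \<mu> = 0 \<and> th2 \<mu> = 0"
        unfolding th1_def th2_def hmin_hmax_zero_iff e11_def e22_def e12_def by simp
      then have "Th k \<mu> = 0"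
        using that(2) Th_gap[OF that(1)] by auto
      then show ?thesis
        by (rule realise)
    qed
    show "x \<in> eigval_range T P Q R j (layer 0)"
    proof (cases k)
      case 0
      then show ?thesis
        using window regular[of 0] by (simp add: window_0)
    next
      case (Suc i)
      then consider "\<mu> \<in> gap i" | "\<mu> = dn i" | "\<mu> \<in> gap (Suc i)"
        using window unfolding Suc window_Suc by blast
      then show ?thesis
      proof cases
        case 2
        \<comment> \<open>At a pole with h11 = h22 = 0, \<open>Del\<close> reduces to m12 - 2 Re
          h12; this h12 makes it 0.\<close>
        interpret graph_condition T P Q R 0 0 "of_real (m12 \<mu> / 2)"
          by unfold_locales
        have "Del \<mu> = 0"
          unfolding Del_def using 2 by simp
        then have "Th k \<mu> = 0"
          using 2 unfolding Th_def Suc by simp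
        then show ?thesis
          by (rule realise)
      qed (use regular Suc in auto)
    qed
  qed
qed

lemma eigval_layer1:
  assumes \<Lambda>: "\<Lambda> \<in> layer 1"
  shows "eigval T P Q R (Suc k) \<Lambda> \<le> dn k" "dn k \<le> eigval T P Q R (Suc (Suc k)) \<Lambda>"
proof -
  obtain \<xi>0 \<xi>1 h where \<xi>: "\<xi>0 \<noteq> 0 \<or> \<xi>1 \<noteq> 0" and L: "\<Lambda> = Lag_line \<xi>0 \<xi>1 h"
    using \<Lambda> unfolding layer1_iff by blast
  interpret line_condition T P Q R \<xi>0 \<xi>1 h
    by unfold_locales (rule \<xi>)
  show "eigval T P Q R (Suc k) \<Lambda> \<le> dn k" "dn k \<le> eigval T P Q R (Suc (Suc k)) \<Lambda>"
    unfolding L using eigval_line[of "Suc k"] eigval_line[of "Suc (Suc k)"] lz1_bounds[of k] by simp_all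
qed

lemma realise_regular:
  assumes \<mu>: "\<mu> \<in> gap k"
  shows "\<exists>\<Lambda>\<in>layer 1. eigval T P Q R (Suc k) \<Lambda> = \<mu>"
proof -
  \<comment> \<open>Here \<xi> = (1, 0) and h is the value of the form at \<mu>, which places the
    zero of \<open>line_form\<close> at \<mu>.\<close>
  interpret line_condition T P Q R 1 0 "qf \<mu> 1 0"
    by unfold_locales simp
  have "line_form \<mu> = 0"
    unfolding line_form_def by (simp add: qf_def)
  then have "lz1 k = \<mu>"
    using lz1_gap_iff[OF \<mu>] by simp
  moreover have "Lag_line 1 0 (qf \<mu> 1 0) \<in> layer 1"
    unfolding layer1_iff using \<xi> by blast
  ultimately show ?thesis
    using eigval_line[of "Suc k"] by (intro bexI) simp_all
qed

text \<open>Take \<xi> in the direction that the pole does not affect and h equal to the limit of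
  the form, so that \<open>lim_value\<close> is 0. The double eigenvalue attains the right end of
  one range and the left end of the next.\<close>

lemma realise_Dirichlet:
  "\<exists>\<Lambda>\<in>layer 1. eigval T P Q R (Suc k) \<Lambda> = dn k \<and> eigval T P Q R (Suc (Suc k)) \<Lambda> = dn k"
proof -
  let ?d = "dn k"
  interpret line_condition T P Q R 1 "of_real (m22 ?d)" "m12 ?d * m22 ?d"
    by unfold_locales simp
  have "lim_value ?d = 0"
    by (simp add: lim_value_def)
  then have "lz1 k = ?d" "lz1 (Suc k) = ?d"
    using lz1_dn_iff[of k k] lz1_dn_iff[of "Suc k" k] line_form_left_iff[of k] line_form_right_iff[of k] by simp_all
  moreover have "Lag_line 1 (of_real (m22 ?d)) (m12 ?d * m22 ?d) \<in> layer 1"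
    unfolding layer1_iff using \<xi> by blast
  ultimately show ?thesis
    using eigval_line[of "Suc k"] eigval_line[of "Suc (Suc k)"] by (intro bexI) simp_all
qed

lemma range_layer1_first:
  "eigval_range T P Q R 1 (layer 1) = {-\<infinity> <.. dirichlet_eigval T P Q R 1}"
proof (intro equalityI subsetI)
  fix x assume "x \<in> eigval_range T P Q R 1 (layer 1)"
  then show "x \<in> {-\<infinity> <.. dirichlet_eigval T P Q R 1}"
    using eigval_layer1(1)[of _ 0] by (auto simp: eigval_range_def dirichlet_eigval_eq)
next
  fix x assume x: "x \<in> {-\<infinity> <.. dirichlet_eigval T P Q R 1}"
  then obtain \<mu> where \<mu>: "x = ereal \<mu>" "\<mu> \<le> dn 0"
    by (cases x) (auto simp: dirichlet_eigval_eq)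
  have "\<exists>\<Lambda>\<in>layer 1. eigval T P Q R (Suc 0) \<Lambda> = \<mu>"
    using \<mu>(2) realise_regular[of \<mu> 0] realise_Dirichlet[of 0] by (cases "\<mu> = dn 0") (auto simp: gap_def)
  then show "x \<in> eigval_range T P Q R 1 (layer 1)"
    unfolding eigval_range_def \<mu>(1) by auto
qed

lemma range_layer1:
  assumes j: "j \<ge> 2"
  shows "eigval_range T P Q R j (layer 1) =
    {dirichlet_eigval T P Q R (int j - 1) .. dirichlet_eigval T P Q R (int j)}"
proof -
  define k where "k = j - 2"
  have jk: "j = Suc (Suc k)"
    using j by (simp add: k_def)
  have up: "dirichlet_eigval T P Q R (int j) = ereal (dn (Suc k))"
    and low: "dirichlet_eigval T P Q R (int j - 1) = ereal (dn k)"
    unfolding jk dirichlet_eigval_eq by (simp_all add: nat_add_distrib)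
  show ?thesis
  proof (intro equalityI subsetI)
    fix x assume "x \<in> eigval_range T P Q R j (layer 1)"
    then show "x \<in> {dirichlet_eigval T P Q R (int j - 1) .. dirichlet_eigval T P Q R (int j)}"
      unfolding up low using eigval_layer1(1)[of _ "Suc k"] eigval_layer1(2)[of _ k]
      by (auto simp: eigval_range_def jk)
  next
    fix x assume "x \<in> {dirichlet_eigval T P Q R (int j - 1) .. dirichlet_eigval T P Q R (int j)}"
    then obtain \<mu> where \<mu>: "x = ereal \<mu>" "dn k \<le> \<mu>" "\<mu> \<le> dn (Suc k)"
      unfolding up low by (cases x) auto
    then consider "\<mu> = dn k" | "\<mu> = dn (Suc k)" | "\<mu> \<in> gap (Suc k)"
      unfolding gap_Suc by fastforce
    then have "\<exists>\<Lambda>\<in>layer 1. eigval T P Q R j \<Lambda> = \<mu>"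
      using realise_regular[of \<mu> "Suc k"] realise_Dirichlet[of k] realise_Dirichlet[of "Suc k"]
      unfolding jk by cases blast+
    then show "x \<in> eigval_range T P Q R j (layer 1)"
      unfolding eigval_range_def \<mu>(1) by auto
  qed
qed

lemma range_layer2:
  assumes "j \<ge> 1"
  shows "eigval_range T P Q R j (layer 2) = {dirichlet_eigval T P Q R (int j)}"
  using assms by (auto simp: eigval_range_def layer2_eq dirichlet_eigval_def)

end

theorem corollary1p4:
  fixes T :: real and P Q R :: "real \<Rightarrow> real" and j :: nat
  assumes "T > 0"
    and "H1 T P" and "H1 T Q" and "continuous_on {0..T} R"
    and "\<forall>t\<in>{0..T}. P t > 0"
    and "j \<ge> 1"
  shows "eigval_range T P Q R j (layer 0) =
           {dirichlet_eigval T P Q R (int j - 2) <..< dirichlet_eigval T P Q R (int j)}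
       \<and> (eigval_range T P Q R 1 (layer 1) = {-\<infinity> <.. dirichlet_eigval T P Q R 1}
          \<and> (j \<ge> 2 \<longrightarrow> eigval_range T P Q R j (layer 1) =
               {dirichlet_eigval T P Q R (int j - 1) .. dirichlet_eigval T P Q R (int j)}))
       \<and> eigval_range T P Q R j (layer 2) = {dirichlet_eigval T P Q R (int j)}"
proof -
  interpret sturm_liouville T P Q R
    by unfold_locales (use assms in auto)
  show ?thesis
    using range_layer0[OF \<open>j \<ge> 1\<close>] range_layer1_first range_layer1 range_layer2[OF \<open>j \<ge> 1\<close>] by blast
qed

end
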